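(* Let $(c_i)_{i=1}^s$ be distinct and let $\{u_i\}_{i=1}^s$ satisfy the collocation condition. If the corresponding $s$-stage FEPTRKN method has collocation parameters $(c_i)_{i=1}^s$ that satisfy $$\int_{0}^1\int_{0}^{1+x}\int_0^t\prod_{i=1}^s(\xi-c_i)\,d\xi\, dt\, dx = 0,\qquad \int_{0}^1 \xi^k\prod_{i=1}^s(\xi-c_i)\,d\xi = 0,\quad k=0,1,2,$$ then the method has step order $p=s+3$.
   Context: Setting: the scalar initial value problem $y''(t)=f(t,y(t))$, $y(t_0)=y_0$, $y'(t_0)=y_0'$, $t\in[t_0,t_0+T]$, where $f:[t_0,t_0+T]\times\mathbb{R}\to\mathbb{R}$ is continuous with respect to $t$ and satisfies a Lipschitz condition with respect to $y$; $y(t)$ denotes the exact solution. Notation: $\mathbf{c}=(c_1,\dots,c_s)^T$, $\mathbf{e}=(1,\dots,1)^T\in\mathbb{R}^s$; for a scalar function $v$, $v(\mathbf{e}t+\mathbf{c}h)=(v(t+c_1h),\dots,v(t+c_sh))^T$; $f(\mathbf{e}t+\mathbf{c}h,\mathbf{Y})=(f(t+c_1h,Y_1),\dots,f(t+c_sh,Y_s))^T$; $h$ is the stepsize and $t_{n+1}=t_n+h$. Collocation condition: a set of sufficiently smooth functions $\{u_1,\dots,u_s\}$ satisfies the collocation condition if for any given $t\in[t_0,t_0+T)$ the $s\times s$ matrix $\mathbf{F}(t,h)=\big(u_1''(\mathbf{e}t+\mathbf{c}h),\dots,u_s''(\mathbf{e}t+\mathbf{c}h)\big)$ (listed by columns)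 is nonsingular for almost every $h\in[0,h_{\max}]$, where $h_{\max}>0$ is a constant. FEPTRKN method (functionally-fitted explicit pseudo two-step Runge-Kutta-Nyström method) with respect to the basis functions $\{u_i\}_{i=1}^s$: its coefficients $\mathbf{A}(t,h)\in\mathbb{R}^{s\times s}$, $\mathbf{b}(t,h),\mathbf{d}(t,h)\in\mathbb{R}^s$ satisfy, for all $i=1,\dots,s$, $$u_i(t+h)=u_i(t)+hu_i'(t)+h^2\mathbf{b}^T(t,h)u_i''(\mathbf{e}t+\mathbf{c}h),$$ $$u_i'(t+h)=u_i'(t)+h\mathbf{d}^T(t,h)u_i''(\mathbf{e}t+\mathbf{c}h),$$ $$u_i(\mathbf{e}t+\mathbf{c}h+\mathbf{e}h)=\mathbf{e}u_i(t+h)+h\mathbf{c}u_i'(t+h)+h^2\mathbf{A}(t,h)u_i''(\mathbf{e}t+\mathbf{c}h)$$ (these linear systems determine the coefficients whenever $h>0$ and $\mathbf{F}(t,h)$ is nonsingular). One step of the method maps $(y_n,y_n',\mathbf{Y}_n)$, where $y_n\approx y(t_n)$, $y_n'\approx y'(t_n)$, $\mathbf{Y}_n\approx y(\mathbf{e}t_n+\mathbf{c}h)$, to $$y_{n+1}=y_n+hy_n'+h^2\mathbf{b}^T(t_n,h)f(\mathbf{e}t_n+\mathbf{c}h,\mathbf{Y}_n),\qquad y_{n+1}'=y_n'+h\mathbf{d}^T(t_n,h)f(\mathbf{e}t_n+\mathbf{c}h,\mathbf{Y}_n),$$ $$\mathbf{Y}_{n+1}=\mathbf{e}y_{n+1}+h\mathbf{c}y_{n+1}'+h^2\mathbf{A}(t_n,h)f(\mathbf{e}t_n+\mathbf{c}h,\mathbf{Y}_n).$$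 Orders: the method is said to have step order $p=\min\{p_1,p_2\}$ and stage order $r=\min\{p_1,p_2,p_3\}$ if $$y(t_{n+1})-y_{n+1}=O(h^{p_1+1}),\quad y'(t_{n+1})-y'_{n+1}=O(h^{p_2+1}),\quad y(\mathbf{e}t_{n+1}+\mathbf{c}h)-\mathbf{Y}_{n+1}=O(h^{p_3+1}),$$ given that $y_n=y(t_n)$, $y_n'=y'(t_n)$, and $y(\mathbf{e}t_n+\mathbf{c}h)-\mathbf{Y}_n=O(h^{p_3+1})$.
   Formalization: Proved with f_y existing and locally Lipschitz, y and u_i in C^{s+5}, Y_n taken from the method's preceding step (so not for the first step), and only at t_n where the Wronskian of the u_i'' is nonzero (shown open and dense); the literal claim fails otherwise. *)

theory Defs
  imports "HOL-Analysis.Analysis" "HOL-Library.Landau_Symbols"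
begin

text \<open>
  The number of stages is \<^term>\<open>CARD('s)\<close> for a finite index type; vectors in R^s are of type
  \<^typ>\<open>real ^ 's\<close>. The vector written e x in the mathematical notation is \<^term>\<open>vec x\<close>.
\<close>

section \<open>The initial value problem\<close>

text \<open>One-sided derivatives are used at the end points when S is a compact interval.\<close>

definition Ck_on :: "nat \<Rightarrow> real set \<Rightarrow> (real \<Rightarrow> real) \<Rightarrow> bool" where
  "Ck_on k S g \<longleftrightarrow>
     (\<exists>G :: nat \<Rightarrow> real \<Rightarrow> real.
        (\<forall>t\<in>S. G 0 t = g t) \<and>
        (\<forall>j<k. \<forall>t\<in>S. (G j has_real_derivative G (Suc j) t) (at t within S)) \<and>
        continuous_on S (G k))"

definition admissible_rhs :: "real \<Rightarrow> real \<Rightarrow> (real \<Rightarrow> real \<Rightarrow> real) \<Rightarrow> bool" where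
  "admissible_rhs t0 T f \<longleftrightarrow>
     (\<forall>v. continuous_on {t0..t0+T} (\<lambda>t. f t v)) \<and>
     (\<exists>L. \<forall>t\<in>{t0..t0+T}. L-lipschitz_on UNIV (f t))"

text \<open>
  The smoothness of f in its second argument that is used by the order theory beyond the Lipschitz
  condition. Every twice continuously differentiable f has this property. It cannot be
  dropped: with a kink of f along the solution, stage errors need not cancel in the sum weighted
  by d.
\<close>

definition smooth_rhs :: "real \<Rightarrow> real \<Rightarrow> (real \<Rightarrow> real \<Rightarrow> real) \<Rightarrow> bool" where
  "smooth_rhs t0 T f \<longleftrightarrow>
     (\<exists>fy :: real \<Rightarrow> real \<Rightarrow> real.
        (\<forall>t\<in>{t0..t0+T}. \<forall>v. (f t has_real_derivative fy t v) (at v)) \<and>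
        (\<forall>R. \<exists>L. L-lipschitz_on ({t0..t0+T} \<times> {-R..R}) (\<lambda>(t, v). fy t v)))"

definition solves_ivp ::
  "real \<Rightarrow> real \<Rightarrow> (real \<Rightarrow> real \<Rightarrow> real) \<Rightarrow> real \<Rightarrow> real \<Rightarrow> (real \<Rightarrow> real) \<Rightarrow> (real \<Rightarrow> real) \<Rightarrow> bool" where
  "solves_ivp t0 T f y0 dy0 y dy \<longleftrightarrow>
     y t0 = y0 \<and> dy t0 = dy0 \<and>
     (\<forall>t\<in>{t0..t0+T}. (y has_real_derivative dy t) (at t within {t0..t0+T}) \<and>
                     (dy has_real_derivative f t (y t)) (at t within {t0..t0+T}))"


section \<open>Functionally-fitted methods\<close>

definition at_stages :: "real ^ 's \<Rightarrow> (real \<Rightarrow> real) \<Rightarrow> real \<Rightarrow> real \<Rightarrow> real ^ 's" where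
  "at_stages c v t h = (\<chi> i. v (t + c $ i * h))"

definition rhs_at_stages ::
  "real ^ 's \<Rightarrow> (real \<Rightarrow> real \<Rightarrow> real) \<Rightarrow> real \<Rightarrow> real \<Rightarrow> real ^ 's \<Rightarrow> real ^ 's" where
  "rhs_at_stages c f t h Y = (\<chi> i. f (t + c $ i * h) (Y $ i))"

definition d2 :: "(real \<Rightarrow> real) \<Rightarrow> real \<Rightarrow> real" where
  "d2 v = deriv (deriv v)"

definition collocation_matrix ::
  "real ^ 's \<Rightarrow> ('s \<Rightarrow> real \<Rightarrow> real) \<Rightarrow> real \<Rightarrow> real \<Rightarrow> real ^ 's ^ 's" where
  "collocation_matrix c u t h = (\<chi> i j. at_stages c (d2 (u j)) t h $ i)"

definition collocation_condition ::
  "real \<Rightarrow> real \<Rightarrow> real \<Rightarrow> real ^ 's::finite \<Rightarrow> ('s \<Rightarrow> real \<Rightarrow> real) \<Rightarrow> bool" where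
  "collocation_condition t0 T hmax c u \<longleftrightarrow>
     0 < hmax \<and>
     (\<forall>t\<in>{t0..<t0+T}. AE h in lborel. h \<in> {0..hmax} \<longrightarrow> invertible (collocation_matrix c u t h))"

text \<open>
  The coefficients are constrained only where the linear systems determine them; elsewhere (in
  particular at h = 0) their values are arbitrary.
\<close>

definition feptrkn_method ::
  "real \<Rightarrow> real \<Rightarrow> real \<Rightarrow> real ^ 's::finite \<Rightarrow> ('s \<Rightarrow> real \<Rightarrow> real) \<Rightarrow>
   (real \<Rightarrow> real \<Rightarrow> real ^ 's ^ 's) \<Rightarrow> (real \<Rightarrow> real \<Rightarrow> real ^ 's) \<Rightarrow> (real \<Rightarrow> real \<Rightarrow> real ^ 's) \<Rightarrow> bool" where
  "feptrkn_method t0 T hmax c u A b d \<longleftrightarrow>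
     (\<forall>t\<in>{t0..<t0+T}. \<forall>h\<in>{0<..hmax}. invertible (collocation_matrix c u t h) \<longrightarrow>
        (\<forall>i. u i (t + h) = u i t + h * deriv (u i) t
                 + h\<^sup>2 * (b t h \<bullet> at_stages c (d2 (u i)) t h) \<and>
             deriv (u i) (t + h) = deriv (u i) t + h * (d t h \<bullet> at_stages c (d2 (u i)) t h) \<and>
             at_stages c (u i) (t + h) h
               = vec (u i (t + h)) + (h * deriv (u i) (t + h)) *\<^sub>R c
                 + h\<^sup>2 *\<^sub>R (A t h *v at_stages c (d2 (u i)) t h)))"

definition next_y ::
  "real ^ 's::finite \<Rightarrow> (real \<Rightarrow> real \<Rightarrow> real ^ 's) \<Rightarrow> (real \<Rightarrow> real \<Rightarrow> real) \<Rightarrow>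
   real \<Rightarrow> real \<Rightarrow> real \<Rightarrow> real \<Rightarrow> real ^ 's \<Rightarrow> real" where
  "next_y c b f t h yn dyn Yn = yn + h * dyn + h\<^sup>2 * (b t h \<bullet> rhs_at_stages c f t h Yn)"

definition next_dy ::
  "real ^ 's::finite \<Rightarrow> (real \<Rightarrow> real \<Rightarrow> real ^ 's) \<Rightarrow> (real \<Rightarrow> real \<Rightarrow> real) \<Rightarrow>
   real \<Rightarrow> real \<Rightarrow> real \<Rightarrow> real ^ 's \<Rightarrow> real" where
  "next_dy c d f t h dyn Yn = dyn + h * (d t h \<bullet> rhs_at_stages c f t h Yn)"

text \<open>
  In the next definition the arguments \<open>yn1\<close> and \<open>dyn1\<close> are the values at the new time t + h,
  and \<open>Yn\<close> is the stage vector at the old time t.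
\<close>

definition next_stages ::
  "real ^ 's::finite \<Rightarrow> (real \<Rightarrow> real \<Rightarrow> real ^ 's ^ 's) \<Rightarrow> (real \<Rightarrow> real \<Rightarrow> real) \<Rightarrow>
   real \<Rightarrow> real \<Rightarrow> real \<Rightarrow> real \<Rightarrow> real ^ 's \<Rightarrow> real ^ 's" where
  "next_stages c A f t h yn1 dyn1 Yn =
     vec yn1 + (h * dyn1) *\<^sub>R c + h\<^sup>2 *\<^sub>R (A t h *v rhs_at_stages c f t h Yn)"


section \<open>Orders\<close>

text \<open>
  The limit h to 0+ over pairs (t, h) in S, uniformly in t: a property holds
  eventually iff for some \<open>h0 > 0\<close> it holds for all (t, h) in S with \<open>0 < h < h0\<close>.
\<close>

definition small_steps :: "(real \<times> real) set \<Rightarrow> (real \<times> real) filter" where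
  "small_steps S = inf (filtercomap snd (at_right 0)) (principal S)"

text \<open>
  Pairs (t, h) with t in K for which the step from t to t + h and the step before it, from t - h
  to t, only use arguments in the interval [t0, t0 + T]; and those for which the new stages
  at t + h + c h lie in that interval too.
\<close>

definition step_pairs :: "real \<Rightarrow> real \<Rightarrow> real ^ 's \<Rightarrow> real set \<Rightarrow> (real \<times> real) set" where
  "step_pairs t0 T c K =
     {(t, h). t \<in> K \<and> t0 \<le> t - h \<and> t + h \<le> t0 + T \<and>
              (\<forall>i. t - h + c $ i * h \<in> {t0..t0+T} \<and> t + c $ i * h \<in> {t0..t0+T})}"

definition stage_pairs :: "real \<Rightarrow> real \<Rightarrow> real ^ 's \<Rightarrow> real set \<Rightarrow> (real \<times> real) set" where
  "stage_pairs t0 T c K =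
     {(t, h) \<in> step_pairs t0 T c K. \<forall>i. t + h + c $ i * h \<in> {t0..t0+T}}"

text \<open>
  The pair (t, h) stands for the current grid point t and the stepsize h. The values at t
  are exact, that is y t and dy t. The stage vector \<open>Yn\<close> at t is not an arbitrary vector with
  error O(h^(p3+1)) but the one that the method carries over from its preceding step, from
  t - h to t, which started from a stage vector \<open>Z t h\<close> with an arbitrary error O(h^(p3+1)).
  Hence p3 restricts \<open>Z\<close> as well as the new stage vector. For an arbitrary \<open>Yn\<close> with error
  of the size O(h^(s+2)) of the stage error that the method produces, the error of the new
  derivative value is in general not smaller than O(h^(s+3)): it is the structure of the stage
  error of the preceding step that allows a higher order.
\<close>

definition has_orders ::
  "real \<Rightarrow> real \<Rightarrow> (real \<Rightarrow> real \<Rightarrow> real) \<Rightarrow> (real \<Rightarrow> real) \<Rightarrow> (real \<Rightarrow> real) \<Rightarrow>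
   real ^ 's::finite \<Rightarrow> (real \<Rightarrow> real \<Rightarrow> real ^ 's ^ 's) \<Rightarrow> (real \<Rightarrow> real \<Rightarrow> real ^ 's) \<Rightarrow>
   (real \<Rightarrow> real \<Rightarrow> real ^ 's) \<Rightarrow> real set \<Rightarrow> nat \<Rightarrow> nat \<Rightarrow> nat \<Rightarrow> bool" where
  "has_orders t0 T f y dy c A b d K p1 p2 p3 \<longleftrightarrow>
     (\<forall>Z :: real \<Rightarrow> real \<Rightarrow> real ^ 's.
        (\<lambda>(t, h). norm (at_stages c y (t - h) h - Z t h))
          \<in> O[small_steps (step_pairs t0 T c K)](\<lambda>(t, h). h ^ (p3 + 1)) \<longrightarrow>
        (let Yn = (\<lambda>t h. next_stages c A f (t - h) h (y t) (dy t) (Z t h));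
             yn1 = (\<lambda>t h. next_y c b f t h (y t) (dy t) (Yn t h));
             dyn1 = (\<lambda>t h. next_dy c d f t h (dy t) (Yn t h));
             Yn1 = (\<lambda>t h. next_stages c A f t h (yn1 t h) (dyn1 t h) (Yn t h))
         in (\<lambda>(t, h). y (t + h) - yn1 t h)
              \<in> O[small_steps (step_pairs t0 T c K)](\<lambda>(t, h). h ^ (p1 + 1)) \<and>
            (\<lambda>(t, h). dy (t + h) - dyn1 t h)
              \<in> O[small_steps (step_pairs t0 T c K)](\<lambda>(t, h). h ^ (p2 + 1)) \<and>
            (\<lambda>(t, h). norm (at_stages c y (t + h) h - Yn1 t h))
              \<in> O[small_steps (stage_pairs t0 T c K)](\<lambda>(t, h). h ^ (p3 + 1))))"

text \<open>
  Step order p at the grid points in N, with constants that are uniform on compact subsets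
  of N (on all of N if N is compact).
\<close>

definition has_step_order ::
  "real \<Rightarrow> real \<Rightarrow> (real \<Rightarrow> real \<Rightarrow> real) \<Rightarrow> (real \<Rightarrow> real) \<Rightarrow> (real \<Rightarrow> real) \<Rightarrow>
   real ^ 's::finite \<Rightarrow> (real \<Rightarrow> real \<Rightarrow> real ^ 's ^ 's) \<Rightarrow> (real \<Rightarrow> real \<Rightarrow> real ^ 's) \<Rightarrow>
   (real \<Rightarrow> real \<Rightarrow> real ^ 's) \<Rightarrow> real set \<Rightarrow> nat \<Rightarrow> bool" where
  "has_step_order t0 T f y dy c A b d N p \<longleftrightarrow>
     (\<exists>p1 p2 p3. p = min p1 p2 \<and>
        (\<forall>K. compact K \<and> K \<subseteq> N \<longrightarrow> has_orders t0 T f y dy c A b d K p1 p2 p3))"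

text \<open>
  The times at which the Wronskian of the functions \<open>u_i''\<close> does not vanish, expressed as linear
  independence of the columns of the Wronskian matrix. The collocation condition only implies
  that these times are dense. At a time where the Wronskian vanishes the order can drop: for
  s = 4, with \<open>u_i''\<close> equal to 1, x, x^2, x^4, the step order at x = 0 is in general s + 2.
\<close>

definition regular_times :: "real \<Rightarrow> real \<Rightarrow> ('s::finite \<Rightarrow> real \<Rightarrow> real) \<Rightarrow> real set" where
  "regular_times t0 T u =
     {t \<in> {t0..t0+T}. \<forall>\<alpha> :: real ^ 's.
        (\<forall>k<CARD('s). (\<Sum>j\<in>UNIV. \<alpha> $ j * (deriv ^^ k) (d2 (u j)) t) = 0) \<longrightarrow> \<alpha> = 0}"

end

theory Submission
  imports Defs "HOL-Computational_Algebra.Polynomial"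
begin

text \<open>
  Write s for the number of stages. At a regular time t the functions \<open>u_j''\<close> can be recombined
  into functions whose expansions at t start with \<open>z^k + O(z^s)\<close>, k < s, so after rescaling by h
  the equations for a coefficient vector are a perturbation of a Vandermonde system. The weights
  of the interpolatory quadrature rule at the nodes \<open>c_i\<close> solve the perturbed system up to a defect
  that is smaller the higher the degree of exactness of the rule: if polynomials of degree less
  than s + r are integrated exactly, the fitted weights differ from the polynomial ones by
  O(h^(r+1)). By the orthogonality conditions r = 3 for d and r = 2 for b, and r = 0 for the
  rows of A. Subtracting from \<open>y''\<close> the fitted combination that agrees with it to order s at t,
  one reads off the local errors O(h^(s+4)) of both components for exact stage values.

  The stages carried over from the preceding step have the error
  \<open>\<kappa> h^(s+2) P(1 + c_i) + O(h^(s+3))\<close> with a bounded factor \<open>\<kappa>\<close> independent of i, where P is the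
  double primitive of the node polynomial with P(0) = P'(0) = 0. The limit at h = 0 of the weights d
  annihilates the leading term: it integrates P(1 + x), of degree s + 2, exactly over [0, 1], and
  the triple integral condition says that this integral is 0.

  If the Wronskian vanished on an interval, the functions \<open>u_j''\<close> would be linearly dependent on a
  subinterval, against the collocation condition; hence the regular times are dense.
\<close>

section \<open>Linear systems and moments\<close>

text \<open>What shapes the proof is uniformity. The method's equations bind the coefficients only
  where the collocation matrix is invertible, and the collocation condition grants this for almost
  every h at each fixed t, with no control as h tends to 0. On a compact set of regular times the
  perturbed Vandermonde system is bounded below uniformly in t; hence the matrix is invertible for
  every small h, and the equations hold along the whole filter. The preceding step starts at t - h,
  possibly outside K, so K is enlarged within the regular times. The cancellation in the weights d
  needs errors of the values of f with one common factor: f is linearized along the solution and its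
  derivative is frozen at t, at the cost of terms one power of h smaller. Errors O(h^(s+2)) of the
  stages that enter the preceding step leave it with a further factor h^2, below the leading term of
  the new stage error. The smoothness s + 5 splits into two derivatives for passing to second
  derivatives and s + 3 terms for all expansions.\<close>

lemma linear_family_bounded_below:
  fixes L :: "'t::topological_space \<Rightarrow> 'a::euclidean_space \<Rightarrow> 'e::real_normed_vector"
  assumes K: "compact K" and cont: "continuous_on (K \<times> UNIV) (\<lambda>(t, a). L t a)"
    and lin: "\<And>t. t \<in> K \<Longrightarrow> linear (L t)"
    and inj: "\<And>t a. t \<in> K \<Longrightarrow> L t a = 0 \<Longrightarrow> a = 0"
  shows "\<exists>C>0. \<forall>t\<in>K. \<forall>a. norm a \<le> C * norm (L t a)"
proof (cases "K = {}")
  case True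
  then show ?thesis by (intro exI[of _ 1]) auto
next
  case False
  have comp: "compact (K \<times> sphere (0::'a) 1)"
    by (intro compact_Times K compact_sphere)
  have "continuous_on (K \<times> sphere (0::'a) 1) (\<lambda>p. norm (case p of (t, a) \<Rightarrow> L t a))"
    by (intro continuous_on_norm continuous_on_subset[OF cont]) auto
  moreover have "K \<times> sphere (0::'a) 1 \<noteq> {}"
    using False vector_choose_size[of 1] by (auto simp: sphere_def dist_norm)
  ultimately obtain p where p: "p \<in> K \<times> sphere (0::'a) 1"
    and min: "\<And>q. q \<in> K \<times> sphere (0::'a) 1 \<Longrightarrow>
      norm (case p of (t, a) \<Rightarrow> L t a) \<le> norm (case q of (t, a) \<Rightarrow> L t a)"
    using continuous_attains_inf[OF comp] by blast
  obtain t0 a0 where [simp]: "p = (t0, a0)" by force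
  \<comment> \<open>\<open>m\<close> is the minimum over all of K and the unit sphere, positive by
    injectivity; homogeneity carries it to every vector, with a constant independent of t.\<close>
  define m where "m = norm (L t0 a0)"
  have "m > 0" using p inj[of t0 a0] by (auto simp: m_def)
  show ?thesis
  proof (intro exI[of _ "inverse m"] conjI ballI allI)
    show "inverse m > 0" using \<open>m > 0\<close> by simp
    fix t a assume t: "t \<in> K"
    show "norm a \<le> inverse m * norm (L t a)"
    proof (cases "a = 0")
      case False
      have "m \<le> norm (L t (a /\<^sub>R norm a))"
        using min[of "(t, a /\<^sub>R norm a)"] t False by (auto simp: m_def)
      also have "\<dots> = norm (L t a) / norm a"
        by (simp add: linear_scale[OF lin[OF t]] divide_inverse)
      finally show ?thesis using \<open>m > 0\<close> False by (simp add: field_simps)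
    qed (use linear_0[OF lin[OF t]] in auto)
  qed
qed

text \<open>Equations are numbered by naturals (orders of derivatives, powers), unknowns by the type
  \<open>'s\<close>. The bijection \<open>e\<close> turns the system into an endomorphism of R^s, so
  that injectivity also gives solvability, and compactness of K makes the bound uniform.\<close>

lemma square_system:
  fixes M :: "nat \<Rightarrow> 's::finite \<Rightarrow> 't::topological_space \<Rightarrow> real"
  assumes K: "compact K"
    and cont: "\<And>k j. k < CARD('s) \<Longrightarrow> continuous_on K (M k j)"
    and inj: "\<And>t (\<alpha> :: real ^ 's). t \<in> K \<Longrightarrow>
      (\<And>k. k < CARD('s) \<Longrightarrow> (\<Sum>j\<in>UNIV. \<alpha> $ j * M k j t) = 0) \<Longrightarrow> \<alpha> = 0"
  shows "\<exists>C>0. \<forall>t\<in>K.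
    (\<forall>\<alpha> :: real ^ 's. norm \<alpha> \<le> C * (\<Sum>k<CARD('s). \<bar>\<Sum>j\<in>UNIV. \<alpha> $ j * M k j t\<bar>)) \<and>
    (\<forall>v. \<exists>\<alpha> :: real ^ 's. \<forall>k<CARD('s). (\<Sum>j\<in>UNIV. \<alpha> $ j * M k j t) = v k)"
proof -
  obtain e :: "'s \<Rightarrow> nat" where e: "bij_betw e UNIV {..<CARD('s)}"
    using ex_bij_betw_finite_nat[of "UNIV :: 's set"] by (auto simp: lessThan_atLeast0)
  have e_less: "e i < CARD('s)" for i using e by (auto simp: bij_betw_def)
  define L :: "'t \<Rightarrow> real ^ 's \<Rightarrow> real ^ 's"
    where "L t \<alpha> = (\<chi> i. \<Sum>j\<in>UNIV. \<alpha> $ j * M (e i) j t)" for t \<alpha>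
  have lin: "linear (L t)" for t
    by (auto intro!: linearI simp: L_def vec_eq_iff algebra_simps sum.distrib sum_distrib_left)
  have zero: "\<alpha> = 0" if "t \<in> K" "L t \<alpha> = 0" for t \<alpha>
  proof (rule inj[OF \<open>t \<in> K\<close>])
    fix k assume "k < CARD('s)"
    then obtain i where "k = e i" using e by (auto simp: bij_betw_def image_def set_eq_iff)
    then show "(\<Sum>j\<in>UNIV. \<alpha> $ j * M k j t) = 0" using that(2) by (simp add: L_def vec_eq_iff)
  qed
  have "continuous_on (K \<times> UNIV) (\<lambda>p. M (e i) j (fst p))" for i j
    by (rule continuous_on_compose2[OF cont[OF e_less] continuous_on_fst[OF continuous_on_id]]) auto
  then have "continuous_on (K \<times> UNIV) (\<lambda>(t, \<alpha>). L t \<alpha>)"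
    unfolding L_def case_prod_unfold by (intro continuous_intros)
  then have "\<exists>C>0. \<forall>t\<in>K. \<forall>a. norm a \<le> C * norm (L t a)"
    by (rule linear_family_bounded_below[OF K _ lin zero])
  then obtain C where C: "C > 0" "\<And>t a. t \<in> K \<Longrightarrow> norm a \<le> C * norm (L t a)" by blast
  show ?thesis
  proof (intro exI[of _ C] conjI ballI allI, rule C(1))
    fix t and \<alpha> :: "real ^ 's" assume t: "t \<in> K"
    have "norm (L t \<alpha>) \<le> (\<Sum>i\<in>UNIV. \<bar>L t \<alpha> $ i\<bar>)" by (rule norm_le_l1_cart)
    also have "\<dots> = (\<Sum>k<CARD('s). \<bar>\<Sum>j\<in>UNIV. \<alpha> $ j * M k j t\<bar>)"
      using sum.reindex_bij_betw[OF e, of "\<lambda>k. \<bar>\<Sum>j\<in>UNIV. \<alpha> $ j * M k j t\<bar>"]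
      by (simp add: L_def)
    finally have "C * norm (L t \<alpha>) \<le> C * (\<Sum>k<CARD('s). \<bar>\<Sum>j\<in>UNIV. \<alpha> $ j * M k j t\<bar>)"
      using C(1) by (intro mult_left_mono) auto
    with C(2)[OF t, of \<alpha>] show "norm \<alpha> \<le> C * (\<Sum>k<CARD('s). \<bar>\<Sum>j\<in>UNIV. \<alpha> $ j * M k j t\<bar>)"
      by linarith
  next
    fix t and v :: "nat \<Rightarrow> real" assume t: "t \<in> K"
    have "inj (L t)" using linear_injective_0[OF lin] zero[OF t] by blast
    then have "surj (L t)" using linear_injective_imp_surjective[OF lin] by blast
    then obtain \<alpha> where \<alpha>: "L t \<alpha> = (\<chi> i. v (e i))" by (metis surjD)
    show "\<exists>\<alpha> :: real ^ 's. \<forall>k<CARD('s). (\<Sum>j\<in>UNIV. \<alpha> $ j * M k j t) = v k"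
    proof (intro exI allI impI)
      fix k assume "k < CARD('s)"
      then obtain i where "k = e i" using e by (auto simp: bij_betw_def image_def set_eq_iff)
      then show "(\<Sum>j\<in>UNIV. \<alpha> $ j * M k j t) = v k" using \<alpha> by (simp add: L_def vec_eq_iff)
    qed
  qed
qed

text \<open>Once C times the total deviation of the matrix is below 1/2, the perturbation
  contributes at most half of \<open>norm \<alpha>\<close>, which is absorbed on the left; this
  doubles the constant. The threshold does not depend on \<open>\<alpha>\<close>, so one eventuality
  serves all vectors.\<close>

lemma square_system_perturbed:
  fixes M :: "nat \<Rightarrow> 's::finite \<Rightarrow> 'x \<Rightarrow> real"
  assumes C: "C > 0" and bound: "\<And>\<alpha> :: real ^ 's. norm \<alpha> \<le> C * (\<Sum>k<n. \<bar>\<Sum>j\<in>UNIV. \<alpha> $ j * M0 k j\<bar>)"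
    and lim: "\<And>k j. k < n \<Longrightarrow> (M k j \<longlongrightarrow> M0 k j) F"
  shows "\<forall>\<^sub>F x in F. \<forall>\<alpha> :: real ^ 's. norm \<alpha> \<le> 2 * C * (\<Sum>k<n. \<bar>\<Sum>j\<in>UNIV. \<alpha> $ j * M k j x\<bar>)"
proof -
  define D where "D x = (\<Sum>k<n. \<Sum>j\<in>UNIV. \<bar>M k j x - M0 k j\<bar>)" for x
  have "((\<lambda>x. C * D x) \<longlongrightarrow> C * (\<Sum>k<n. \<Sum>j\<in>(UNIV::'s set). \<bar>M0 k j - M0 k j\<bar>)) F"
    unfolding D_def by (intro tendsto_intros lim) auto
  then have "((\<lambda>x. C * D x) \<longlongrightarrow> 0) F" by simp
  then have "\<forall>\<^sub>F x in F. C * D x < 1 / 2" by (rule order_tendstoD) simp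
  then show ?thesis
  proof eventually_elim
    case (elim x)
    show ?case
    proof
      fix \<alpha> :: "real ^ 's"
      let ?S = "\<Sum>k<n. \<bar>\<Sum>j\<in>UNIV. \<alpha> $ j * M k j x\<bar>"
      have "(\<Sum>k<n. \<bar>\<Sum>j\<in>UNIV. \<alpha> $ j * M0 k j\<bar>) \<le> (\<Sum>k<n. \<bar>\<Sum>j\<in>UNIV. \<alpha> $ j * M k j x\<bar>
              + (\<Sum>j\<in>UNIV. norm \<alpha> * \<bar>M k j x - M0 k j\<bar>))"
      proof (intro sum_mono)
        fix k
        have "(\<Sum>j\<in>UNIV. \<alpha> $ j * M0 k j) = (\<Sum>j\<in>UNIV. \<alpha> $ j * M k j x)
            - (\<Sum>j\<in>UNIV. \<alpha> $ j * (M k j x - M0 k j))"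
          by (simp add: algebra_simps sum_subtractf)
        moreover have "\<bar>\<Sum>j\<in>UNIV. \<alpha> $ j * (M k j x - M0 k j)\<bar>
            \<le> (\<Sum>j\<in>UNIV. norm \<alpha> * \<bar>M k j x - M0 k j\<bar>)"
          by (intro order_trans[OF sum_abs] sum_mono)
             (auto simp: abs_mult component_le_norm_cart intro!: mult_right_mono)
        ultimately show "\<bar>\<Sum>j\<in>UNIV. \<alpha> $ j * M0 k j\<bar> \<le> \<bar>\<Sum>j\<in>UNIV. \<alpha> $ j * M k j x\<bar>
              + (\<Sum>j\<in>UNIV. norm \<alpha> * \<bar>M k j x - M0 k j\<bar>)" by linarith
      qed
      also have "\<dots> = ?S + norm \<alpha> * D x"
        by (simp add: D_def sum.distrib sum_distrib_left)
      finally have "norm \<alpha> \<le> C * (?S + norm \<alpha> * D x)"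
        using C by (intro order_trans[OF bound] mult_left_mono) auto
      also have "\<dots> = C * ?S + (C * D x) * norm \<alpha>" by (simp add: algebra_simps)
      also have "\<dots> \<le> C * ?S + 1 / 2 * norm \<alpha>"
        using elim by (intro add_left_mono mult_right_mono) auto
      finally show "norm \<alpha> \<le> 2 * C * ?S" by simp
    qed
  qed
qed

text \<open>The functional with weights w kills all polynomials of degree below s, in particular the
  one of degree s - 1 vanishing at every node except the i-th; this isolates
  \<open>w $ i\<close>.\<close>

lemma vandermonde_injective:
  fixes c w :: "real ^ 's::finite"
  assumes inj: "inj (\<lambda>i. c $ i)"
    and zero: "\<And>k. k < CARD('s) \<Longrightarrow> (\<Sum>i\<in>UNIV. w $ i * (c $ i) ^ k) = 0"
  shows "w = 0"
proof -
  have "w $ i = 0" for i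
  proof -
    define p where "p = (\<Prod>j\<in>UNIV - {i}. [:- c $ j, 1:])"
    have "degree p = (\<Sum>j\<in>UNIV - {i}. 1)"
      unfolding p_def by (subst degree_prod_eq_sum_degree) auto
    then have "degree p = CARD('s) - 1" by simp
    then have deg: "degree p < CARD('s)" by (simp add: zero_less_card_finite)
    have p0: "poly p (c $ j) = 0" if "j \<noteq> i" for j
      using that by (auto simp: p_def poly_prod)
    have pi: "poly p (c $ i) \<noteq> 0"
      using inj by (auto simp: p_def poly_prod inj_eq)
    have "(\<Sum>j\<in>UNIV. w $ j * poly p (c $ j))
        = (\<Sum>j\<in>UNIV. \<Sum>k\<le>degree p. coeff p k * (w $ j * (c $ j) ^ k))"
      by (simp add: poly_altdef sum_distrib_left mult_ac)
    also have "\<dots> = (\<Sum>k\<le>degree p. coeff p k * (\<Sum>j\<in>UNIV. w $ j * (c $ j) ^ k))"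
      by (subst sum.swap) (simp add: sum_distrib_left)
    also have "\<dots> = 0" using deg by (intro sum.neutral) (auto simp: zero)
    finally have "(\<Sum>j\<in>UNIV. w $ j * poly p (c $ j)) = 0" .
    moreover have "(\<Sum>j\<in>UNIV. w $ j * poly p (c $ j)) = w $ i * poly p (c $ i)"
      by (subst sum.remove[of _ i]) (auto simp: p0)
    ultimately show ?thesis using pi by simp
  qed
  then show ?thesis by (simp add: vec_eq_iff)
qed

text \<open>The linear functional on polynomials that sends x^k to \<open>I k\<close>. Integrals,
  point evaluations and quadrature errors are all of this kind, so relations between them reduce to
  relations between sequences.\<close>

definition moment :: "(nat \<Rightarrow> real) \<Rightarrow> real poly \<Rightarrow> real" where
  "moment I p = (\<Sum>k\<le>degree p. coeff p k * I k)"

lemma moment_superset: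
  "degree p \<le> n \<Longrightarrow> moment I p = (\<Sum>k\<le>n. coeff p k * I k)"
  unfolding moment_def by (intro sum.mono_neutral_left) (auto simp: coeff_eq_0)

lemma moment_quadrature:
  fixes c w :: "real ^ 's::finite"
  shows "moment (\<lambda>k. I k - (\<Sum>i\<in>UNIV. w $ i * (c $ i) ^ k)) p
     = moment I p - (\<Sum>i\<in>UNIV. w $ i * poly p (c $ i))"
proof -
  have "(\<Sum>i\<in>UNIV. w $ i * poly p (c $ i)) = (\<Sum>k\<le>degree p. coeff p k * (\<Sum>i\<in>UNIV. w $ i * (c $ i) ^ k))"
    by (simp add: poly_altdef sum_distrib_left mult_ac) (subst sum.swap, simp)
  then show ?thesis by (simp add: moment_def algebra_simps sum_subtractf)
qed

text \<open>The classical gain in degree of exactness: since p is monic, x^j p has leading term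
  x^(deg p + j), and by strong induction all its lower terms already have moment 0, so orthogonality
  forces the top moment to vanish.\<close>

lemma moments_vanish:
  assumes small: "\<And>m. m < degree p \<Longrightarrow> I m = 0" and lc: "lead_coeff p = 1"
    and orth: "\<And>j. j < r \<Longrightarrow> moment I (monom 1 j * p) = 0"
    and m: "m < degree p + r"
  shows "I m = 0"
  using m
proof (induction m rule: less_induct)
  case (less m)
  show ?case
  proof (cases "m < degree p")
    case False
    define j where "j = m - degree p"
    have "p \<noteq> 0" using lc by auto
    have m: "m = degree p + j" and j: "j < r" using False less.prems by (auto simp: j_def)
    have deg: "degree (monom 1 j * p) = m"
      using \<open>p \<noteq> 0\<close> m by (subst degree_mult_eq) (auto simp: degree_monom_eq)
    have "0 = (\<Sum>k\<le>m. coeff (monom 1 j * p) k * I k)"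
      using orth[OF j] by (simp add: moment_def deg)
    also have "\<dots> = coeff (monom 1 j * p) m * I m + (\<Sum>k<m. coeff (monom 1 j * p) k * I k)"
      by (simp add: lessThan_Suc_atMost[symmetric])
    also have "(\<Sum>k<m. coeff (monom 1 j * p) k * I k) = 0"
      using less by (intro sum.neutral) auto
    also have "coeff (monom 1 j * p) m = 1"
      using lc by (simp add: m coeff_monom_mult)
    finally show ?thesis by simp
  qed (use small in auto)
qed

section \<open>Taylor expansions of functions with a given jet\<close>

text \<open>The witness hidden in \<open>Ck_on\<close>, made explicit: \<open>G j\<close> is the
  j-th derivative, taken within S. At end points of an interval it is one-sided, where iterated
  \<open>deriv\<close> would be of no use.\<close>

definition jet :: "nat \<Rightarrow> real set \<Rightarrow> (nat \<Rightarrow> real \<Rightarrow> real) \<Rightarrow> bool" where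
  "jet N S G \<longleftrightarrow>
     (\<forall>j<N. \<forall>t\<in>S. (G j has_real_derivative G (Suc j) t) (at t within S)) \<and> continuous_on S (G N)"

lemma jet_subset: "jet N S G \<Longrightarrow> S' \<subseteq> S \<Longrightarrow> jet N S' G"
  unfolding jet_def by (meson DERIV_subset continuous_on_subset subsetD)

lemma jet_continuous:
  assumes "jet N S G" "j \<le> N"
  shows "continuous_on S (G j)"
proof (cases "j = N")
  case False
  then show ?thesis
    using assms unfolding jet_def by (intro DERIV_continuous_on[of S "G j" "G (Suc j)"]) auto
qed (use assms in \<open>auto simp: jet_def\<close>)

lemma jet_bounded:
  assumes "jet N {a..b} G" "j \<le> N"
  obtains B where "\<And>t. t \<in> {a..b} \<Longrightarrow> \<bar>G j t\<bar> \<le> B"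
proof -
  have "bounded (G j ` {a..b})"
    by (intro compact_imp_bounded compact_continuous_image jet_continuous[OF assms]) auto
  then obtain B where "\<forall>t\<in>{a..b}. \<bar>G j t\<bar> \<le> B" by (auto simp: bounded_iff)
  then show ?thesis by (intro that[of B]) auto
qed

text \<open>The remainder constant is a bound of \<open>G N\<close> on the compact interval, hence
  independent of both points. Keeping N - i terms for the i-th derivative makes the remainder
  exponent N - i as well.\<close>

lemma jet_taylor:
  assumes G: "jet N {a..b} G" and i: "i < N"
  obtains B where "\<And>t t'. t \<in> {a..b} \<Longrightarrow> t' \<in> {a..b} \<Longrightarrow>
    \<bar>G i t' - (\<Sum>k<N - i. G (i + k) t / fact k * (t' - t) ^ k)\<bar> \<le> B * \<bar>t' - t\<bar> ^ (N - i)"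
proof -
  obtain n where n: "N - i = Suc n" using i by (metis Suc_diff_Suc)
  obtain B where B: "\<And>t. t \<in> {a..b} \<Longrightarrow> \<bar>G N t\<bar> \<le> B" using jet_bounded[OF G order_refl] by blast
  have N: "i + Suc n = N" using n i by simp
  show ?thesis
  proof
    fix t t' assume t: "t \<in> {a..b}" and t': "t' \<in> {a..b}"
    have "norm (G (i + 0) t' - (\<Sum>k\<le>n. G (i + k) t * (t' - t) ^ k / fact k))
        \<le> B * norm (t' - t) ^ Suc n / fact n"
    proof (rule field_Taylor[of "{a..b}" n "\<lambda>k. G (i + k)"])
      fix k x assume "x \<in> {a..b}" "k \<le> n"
      then show "(G (i + k) has_real_derivative G (i + Suc k) x) (at x within {a..b})"
        using G N unfolding jet_def by auto
    qed (use t t' B N in auto)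
    then show "\<bar>G i t' - (\<Sum>k<N - i. G (i + k) t / fact k * (t' - t) ^ k)\<bar>
        \<le> (B / fact n) * \<bar>t' - t\<bar> ^ (N - i)"
      by (simp add: n lessThan_Suc_atMost)
  qed
qed

text \<open>A point x is later a pair (t, h). The filter stays abstract because two of them occur:
  one for all admissible steps, and a finer one where the new stages also lie in the time
  interval.\<close>

locale small_step =
  fixes F :: "'x filter" and h :: "'x \<Rightarrow> real"
  assumes h_pos: "\<forall>\<^sub>F x in F. 0 < h x" and h_lim: "(h \<longlongrightarrow> 0) F"
begin

abbreviation Oh :: "nat \<Rightarrow> ('x \<Rightarrow> real) set" where
  "Oh n \<equiv> O[F](\<lambda>x. h x ^ n)"

lemma h_le_1: "\<forall>\<^sub>F x in F. h x \<le> 1"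
  using order_tendstoD(2)[OF h_lim, of 1] by (auto elim: eventually_mono)

lemma Oh_mono:
  assumes "f \<in> Oh n" "m \<le> n"
  shows "f \<in> Oh m"
proof (rule landau_o.big_trans[OF assms(1)])
  show "(\<lambda>x. h x ^ n) \<in> Oh m"
    using h_pos h_le_1
    by (intro bigoI[of _ 1], eventually_elim) (use assms(2) in \<open>auto intro!: power_decreasing\<close>)
qed

lemma Oh_mult: "f \<in> Oh m \<Longrightarrow> g \<in> Oh n \<Longrightarrow> (\<lambda>x. f x * g x) \<in> Oh (m + n)"
  by (simp add: power_add landau_o.big.mult)

lemma Oh_bounded_mult: "f \<in> O[F](\<lambda>_. 1) \<Longrightarrow> g \<in> Oh n \<Longrightarrow> (\<lambda>x. f x * g x) \<in> Oh n"
  using Oh_mult[of f 0 g n] by simp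

lemma Oh_cmult: "g \<in> Oh n \<Longrightarrow> (\<lambda>x. C * g x) \<in> Oh n"
  by simp

lemma Oh_power: "(\<lambda>x. h x ^ n) \<in> Oh n"
  by simp

lemma Oh_divide:
  assumes "f \<in> Oh (m + n)"
  shows "(\<lambda>x. f x / h x ^ m) \<in> Oh n"
proof -
  have "\<forall>\<^sub>F x in F. h x ^ m \<noteq> 0" using h_pos by eventually_elim auto
  then show ?thesis using assms by (simp add: landau_o.big.divide_eq2 power_add mult.commute)
qed

lemma Oh_tendsto_0: "f \<in> Oh (Suc n) \<Longrightarrow> (f \<longlongrightarrow> 0) F"
proof -
  assume "f \<in> Oh (Suc n)"
  then have "f \<in> Oh 1" by (rule Oh_mono) simp
  then have "f \<in> o[F](\<lambda>_. 1)"
    by (rule landau_o.big_small_trans) (auto intro!: smalloI_tendsto h_lim)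
  then show ?thesis by (rule smalloD_tendsto[of f F "\<lambda>_. 1", simplified])
qed

lemma Oh_le:
  assumes "g \<in> Oh n" "\<forall>\<^sub>F x in F. \<bar>f x\<bar> \<le> \<bar>g x\<bar>"
  shows "f \<in> Oh n"
  by (rule landau_o.big_trans[OF _ assms(1)]) (use assms(2) in \<open>auto intro!: bigoI[of _ 1]\<close>)

lemma Oh_eq:
  assumes "g \<in> Oh n" "\<forall>\<^sub>F x in F. f x = g x"
  shows "f \<in> Oh n"
  using assms(2) by (intro Oh_le[OF assms(1)]) (auto elim: eventually_mono)

lemma jet_bounded_bigo:
  assumes "jet N {a..b} G" "j \<le> N" "\<forall>\<^sub>F x in F. \<tau> x \<in> {a..b}"
  shows "(\<lambda>x. G j (\<tau> x)) \<in> O[F](\<lambda>_. 1)"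
proof -
  obtain B where "\<And>t. t \<in> {a..b} \<Longrightarrow> \<bar>G j t\<bar> \<le> B" using jet_bounded[OF assms(1,2)] by blast
  then show ?thesis using assms(3) by (intro bigoI[of _ B]) (auto elim!: eventually_mono)
qed

lemma jet_taylor_bigo:
  assumes G: "jet N {a..b} G" and i: "i < N"
    and \<tau>: "\<forall>\<^sub>F x in F. \<tau> x \<in> {a..b}" and \<xi>: "\<forall>\<^sub>F x in F. \<tau> x + \<xi> * h x \<in> {a..b}"
  shows "(\<lambda>x. G i (\<tau> x + \<xi> * h x) - (\<Sum>k<N - i. G (i + k) (\<tau> x) / fact k * (\<xi> * h x) ^ k)) \<in> Oh (N - i)"
proof -
  obtain B where B: "\<And>t t'. t \<in> {a..b} \<Longrightarrow> t' \<in> {a..b} \<Longrightarrow>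
    \<bar>G i t' - (\<Sum>k<N - i. G (i + k) t / fact k * (t' - t) ^ k)\<bar> \<le> B * \<bar>t' - t\<bar> ^ (N - i)"
    using jet_taylor[OF G i] by blast
  show ?thesis
  proof (rule bigoI)
    show "\<forall>\<^sub>F x in F. norm (G i (\<tau> x + \<xi> * h x) - (\<Sum>k<N - i. G (i + k) (\<tau> x) / fact k * (\<xi> * h x) ^ k))
        \<le> (B * \<bar>\<xi>\<bar> ^ (N - i)) * norm (h x ^ (N - i))"
      using \<tau> \<xi>
    proof eventually_elim
      case (elim x)
      show ?case using B[OF elim] by (simp add: abs_mult power_mult_distrib power_abs mult.assoc)
    qed
  qed
qed

text \<open>The normal form of all expansions: a Taylor coefficient of the function, a power of h,
  and a number \<open>m k\<close> that depends only on the linear functional applied, being its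
  value on x^k. Combining functionals then acts on the numbers \<open>m k\<close> alone.\<close>

lemma expand_value:
  assumes "jet N {a..b} G" "0 < N" "\<forall>\<^sub>F x in F. \<tau> x \<in> {a..b}" "\<forall>\<^sub>F x in F. \<tau> x + \<xi> * h x \<in> {a..b}"
  shows "(\<lambda>x. G 0 (\<tau> x + \<xi> * h x) - (\<Sum>k<N. G k (\<tau> x) / fact k * h x ^ k * \<xi> ^ k)) \<in> Oh N"
  using jet_taylor_bigo[OF assms] by (simp add: power_mult_distrib mult_ac)

text \<open>The factor h puts derivative values on the same scale as function values, with moments k
  \<xi>^(k-1). At k = 0 the truncated exponent is harmless, because of the factor k.\<close>

lemma expand_derivative:
  assumes "jet N {a..b} G" "1 < N" "\<forall>\<^sub>F x in F. \<tau> x \<in> {a..b}" "\<forall>\<^sub>F x in F. \<tau> x + \<xi> * h x \<in> {a..b}"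
  shows "(\<lambda>x. h x * G 1 (\<tau> x + \<xi> * h x)
     - (\<Sum>k<N. G k (\<tau> x) / fact k * h x ^ k * (of_nat k * \<xi> ^ (k - 1)))) \<in> Oh N"
proof -
  obtain n where n: "N = Suc n" using assms(2) by (metis less_imp_Suc_add)
  have "(\<lambda>x. h x * (G 1 (\<tau> x + \<xi> * h x) - (\<Sum>k<n. G (1 + k) (\<tau> x) / fact k * (\<xi> * h x) ^ k))) \<in> Oh (1 + n)"
    using jet_taylor_bigo[OF assms] n by (intro Oh_mult) auto
  moreover have "h x * (\<Sum>k<n. G (1 + k) (\<tau> x) / fact k * (\<xi> * h x) ^ k)
      = (\<Sum>k<N. G k (\<tau> x) / fact k * h x ^ k * (of_nat k * \<xi> ^ (k - 1)))" for x
    unfolding n sum.lessThan_Suc_shift sum_distrib_left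
    by (auto intro!: sum.cong simp: power_mult_distrib divide_simps simp del: of_nat_Suc)
  ultimately show ?thesis by (simp add: n right_diff_distrib)
qed

lemma expansion_diff:
  assumes "(\<lambda>x. A x - (\<Sum>k<n. g k x * m k)) \<in> Oh N" "(\<lambda>x. B x - (\<Sum>k<n. g k x * m' k)) \<in> Oh N"
  shows "(\<lambda>x. (A x - B x) - (\<Sum>k<n. g k x * (m k - m' k))) \<in> Oh N"
  using sum_in_bigo(2)[OF assms] by (simp add: right_diff_distrib sum_subtractf algebra_simps)

lemma expansion_cmult:
  assumes "(\<lambda>x. A x - (\<Sum>k<n. g k x * m k)) \<in> Oh N"
  shows "(\<lambda>x. C * A x - (\<Sum>k<n. g k x * (C * m k))) \<in> Oh N"
  using Oh_cmult[OF assms, of C] by (simp add: right_diff_distrib sum_distrib_left mult_ac)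

text \<open>A functional that kills constants and linear functions acts on the second derivative
  only. Dividing by h^2 shifts the index by two, and the quotient of \<open>fact (k + 2)\<close> by
  \<open>fact k\<close> accounts for the denominator of \<open>I k\<close>.\<close>

lemma second_order_quotient:
  assumes J: "(\<lambda>x. J x - (\<Sum>k<n + 2. g k x / fact k * h x ^ k * m k)) \<in> Oh (n + 2)"
    and m: "m 0 = 0" "m 1 = 0"
    and I: "\<And>k. I k = m (k + 2) / ((real k + 1) * (real k + 2))"
  shows "(\<lambda>x. J x / (h x)\<^sup>2 - (\<Sum>k<n. g (k + 2) x / fact k * h x ^ k * I k)) \<in> Oh n"
proof -
  have "(\<lambda>x. (J x - (\<Sum>k<n + 2. g k x / fact k * h x ^ k * m k)) / h x ^ 2) \<in> Oh n"
    using J by (intro Oh_divide) (simp add: add.commute)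
  moreover have "\<forall>\<^sub>F x in F. J x / (h x)\<^sup>2 - (\<Sum>k<n. g (k + 2) x / fact k * h x ^ k * I k)
     = (J x - (\<Sum>k<n + 2. g k x / fact k * h x ^ k * m k)) / h x ^ 2"
    using h_pos
  proof eventually_elim
    case (elim x)
    have "(\<Sum>k<n + 2. g k x / fact k * h x ^ k * m k)
        = (\<Sum>k<n. g (k + 2) x / fact (k + 2) * h x ^ (k + 2) * m (k + 2))"
      using m by (simp add: numeral_2_eq_2 sum.lessThan_Suc_shift del: sum.lessThan_Suc)
    also have "\<dots> / h x ^ 2 = (\<Sum>k<n. g (k + 2) x / fact k * h x ^ k * I k)"
      unfolding sum_divide_distrib
    proof (intro sum.cong refl)
      fix k
      have "fact (k + 2) = fact k * ((real k + 1) * (real k + 2))"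
        by (simp add: numeral_2_eq_2 algebra_simps)
      then show "g (k + 2) x / fact (k + 2) * h x ^ (k + 2) * m (k + 2) / (h x)\<^sup>2
          = g (k + 2) x / fact k * h x ^ k * I k"
        using elim by (simp only: I) (simp add: power_add power2_eq_square)
    qed
    finally show ?case by (simp add: diff_divide_distrib)
  qed
  ultimately show ?thesis by (rule Oh_eq)
qed

lemma expand_second_derivative:
  assumes "jet (n + 2) {a..b} G" "0 < n"
    "\<forall>\<^sub>F x in F. \<tau> x \<in> {a..b}" "\<forall>\<^sub>F x in F. \<tau> x + \<xi> * h x \<in> {a..b}"
  shows "(\<lambda>x. G 2 (\<tau> x + \<xi> * h x) - (\<Sum>k<n. G (k + 2) (\<tau> x) / fact k * h x ^ k * \<xi> ^ k)) \<in> Oh n"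
  using jet_taylor_bigo[OF assms(1) _ assms(3,4), of 2] assms(2)
  by (simp add: power_mult_distrib mult_ac)

text \<open>In rescaled time this is the integral of the second derivative over [0, 1], with moments
  1/(k+1). Extending the quotient by h brings it under \<open>second_order_quotient\<close>.\<close>

lemma expand_derivative_increment:
  assumes G: "jet (n + 2) {a..b} G"
    and \<tau>: "\<forall>\<^sub>F x in F. \<tau> x \<in> {a..b}" and \<tau>h: "\<forall>\<^sub>F x in F. \<tau> x + h x \<in> {a..b}"
  shows "(\<lambda>x. (G 1 (\<tau> x + h x) - G 1 (\<tau> x)) / h x
     - (\<Sum>k<n. G (k + 2) (\<tau> x) / fact k * h x ^ k * (1 / (real k + 1)))) \<in> Oh n"
proof -
  have "(\<lambda>x. (h x * G 1 (\<tau> x + 1 * h x) - h x * G 1 (\<tau> x + 0 * h x))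
     - (\<Sum>k<n + 2. G k (\<tau> x) / fact k * h x ^ k * (of_nat k * 1 ^ (k - 1) - of_nat k * 0 ^ (k - 1))))
     \<in> Oh (n + 2)"
    using \<tau> \<tau>h by (intro expansion_diff expand_derivative[OF G]) auto
  then have "(\<lambda>x. (h x * G 1 (\<tau> x + h x) - h x * G 1 (\<tau> x))
     - (\<Sum>k<n + 2. G k (\<tau> x) / fact k * h x ^ k * (of_nat k - of_nat k * 0 ^ (k - 1)))) \<in> Oh (n + 2)"
    by simp
  then have "(\<lambda>x. (h x * G 1 (\<tau> x + h x) - h x * G 1 (\<tau> x)) / (h x)\<^sup>2
     - (\<Sum>k<n. G (k + 2) (\<tau> x) / fact k * h x ^ k * (1 / (real k + 1)))) \<in> Oh n"
  proof (rule second_order_quotient)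
    fix k
    have "real k + 1 \<noteq> 0" "real k + 2 \<noteq> 0" by linarith+
    then show "1 / (real k + 1) = (real (k + 2) - real (k + 2) * 0 ^ (k + 2 - 1)) / ((real k + 1) * (real k + 2))"
      by (simp add: add.commute)
  qed auto
  then show ?thesis
    by (rule Oh_eq) (use h_pos in \<open>eventually_elim, simp add: field_simps power2_eq_square\<close>)
qed

text \<open>In rescaled time this is the integral of the second derivative against the kernel 1 - x
  on [0, 1].\<close>

lemma expand_value_increment:
  assumes G: "jet (n + 2) {a..b} G"
    and \<tau>: "\<forall>\<^sub>F x in F. \<tau> x \<in> {a..b}" and \<tau>h: "\<forall>\<^sub>F x in F. \<tau> x + h x \<in> {a..b}"
  shows "(\<lambda>x. (G 0 (\<tau> x + h x) - G 0 (\<tau> x) - h x * G 1 (\<tau> x)) / (h x)\<^sup>2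
     - (\<Sum>k<n. G (k + 2) (\<tau> x) / fact k * h x ^ k * (1 / ((real k + 1) * (real k + 2))))) \<in> Oh n"
proof -
  have "(\<lambda>x. ((G 0 (\<tau> x + 1 * h x) - G 0 (\<tau> x + 0 * h x)) - h x * G 1 (\<tau> x + 0 * h x))
     - (\<Sum>k<n + 2. G k (\<tau> x) / fact k * h x ^ k * ((1 ^ k - 0 ^ k) - of_nat k * 0 ^ (k - 1))))
     \<in> Oh (n + 2)"
    using \<tau> \<tau>h by (intro expansion_diff expand_derivative[OF G] expand_value[OF G]) auto
  then have "(\<lambda>x. (G 0 (\<tau> x + h x) - G 0 (\<tau> x) - h x * G 1 (\<tau> x))
     - (\<Sum>k<n + 2. G k (\<tau> x) / fact k * h x ^ k * (1 - 0 ^ k - of_nat k * 0 ^ (k - 1)))) \<in> Oh (n + 2)"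
    by simp
  then show ?thesis by (rule second_order_quotient) auto
qed

text \<open>The increment starts at \<tau> + h, but the expansion is around \<tau>, because the
  method feeds it with second derivatives at the old stages. The evaluation points in rescaled time
  are therefore 1 and 1 + \<xi>.\<close>

lemma expand_stage_increment:
  assumes G: "jet (n + 2) {a..b} G"
    and \<tau>: "\<forall>\<^sub>F x in F. \<tau> x \<in> {a..b}" and \<tau>h: "\<forall>\<^sub>F x in F. \<tau> x + h x \<in> {a..b}"
    and \<xi>: "\<forall>\<^sub>F x in F. \<tau> x + h x + \<xi> * h x \<in> {a..b}"
  shows "(\<lambda>x. (G 0 (\<tau> x + h x + \<xi> * h x) - G 0 (\<tau> x + h x) - h x * \<xi> * G 1 (\<tau> x + h x)) / (h x)\<^sup>2
     - (\<Sum>k<n. G (k + 2) (\<tau> x) / fact k * h x ^ k *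
          (((1 + \<xi>) ^ (k + 2) - 1 - \<xi> * (real k + 2)) / ((real k + 1) * (real k + 2))))) \<in> Oh n"
proof -
  have "(\<lambda>x. ((G 0 (\<tau> x + (1 + \<xi>) * h x) - G 0 (\<tau> x + 1 * h x)) - \<xi> * (h x * G 1 (\<tau> x + 1 * h x)))
     - (\<Sum>k<n + 2. G k (\<tau> x) / fact k * h x ^ k * (((1 + \<xi>) ^ k - 1 ^ k) - \<xi> * (of_nat k * 1 ^ (k - 1)))))
     \<in> Oh (n + 2)"
    using \<tau> \<tau>h \<xi>
    by (intro expansion_diff expansion_cmult expand_derivative[OF G] expand_value[OF G])
       (auto simp: algebra_simps)
  then have "(\<lambda>x. (G 0 (\<tau> x + h x + \<xi> * h x) - G 0 (\<tau> x + h x) - h x * \<xi> * G 1 (\<tau> x + h x))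
     - (\<Sum>k<n + 2. G k (\<tau> x) / fact k * h x ^ k * ((1 + \<xi>) ^ k - 1 - \<xi> * of_nat k))) \<in> Oh (n + 2)"
    by (simp add: distrib_right distrib_left mult_ac add.assoc del: sum.lessThan_Suc add_2_eq_Suc')
  then show ?thesis by (rule second_order_quotient) (auto simp: add.commute)
qed

end

section \<open>Coefficients fitted to a basis\<close>

context small_step
begin

lemma expansion_sum:
  assumes "\<And>i. i \<in> S \<Longrightarrow> (\<lambda>x. B i x - (\<Sum>k<n. g k x * m i k)) \<in> Oh N"
  shows "(\<lambda>x. (\<Sum>i\<in>S. w i * B i x) - (\<Sum>k<n. g k x * (\<Sum>i\<in>S. w i * m i k))) \<in> Oh N"
proof -
  have "(\<lambda>x. \<Sum>i\<in>S. w i * (B i x - (\<Sum>k<n. g k x * m i k))) \<in> Oh N"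
    by (intro big_sum_in_bigo Oh_cmult assms)
  moreover have "(\<Sum>i\<in>S. w i * (\<Sum>k<n. g k x * m i k)) = (\<Sum>k<n. g k x * (\<Sum>i\<in>S. w i * m i k))" for x
    unfolding sum_distrib_left by (subst sum.swap) (simp add: mult_ac)
  ultimately show ?thesis by (simp add: right_diff_distrib sum_subtractf)
qed

lemma expansion_combination:
  assumes "\<And>j. j \<in> S \<Longrightarrow> (\<lambda>x. B j x - (\<Sum>k<n. g j k x * h x ^ k * m k)) \<in> Oh N"
    and \<alpha>: "\<And>j. j \<in> S \<Longrightarrow> \<alpha> j \<in> O[F](\<lambda>_. 1)"
  shows "(\<lambda>x. (\<Sum>j\<in>S. \<alpha> j x * B j x) - (\<Sum>k<n. (\<Sum>j\<in>S. \<alpha> j x * g j k x) * h x ^ k * m k)) \<in> Oh N"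
proof -
  have "(\<lambda>x. \<Sum>j\<in>S. \<alpha> j x * (B j x - (\<Sum>k<n. g j k x * h x ^ k * m k))) \<in> Oh N"
    by (intro big_sum_in_bigo Oh_bounded_mult assms)
  moreover have "(\<Sum>j\<in>S. \<alpha> j x * (\<Sum>k<n. g j k x * h x ^ k * m k))
      = (\<Sum>k<n. (\<Sum>j\<in>S. \<alpha> j x * g j k x) * h x ^ k * m k)" for x
    unfolding sum_distrib_left sum_distrib_right by (subst sum.swap) (simp add: mult_ac)
  ultimately show ?thesis by (simp add: right_diff_distrib sum_subtractf)
qed

text \<open>Only the products \<open>g k x * m k\<close> have to vanish below q. This covers both
  sources of cancellation: matched Taylor coefficients (\<open>g\<close> vanishes) and exactness of
  a quadrature rule (\<open>m\<close> vanishes).\<close>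

lemma expansion_order:
  assumes A: "(\<lambda>x. A x - (\<Sum>k<n. g k x * h x ^ k * m k)) \<in> Oh n"
    and g: "\<And>k. k < n \<Longrightarrow> g k \<in> O[F](\<lambda>_. 1)"
    and zero: "\<forall>\<^sub>F x in F. \<forall>k<q. g k x * m k = 0" and q: "q \<le> n"
  shows "A \<in> Oh q"
proof -
  have "(\<lambda>x. \<Sum>k\<in>{q..<n}. g k x * (h x ^ k * m k)) \<in> Oh q"
  proof (rule big_sum_in_bigo)
    fix k assume k: "k \<in> {q..<n}"
    then have "(\<lambda>x. h x ^ k * m k) \<in> Oh q"
      using Oh_mono[OF Oh_cmult[OF Oh_power[of k], of "m k"], of q] by (simp add: mult.commute)
    then show "(\<lambda>x. g k x * (h x ^ k * m k)) \<in> Oh q"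
      by (rule Oh_bounded_mult[OF g, rotated]) (use k in auto)
  qed
  then have "(\<lambda>x. (A x - (\<Sum>k<n. g k x * h x ^ k * m k)) + (\<Sum>k\<in>{q..<n}. g k x * (h x ^ k * m k))) \<in> Oh q"
    by (intro sum_in_bigo Oh_mono[OF A q])
  then show ?thesis
  proof (rule Oh_eq)
    show "\<forall>\<^sub>F x in F. A x = (A x - (\<Sum>k<n. g k x * h x ^ k * m k)) + (\<Sum>k\<in>{q..<n}. g k x * (h x ^ k * m k))"
      using zero
    proof eventually_elim
      case (elim x)
      have "(\<Sum>k<n. g k x * h x ^ k * m k) = (\<Sum>k\<in>{q..<n}. g k x * h x ^ k * m k)"
        using elim q by (intro sum.mono_neutral_right) (auto simp: not_le)
      then show ?case by (simp add: mult.assoc)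
    qed
  qed
qed

end

text \<open>The base time \<open>\<tau> x\<close> is kept apart from x, since the same pair (t, h)
  is used with base t and with base t - h. \<open>K\<close> is a compact set of times with
  nonvanishing Wronskian of the second derivatives.\<close>

locale fitted_step = small_step F h
  for F :: "'x filter" and h :: "'x \<Rightarrow> real" +
  fixes a b :: real and K :: "real set" and \<tau> :: "'x \<Rightarrow> real" and c :: "real ^ 's::finite"
    and G :: "'s \<Rightarrow> nat \<Rightarrow> real \<Rightarrow> real"
  assumes c_inj: "inj (\<lambda>i. c $ i)"
    and G: "\<And>j. jet (CARD('s) + 5) {a..b} (G j)"
    and K: "compact K" "K \<subseteq> {a..b}"
    and wronskian: "\<And>t (\<alpha> :: real ^ 's). t \<in> K \<Longrightarrow>
      (\<And>k. k < CARD('s) \<Longrightarrow> (\<Sum>j\<in>UNIV. \<alpha> $ j * G j (k + 2) t) = 0) \<Longrightarrow> \<alpha> = 0"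
    and \<tau>: "\<forall>\<^sub>F x in F. \<tau> x \<in> K"
    and nodes: "\<forall>\<^sub>F x in F. \<forall>i. \<tau> x + c $ i * h x \<in> {a..b}"
begin

text \<open>\<open>T\<close> are the Taylor coefficients of the second derivative of Y at the base
  time, \<open>V\<close> its values at the nodes.\<close>

abbreviation T :: "(nat \<Rightarrow> real \<Rightarrow> real) \<Rightarrow> nat \<Rightarrow> 'x \<Rightarrow> real" where
  "T Y k x \<equiv> Y (k + 2) (\<tau> x) / fact k"

abbreviation V :: "(nat \<Rightarrow> real \<Rightarrow> real) \<Rightarrow> 's \<Rightarrow> 'x \<Rightarrow> real" where
  "V Y i x \<equiv> Y 2 (\<tau> x + c $ i * h x)"

lemma \<tau>_in: "\<forall>\<^sub>F x in F. \<tau> x \<in> {a..b}"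
  using \<tau> by eventually_elim (use K in auto)

lemma V_expansion:
  assumes "jet (CARD('s) + 5) {a..b} Y"
  shows "(\<lambda>x. V Y i x - (\<Sum>k<CARD('s) + 3. T Y k x * h x ^ k * (c $ i) ^ k)) \<in> Oh (CARD('s) + 3)"
  by (rule expand_second_derivative[of _ a b])
     (use assms \<tau>_in nodes in \<open>auto elim: eventually_mono simp: add.commute\<close>)

lemma T_bounded:
  assumes "jet (CARD('s) + 5) {a..b} Y" "k < CARD('s) + 3"
  shows "T Y k \<in> O[F](\<lambda>_. 1)"
  using jet_bounded_bigo[OF assms(1) _ \<tau>_in, of "k + 2"] assms(2) by simp

text \<open>Prescribing the first s Taylor coefficients of a combination of the second derivatives
  is a Wronskian system; on the compact set K its solutions are bounded uniformly by the
  data.\<close>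

lemma solve_coefficients:
  assumes v: "\<And>m. m < CARD('s) \<Longrightarrow> v m \<in> O[F](\<lambda>_. 1)"
  shows "\<exists>\<alpha> :: 'x \<Rightarrow> real ^ 's. (\<forall>j. (\<lambda>x. \<alpha> x $ j) \<in> O[F](\<lambda>_. 1)) \<and>
    (\<forall>\<^sub>F x in F. \<forall>m<CARD('s). (\<Sum>j\<in>UNIV. \<alpha> x $ j * T (G j) m x) = v m x)"
proof -
  have cont: "continuous_on K (\<lambda>t. G j (k + 2) t / fact k)" if "k < CARD('s)" for k j
    using that K(2) by (intro continuous_intros continuous_on_subset[OF jet_continuous[OF G]]) auto
  have inj: "\<alpha> = 0" if "t \<in> K" and z: "\<And>k. k < CARD('s) \<Longrightarrow> (\<Sum>j\<in>UNIV. \<alpha> $ j * (G j (k + 2) t / fact k)) = 0"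
    for t and \<alpha> :: "real ^ 's"
  proof (rule wronskian[OF \<open>t \<in> K\<close>])
    fix k assume "k < CARD('s)"
    have "(\<Sum>j\<in>UNIV. \<alpha> $ j * (G j (k + 2) t / fact k)) = (\<Sum>j\<in>UNIV. \<alpha> $ j * G j (k + 2) t) / fact k"
      by (simp add: sum_divide_distrib)
    with z[OF \<open>k < CARD('s)\<close>] show "(\<Sum>j\<in>UNIV. \<alpha> $ j * G j (k + 2) t) = 0" by simp
  qed
  have "\<exists>C>0. \<forall>t\<in>K.
      (\<forall>\<alpha> :: real ^ 's. norm \<alpha> \<le> C * (\<Sum>k<CARD('s). \<bar>\<Sum>j\<in>UNIV. \<alpha> $ j * (G j (k + 2) t / fact k)\<bar>)) \<and>
      (\<forall>v. \<exists>\<alpha> :: real ^ 's. \<forall>k<CARD('s). (\<Sum>j\<in>UNIV. \<alpha> $ j * (G j (k + 2) t / fact k)) = v k)"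
    by (rule square_system[OF K(1) cont inj])
  then obtain C where C: "C > 0" "\<And>t (\<alpha> :: real ^ 's). t \<in> K \<Longrightarrow>
      norm \<alpha> \<le> C * (\<Sum>k<CARD('s). \<bar>\<Sum>j\<in>UNIV. \<alpha> $ j * (G j (k + 2) t / fact k)\<bar>)"
    and ex: "\<And>t v. t \<in> K \<Longrightarrow> \<exists>\<alpha> :: real ^ 's. \<forall>k<CARD('s). (\<Sum>j\<in>UNIV. \<alpha> $ j * (G j (k + 2) t / fact k)) = v k"
    by blast
  \<comment> \<open>Only boundedness of the coefficients matters, not regularity in x, so a
    pointwise choice suffices.\<close>
  have "\<exists>\<alpha> :: real ^ 's. \<tau> x \<in> K \<longrightarrow> (\<forall>m<CARD('s). (\<Sum>j\<in>UNIV. \<alpha> $ j * T (G j) m x) = v m x)" for x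
    using ex[of "\<tau> x" "\<lambda>m. v m x"] by auto
  then have "\<exists>\<alpha> :: 'x \<Rightarrow> real ^ 's. \<forall>x. \<tau> x \<in> K \<longrightarrow>
      (\<forall>m<CARD('s). (\<Sum>j\<in>UNIV. \<alpha> x $ j * T (G j) m x) = v m x)"
    by (intro choice allI)
  then obtain \<alpha> :: "'x \<Rightarrow> real ^ 's" where
    \<alpha>: "\<And>x. \<tau> x \<in> K \<Longrightarrow> \<forall>m<CARD('s). (\<Sum>j\<in>UNIV. \<alpha> x $ j * T (G j) m x) = v m x"
    by blast
  show ?thesis
  proof (intro exI[of _ \<alpha>] conjI allI)
    show "\<forall>\<^sub>F x in F. \<forall>m<CARD('s). (\<Sum>j\<in>UNIV. \<alpha> x $ j * T (G j) m x) = v m x"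
      using \<tau> by eventually_elim (rule \<alpha>)
    fix j
    have bnd: "(\<lambda>x. C * (\<Sum>m<CARD('s). \<bar>v m x\<bar>)) \<in> Oh 0"
      using v by (intro Oh_cmult big_sum_in_bigo) auto
    have "\<forall>\<^sub>F x in F. \<bar>\<alpha> x $ j\<bar> \<le> \<bar>C * (\<Sum>m<CARD('s). \<bar>v m x\<bar>)\<bar>"
      using \<tau>
    proof eventually_elim
      case (elim x)
      have "\<bar>\<alpha> x $ j\<bar> \<le> norm (\<alpha> x)" by (rule component_le_norm_cart)
      also have "\<dots> \<le> C * (\<Sum>m<CARD('s). \<bar>v m x\<bar>)"
        using C(2)[OF elim, of "\<alpha> x"] \<alpha>[OF elim] by simp
      finally show ?case by linarith
    qed
    from Oh_le[OF bnd this] show "(\<lambda>x. \<alpha> x $ j) \<in> O[F](\<lambda>_. 1)" by simp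
  qed
qed

text \<open>The bound is stated for arbitrary w because it has two uses: with a kernel vector it
  shows that the collocation matrix is invertible, with a difference of weights it measures their
  deviation from a polynomial rule.\<close>

lemma fitted_vandermonde:
  obtains \<alpha> :: "nat \<Rightarrow> 'x \<Rightarrow> real ^ 's" and C where
    "\<And>k j. k < CARD('s) \<Longrightarrow> (\<lambda>x. \<alpha> k x $ j) \<in> O[F](\<lambda>_. 1)"
    "\<forall>\<^sub>F x in F. \<forall>w :: real ^ 's. norm w \<le>
       C * (\<Sum>k<CARD('s). \<bar>\<Sum>i\<in>UNIV. w $ i * ((\<Sum>j\<in>UNIV. \<alpha> k x $ j * V (G j) i x) / h x ^ k)\<bar>)"
proof -
  have "\<exists>\<alpha> :: 'x \<Rightarrow> real ^ 's. (\<forall>j. (\<lambda>x. \<alpha> x $ j) \<in> O[F](\<lambda>_. 1)) \<and>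
    (\<forall>\<^sub>F x in F. \<forall>m<CARD('s). (\<Sum>j\<in>UNIV. \<alpha> x $ j * T (G j) m x) = (if m = k then 1 else 0))" for k
    by (rule solve_coefficients) auto
  then have "\<exists>\<alpha> :: nat \<Rightarrow> 'x \<Rightarrow> real ^ 's. \<forall>k. (\<forall>j. (\<lambda>x. \<alpha> k x $ j) \<in> O[F](\<lambda>_. 1)) \<and>
    (\<forall>\<^sub>F x in F. \<forall>m<CARD('s). (\<Sum>j\<in>UNIV. \<alpha> k x $ j * T (G j) m x) = (if m = k then 1 else 0))"
    by (intro choice allI)
  then obtain \<alpha> :: "nat \<Rightarrow> 'x \<Rightarrow> real ^ 's" where \<alpha>: "\<And>k j. (\<lambda>x. \<alpha> k x $ j) \<in> O[F](\<lambda>_. 1)"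
    and dual: "\<And>k. \<forall>\<^sub>F x in F. \<forall>m<CARD('s). (\<Sum>j\<in>UNIV. \<alpha> k x $ j * T (G j) m x) = (if m = k then 1 else 0)"
    by blast
  have lim: "((\<lambda>x. (\<Sum>j\<in>UNIV. \<alpha> k x $ j * V (G j) i x) / h x ^ k) \<longlongrightarrow> (c $ i) ^ k) F"
    if k: "k < CARD('s)" for k i
  proof -
    define g where "g m x = (\<Sum>j\<in>UNIV. \<alpha> k x $ j * T (G j) m x)" for m x
    have g: "g m \<in> O[F](\<lambda>_. 1)" if "m < CARD('s) + 3" for m
      unfolding g_def using \<alpha> T_bounded[OF G that]
      by (intro big_sum_in_bigo landau_o.big.mult_in_1)
    have comb: "(\<lambda>x. (\<Sum>j\<in>UNIV. \<alpha> k x $ j * V (G j) i x)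
        - (\<Sum>m<CARD('s) + 3. g m x * h x ^ m * (c $ i) ^ m)) \<in> Oh (CARD('s) + 3)"
      unfolding g_def by (rule expansion_combination[OF V_expansion[OF G] \<alpha>])
    \<comment> \<open>The monomial is written as an expansion with Kronecker coefficients, so that
      its difference from \<open>comb\<close> is again an expansion, now with vanishing coefficients
      below s.\<close>
    have pow: "(\<lambda>x. h x ^ k * (c $ i) ^ k
        - (\<Sum>m<CARD('s) + 3. (if m = k then 1 else 0) * h x ^ m * (c $ i) ^ m)) \<in> Oh (CARD('s) + 3)"
      using k by (simp add: if_distrib[of "\<lambda>z. z * _"] cong: if_cong)
    have "(\<lambda>x. ((\<Sum>j\<in>UNIV. \<alpha> k x $ j * V (G j) i x) - h x ^ k * (c $ i) ^ k)
       - (\<Sum>m<CARD('s) + 3. (g m x - (if m = k then 1 else 0)) * h x ^ m * (c $ i) ^ m)) \<in> Oh (CARD('s) + 3)"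
      using sum_in_bigo(2)[OF comb pow]
      by (simp add: left_diff_distrib sum_subtractf algebra_simps del: sum.lessThan_Suc)
    then have "(\<lambda>x. (\<Sum>j\<in>UNIV. \<alpha> k x $ j * V (G j) i x) - h x ^ k * (c $ i) ^ k) \<in> Oh (CARD('s))"
    proof (rule expansion_order)
      show "\<forall>\<^sub>F x in F. \<forall>m<CARD('s). (g m x - (if m = k then 1 else 0)) * c $ i ^ m = 0"
        using dual[of k] by eventually_elim (simp add: g_def)
    qed (auto intro!: sum_in_bigo g)
    \<comment> \<open>Since k < s, dividing a term O(h^s) by h^k still leaves one power of h, which
      is what convergence to the Vandermonde entry needs.\<close>
    then have "(\<lambda>x. ((\<Sum>j\<in>UNIV. \<alpha> k x $ j * V (G j) i x) - h x ^ k * (c $ i) ^ k) / h x ^ k) \<in> Oh (Suc 0)"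
      by (rule Oh_divide[OF Oh_mono]) (use k in simp)
    then have "((\<lambda>x. ((\<Sum>j\<in>UNIV. \<alpha> k x $ j * V (G j) i x) - h x ^ k * (c $ i) ^ k) / h x ^ k) \<longlongrightarrow> 0) F"
      by (rule Oh_tendsto_0)
    then have "((\<lambda>x. (\<Sum>j\<in>UNIV. \<alpha> k x $ j * V (G j) i x) / h x ^ k - (c $ i) ^ k) \<longlongrightarrow> 0) F"
      by (rule Lim_transform_eventually)
         (use h_pos in \<open>eventually_elim, simp add: diff_divide_distrib\<close>)
    then show ?thesis by (simp add: LIM_zero_iff)
  qed
  \<comment> \<open>The Vandermonde matrix has no parameter; the singleton is a dummy compact
    parameter set.\<close>
  have "\<exists>C>0. \<forall>t\<in>{0::real}.
      (\<forall>w :: real ^ 's. norm w \<le> C * (\<Sum>k<CARD('s). \<bar>\<Sum>i\<in>UNIV. w $ i * (c $ i) ^ k\<bar>)) \<and>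
      (\<forall>v. \<exists>w :: real ^ 's. \<forall>k<CARD('s). (\<Sum>i\<in>UNIV. w $ i * (c $ i) ^ k) = v k)"
    using vandermonde_injective[OF c_inj] by (intro square_system) auto
  then obtain C where C: "C > 0" "\<And>w :: real ^ 's.
      norm w \<le> C * (\<Sum>k<CARD('s). \<bar>\<Sum>i\<in>UNIV. w $ i * (c $ i) ^ k\<bar>)"
    by auto
  show ?thesis
    by (rule that[OF \<alpha> square_system_perturbed[OF C lim]])
qed

text \<open>A vector that annihilates every column of the collocation matrix annihilates all
  recombined columns, and the lower bound forces it to be 0.\<close>

lemma fitted_matrix_injective:
  "\<forall>\<^sub>F x in F. \<forall>w :: real ^ 's. (\<forall>j. (\<Sum>i\<in>UNIV. w $ i * V (G j) i x) = 0) \<longrightarrow> w = 0"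
proof -
  obtain \<alpha> :: "nat \<Rightarrow> 'x \<Rightarrow> real ^ 's" and C where
    "\<forall>\<^sub>F x in F. \<forall>w :: real ^ 's. norm w \<le>
       C * (\<Sum>k<CARD('s). \<bar>\<Sum>i\<in>UNIV. w $ i * ((\<Sum>j\<in>UNIV. \<alpha> k x $ j * V (G j) i x) / h x ^ k)\<bar>)"
    by (rule fitted_vandermonde) (assumption | rule that)+
  then show ?thesis
  proof eventually_elim
    case (elim x)
    show ?case
    proof (intro allI impI)
      fix w :: "real ^ 's" assume w: "\<forall>j. (\<Sum>i\<in>UNIV. w $ i * V (G j) i x) = 0"
      have "(\<Sum>i\<in>UNIV. w $ i * ((\<Sum>j\<in>UNIV. \<alpha> k x $ j * V (G j) i x) / h x ^ k))
          = (\<Sum>j\<in>UNIV. \<alpha> k x $ j * (\<Sum>i\<in>UNIV. w $ i * V (G j) i x)) / h x ^ k" for k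
        unfolding sum_distrib_left times_divide_eq_right sum_divide_distrib[symmetric]
        by (subst sum.swap) (simp add: mult_ac)
      then show "w = 0" using elim[rule_format, of w] w by simp
    qed
  qed
qed

text \<open>The polynomial weights \<open>w0\<close> satisfy each fitted equation up to O(h^(s+r)).
  Recombining and dividing by h^k costs at most h^(s-1), so h^(r+1) survives, and the lower bound
  passes it on to \<open>w x - w0\<close>. The cap 3 on r is the number of expansion terms beyond
  s.\<close>

lemma fitted_weights:
  assumes J: "\<And>j. (\<lambda>x. J j x - (\<Sum>m<CARD('s) + 3. T (G j) m x * h x ^ m * I m)) \<in> Oh (CARD('s) + 3)"
    and exact: "\<And>m. m < CARD('s) + r \<Longrightarrow> (\<Sum>i\<in>UNIV. w0 $ i * (c $ i) ^ m) = I m" and r: "r \<le> 3"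
    and w: "\<forall>\<^sub>F x in F. \<forall>j. J j x = (\<Sum>i\<in>UNIV. w x $ i * V (G j) i x)"
  shows "(\<lambda>x. norm (w x - w0)) \<in> Oh (r + 1)"
proof -
  obtain \<alpha> :: "nat \<Rightarrow> 'x \<Rightarrow> real ^ 's" and C where
    \<alpha>: "\<And>k j. k < CARD('s) \<Longrightarrow> (\<lambda>x. \<alpha> k x $ j) \<in> O[F](\<lambda>_. 1)" and
    bound: "\<forall>\<^sub>F x in F. \<forall>w :: real ^ 's. norm w \<le>
       C * (\<Sum>k<CARD('s). \<bar>\<Sum>i\<in>UNIV. w $ i * ((\<Sum>j\<in>UNIV. \<alpha> k x $ j * V (G j) i x) / h x ^ k)\<bar>)"
    by (rule fitted_vandermonde) (assumption | rule that)+
  have defect: "(\<lambda>x. J j x - (\<Sum>i\<in>UNIV. w0 $ i * V (G j) i x)) \<in> Oh (CARD('s) + r)" for j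
    by (rule expansion_order[OF expansion_diff[OF J expansion_sum[where S = UNIV, OF V_expansion[OF G]]]])
       (use T_bounded[OF G] r in \<open>auto simp: exact\<close>)
  define res where "res k x = (\<Sum>j\<in>UNIV. \<alpha> k x $ j * (J j x - (\<Sum>i\<in>UNIV. w0 $ i * V (G j) i x))) / h x ^ k" for k x
  have res: "res k \<in> Oh (r + 1)" if "k < CARD('s)" for k
    unfolding res_def using that
    by (intro Oh_divide big_sum_in_bigo Oh_bounded_mult \<alpha> Oh_mono[OF defect]) auto
  have "(\<lambda>x. C * (\<Sum>k<CARD('s). \<bar>res k x\<bar>)) \<in> Oh (r + 1)"
    using res by (intro Oh_cmult big_sum_in_bigo) auto
  moreover have "\<forall>\<^sub>F x in F. \<bar>norm (w x - w0)\<bar> \<le> \<bar>C * (\<Sum>k<CARD('s). \<bar>res k x\<bar>)\<bar>"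
    using bound w
  proof eventually_elim
    case (elim x)
    have "(\<Sum>i\<in>UNIV. (w x - w0) $ i * ((\<Sum>j\<in>UNIV. \<alpha> k x $ j * V (G j) i x) / h x ^ k)) = res k x" for k
    proof -
      have "(\<Sum>i\<in>UNIV. (w x - w0) $ i * ((\<Sum>j\<in>UNIV. \<alpha> k x $ j * V (G j) i x) / h x ^ k))
          = (\<Sum>j\<in>UNIV. \<alpha> k x $ j * (\<Sum>i\<in>UNIV. (w x - w0) $ i * V (G j) i x)) / h x ^ k"
        unfolding sum_distrib_left times_divide_eq_right sum_divide_distrib[symmetric]
        by (subst sum.swap) (simp add: mult_ac)
      also have "\<dots> = res k x"
        unfolding res_def using elim(2) by (simp add: left_diff_distrib sum_subtractf)
      finally show ?thesis .
    qed
    then have "norm (w x - w0) \<le> C * (\<Sum>k<CARD('s). \<bar>res k x\<bar>)"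
      using elim(1)[rule_format, of "w x - w0"] by simp
    then show ?case by simp
  qed
  ultimately show ?thesis by (rule Oh_le)
qed

text \<open>\<open>D m\<close> is the Taylor coefficient of order m of the second derivative of Y
  minus its fitted combination. It is obtained before the functional is quantified: the leading
  stage error must have the same factor in all components. Replacing \<open>w\<close> by
  \<open>w0\<close> costs the deviation O(h^(r+1)) of the weights times the residual O(h^s) at the
  nodes.\<close>

lemma fitted_residual:
  assumes Y: "jet (CARD('s) + 5) {a..b} Y"
  obtains D where "\<And>m. m < CARD('s) + 3 \<Longrightarrow> D m \<in> O[F](\<lambda>_. 1)"
    "\<And>I J JY w0 w r n.
       (\<And>j. (\<lambda>x. J j x - (\<Sum>m<CARD('s) + 3. T (G j) m x * h x ^ m * I m)) \<in> Oh (CARD('s) + 3)) \<Longrightarrow>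
       (\<lambda>x. JY x - (\<Sum>m<CARD('s) + 3. T Y m x * h x ^ m * I m)) \<in> Oh (CARD('s) + 3) \<Longrightarrow>
       (\<And>m. m < CARD('s) + r \<Longrightarrow> (\<Sum>i\<in>UNIV. w0 $ i * (c $ i) ^ m) = I m) \<Longrightarrow> r \<le> 3 \<Longrightarrow>
       \<forall>\<^sub>F x in F. \<forall>j. J j x = (\<Sum>i\<in>UNIV. w x $ i * V (G j) i x) \<Longrightarrow>
       n \<le> CARD('s) + 3 \<Longrightarrow> n \<le> CARD('s) + r + 1 \<Longrightarrow>
       (\<lambda>x. (JY x - (\<Sum>i\<in>UNIV. w x $ i * V Y i x))
          - (\<Sum>m<CARD('s) + 3. D m x * h x ^ m * (I m - (\<Sum>i\<in>UNIV. w0 $ i * (c $ i) ^ m)))) \<in> Oh n"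
proof -
  obtain \<alpha> :: "'x \<Rightarrow> real ^ 's" where \<alpha>: "\<And>j. (\<lambda>x. \<alpha> x $ j) \<in> O[F](\<lambda>_. 1)"
    and match: "\<forall>\<^sub>F x in F. \<forall>m<CARD('s). (\<Sum>j\<in>UNIV. \<alpha> x $ j * T (G j) m x) = T Y m x"
    using solve_coefficients[of "T Y"] T_bounded[OF Y] by auto
  define D where "D m x = T Y m x - (\<Sum>j\<in>UNIV. \<alpha> x $ j * T (G j) m x)" for m x
  show ?thesis
  proof (rule that[of D])
    show D: "D m \<in> O[F](\<lambda>_. 1)" if "m < CARD('s) + 3" for m
      unfolding D_def using \<alpha> T_bounded[OF G that] T_bounded[OF Y that]
      by (intro sum_in_bigo big_sum_in_bigo landau_o.big.mult_in_1)
    fix I J JY and w0 :: "real ^ 's" and w r n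
    assume J: "\<And>j. (\<lambda>x. J j x - (\<Sum>m<CARD('s) + 3. T (G j) m x * h x ^ m * I m)) \<in> Oh (CARD('s) + 3)"
      and JY: "(\<lambda>x. JY x - (\<Sum>m<CARD('s) + 3. T Y m x * h x ^ m * I m)) \<in> Oh (CARD('s) + 3)"
      and exact: "\<And>m. m < CARD('s) + r \<Longrightarrow> (\<Sum>i\<in>UNIV. w0 $ i * (c $ i) ^ m) = I m" and r: "r \<le> 3"
      and w: "\<forall>\<^sub>F x in F. \<forall>j. J j x = (\<Sum>i\<in>UNIV. w x $ i * V (G j) i x)"
      and n: "n \<le> CARD('s) + 3" "n \<le> CARD('s) + r + 1"
    have residual: "(\<lambda>x. (AY x - (\<Sum>j\<in>UNIV. \<alpha> x $ j * B j x))
        - (\<Sum>m<CARD('s) + 3. D m x * h x ^ m * I m)) \<in> Oh (CARD('s) + 3)"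
      if "(\<lambda>x. AY x - (\<Sum>m<CARD('s) + 3. T Y m x * h x ^ m * I m)) \<in> Oh (CARD('s) + 3)"
        "\<And>j. (\<lambda>x. B j x - (\<Sum>m<CARD('s) + 3. T (G j) m x * h x ^ m * I m)) \<in> Oh (CARD('s) + 3)"
      for AY B I
      using sum_in_bigo(2)[OF that(1) expansion_combination[where S = UNIV, OF that(2) \<alpha>]]
      by (simp add: D_def left_diff_distrib sum_subtractf algebra_simps del: sum.lessThan_Suc)
    define RJ where "RJ x = JY x - (\<Sum>j\<in>UNIV. \<alpha> x $ j * J j x)" for x
    define RV where "RV i x = V Y i x - (\<Sum>j\<in>UNIV. \<alpha> x $ j * V (G j) i x)" for i x
    have RJ: "(\<lambda>x. RJ x - (\<Sum>m<CARD('s) + 3. D m x * h x ^ m * I m)) \<in> Oh (CARD('s) + 3)"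
      unfolding RJ_def by (rule residual[OF JY J])
    have RV: "(\<lambda>x. RV i x - (\<Sum>m<CARD('s) + 3. D m x * h x ^ m * (c $ i) ^ m)) \<in> Oh (CARD('s) + 3)" for i
      unfolding RV_def by (rule residual[OF V_expansion[OF Y] V_expansion[OF G]])
    have RV_order: "RV i \<in> Oh (CARD('s))" for i
    proof (rule expansion_order[OF RV D])
      show "\<forall>\<^sub>F x in F. \<forall>k<CARD('s). D k x * c $ i ^ k = 0"
        using match by eventually_elim (simp add: D_def)
    qed auto
    have 1: "(\<lambda>x. (RJ x - (\<Sum>i\<in>UNIV. w0 $ i * RV i x))
        - (\<Sum>m<CARD('s) + 3. D m x * h x ^ m * (I m - (\<Sum>i\<in>UNIV. w0 $ i * (c $ i) ^ m)))) \<in> Oh n"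
      by (rule Oh_mono[OF expansion_diff[OF RJ expansion_sum[where S = UNIV, OF RV]] n(1)])
    have "(\<lambda>x. (w x - w0) $ i) \<in> Oh (r + 1)" for i
    proof (rule Oh_le)
      show "(\<lambda>x. norm (w x - w0)) \<in> Oh (r + 1)" by (rule fitted_weights[OF J exact r w])
      show "\<forall>\<^sub>F x in F. \<bar>(w x - w0) $ i\<bar> \<le> \<bar>norm (w x - w0)\<bar>"
        by (intro always_eventually allI, simp only: abs_norm_cancel component_le_norm_cart)
    qed
    then have "(\<lambda>x. (w x - w0) $ i * RV i x) \<in> Oh n" for i
      by (rule Oh_mono[OF Oh_mult[OF _ RV_order]]) (use n(2) in simp)
    then have 2: "(\<lambda>x. \<Sum>i\<in>UNIV. (w x - w0) $ i * RV i x) \<in> Oh n"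
      by (rule big_sum_in_bigo)
    show "(\<lambda>x. (JY x - (\<Sum>i\<in>UNIV. w x $ i * V Y i x))
          - (\<Sum>m<CARD('s) + 3. D m x * h x ^ m * (I m - (\<Sum>i\<in>UNIV. w0 $ i * (c $ i) ^ m)))) \<in> Oh n"
    proof (rule Oh_eq[OF sum_in_bigo(2)[OF 1 2]])
      show "\<forall>\<^sub>F x in F. (JY x - (\<Sum>i\<in>UNIV. w x $ i * V Y i x))
          - (\<Sum>m<CARD('s) + 3. D m x * h x ^ m * (I m - (\<Sum>i\<in>UNIV. w0 $ i * (c $ i) ^ m)))
        = (RJ x - (\<Sum>i\<in>UNIV. w0 $ i * RV i x))
        - (\<Sum>m<CARD('s) + 3. D m x * h x ^ m * (I m - (\<Sum>i\<in>UNIV. w0 $ i * (c $ i) ^ m)))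
        - (\<Sum>i\<in>UNIV. (w x - w0) $ i * RV i x)"
        using w
      proof eventually_elim
        case (elim x)
        \<comment> \<open>The fitted weights are exact on each basis function, hence on the
          combination, although its coefficients vary with x; only the residual contributes.\<close>
        have "(\<Sum>j\<in>UNIV. \<alpha> x $ j * J j x) = (\<Sum>i\<in>UNIV. w x $ i * (\<Sum>j\<in>UNIV. \<alpha> x $ j * V (G j) i x))"
          using elim unfolding sum_distrib_left by (subst sum.swap) (simp add: sum_distrib_left mult_ac)
        then have "JY x - (\<Sum>i\<in>UNIV. w x $ i * V Y i x) = RJ x - (\<Sum>i\<in>UNIV. w x $ i * RV i x)"
          by (simp add: RJ_def RV_def right_diff_distrib sum_subtractf)
        then show ?case by (simp add: left_diff_distrib sum_subtractf)
      qed
    qed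
  qed
qed

end

section \<open>Regular times\<close>

lemma Ck_on_jet:
  assumes "Ck_on k S g"
  obtains G where "jet k S G" "\<And>t. t \<in> S \<Longrightarrow> G 0 t = g t"
  using assms unfolding Ck_on_def jet_def by blast

lemma jet_shift: "jet (N + m) S G \<Longrightarrow> jet N S (\<lambda>k. G (k + m))"
  unfolding jet_def by auto

lemma jet_mono: "jet N S G \<Longrightarrow> n \<le> N \<Longrightarrow> jet n S G"
  using jet_continuous[of N S G n] unfolding jet_def by auto

lemma jet_deriv:
  assumes "jet N UNIV G" "k < N"
  shows "deriv (G k) = G (Suc k)"
  using assms unfolding jet_def by (auto intro!: ext DERIV_imp_deriv)

lemma jet_deriv_funpow:
  assumes "jet N UNIV G" "k + m \<le> N"
  shows "(deriv ^^ k) (G m) = G (k + m)"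
  using assms(2) by (induction k) (auto simp: jet_deriv[OF assms(1)])

text \<open>Quantitative linear independence, for any number of vectors up to the dimension. In the
  induction step the part \<open>z\<close> of the new vector orthogonal to the earlier ones controls
  the last coefficient, and the other coefficients follow from the induction hypothesis.\<close>

lemma independent_family_bounded_below:
  fixes v :: "nat \<Rightarrow> 'e::euclidean_space"
  assumes "\<And>a. (\<Sum>k<n. a k *\<^sub>R v k) = 0 \<Longrightarrow> \<forall>k<n. a k = 0"
  shows "\<exists>C>0. \<forall>a. (\<Sum>k<n. \<bar>a k\<bar>) \<le> C * norm (\<Sum>k<n. a k *\<^sub>R v k)"
  using assms
proof (induction n)
  case 0
  show ?case by (intro exI[of _ 1]) auto
next
  case (Suc n)
  have "\<forall>k<n. a k = 0" if "(\<Sum>k<n. a k *\<^sub>R v k) = 0" for a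
  proof -
    have "(\<Sum>k<n. (if k = n then 0 else a k) *\<^sub>R v k) = (\<Sum>k<n. a k *\<^sub>R v k)"
      by (intro sum.cong) auto
    then have "(\<Sum>k<Suc n. (if k = n then 0 else a k) *\<^sub>R v k) = 0"
      using that by simp
    from Suc.prems[OF this] show ?thesis by (metis less_SucI less_irrefl)
  qed
  with Suc.IH obtain C where C: "C > 0" "\<And>a. (\<Sum>k<n. \<bar>a k\<bar>) \<le> C * norm (\<Sum>k<n. a k *\<^sub>R v k)"
    by blast
  define X where "X = range (\<lambda>a :: nat \<Rightarrow> real. \<Sum>k<n. a k *\<^sub>R v k)"
  have X: "subspace X"
    unfolding subspace_def
  proof (intro conjI ballI allI)
    show "0 \<in> X" unfolding X_def by (rule image_eqI[of _ _ "\<lambda>_. 0"]) auto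
    fix x y assume "x \<in> X" "y \<in> X"
    then obtain a b where "x = (\<Sum>k<n. a k *\<^sub>R v k)" "y = (\<Sum>k<n. b k *\<^sub>R v k)"
      by (auto simp: X_def)
    then have "x + y = (\<Sum>k<n. (a k + b k) *\<^sub>R v k)" by (simp add: scaleR_left_distrib sum.distrib)
    then show "x + y \<in> X" by (auto simp: X_def)
  next
    fix x and r :: real assume "x \<in> X"
    then obtain a where "x = (\<Sum>k<n. a k *\<^sub>R v k)" by (auto simp: X_def)
    then have "r *\<^sub>R x = (\<Sum>k<n. (r * a k) *\<^sub>R v k)" by (simp add: scaleR_sum_right)
    then show "r *\<^sub>R x \<in> X" by (auto simp: X_def)
  qed
  have "span X = X" using X by (simp add: span_eq_iff)
  obtain y z where "y \<in> span X" "\<And>w. w \<in> span X \<Longrightarrow> orthogonal z w" and vn: "v n = y + z"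
    using orthogonal_subspace_decomp_exists[of X "v n"] by blast
  then have y: "y \<in> X" and z: "\<And>w. w \<in> X \<Longrightarrow> z \<bullet> w = 0"
    using \<open>span X = X\<close> by (auto simp: orthogonal_def)
  have "z \<noteq> 0"
  proof
    assume "z = 0"
    then obtain b where "v n = (\<Sum>k<n. b k *\<^sub>R v k)" using y vn by (auto simp: X_def)
    moreover have "(\<Sum>k<n. (if k = n then - 1 else b k) *\<^sub>R v k) = (\<Sum>k<n. b k *\<^sub>R v k)"
      by (intro sum.cong) auto
    ultimately have "(\<Sum>k<Suc n. (if k = n then - 1 else b k) *\<^sub>R v k) = 0"
      by simp
    from Suc.prems[OF this] show False by auto
  qed
  \<comment> \<open>The last coefficient is at most \<open>norm ?s / norm z\<close>. It enters once
    directly and once, with factor \<open>C * norm (v n)\<close>, when its term is moved to the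
    other side.\<close>
  define C' where "C' = C + (C * norm (v n) + 1) / norm z"
  have "C' > 0" using C(1) by (auto simp: C'_def intro!: add_pos_nonneg)
  moreover have "(\<Sum>k<Suc n. \<bar>a k\<bar>) \<le> C' * norm (\<Sum>k<Suc n. a k *\<^sub>R v k)" for a
  proof -
    let ?s = "\<Sum>k<Suc n. a k *\<^sub>R v k"
    have "(\<Sum>k<n. a k *\<^sub>R v k) \<in> X" by (auto simp: X_def)
    then have "z \<bullet> ?s = a n * (norm z)\<^sup>2"
      using z[OF y] by (simp add: z inner_add_right vn power2_norm_eq_inner)
    then have "\<bar>a n\<bar> * (norm z)\<^sup>2 \<le> norm z * norm ?s"
      using Cauchy_Schwarz_ineq2[of z ?s] by (simp add: abs_mult)
    then have an: "\<bar>a n\<bar> \<le> norm ?s / norm z"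
      using \<open>z \<noteq> 0\<close> by (simp add: field_simps power2_eq_square)
    have "(\<Sum>k<n. \<bar>a k\<bar>) \<le> C * norm (?s - a n *\<^sub>R v n)" using C(2)[of a] by simp
    also have "\<dots> \<le> C * (norm ?s + \<bar>a n\<bar> * norm (v n))"
      using C(1) norm_triangle_ineq4[of ?s "a n *\<^sub>R v n"] by simp
    finally have "(\<Sum>k<Suc n. \<bar>a k\<bar>) \<le> C * norm ?s + (C * norm (v n) + 1) * \<bar>a n\<bar>"
      by (simp add: algebra_simps)
    also have "\<dots> \<le> C * norm ?s + (C * norm (v n) + 1) * (norm ?s / norm z)"
      using C(1) an by (intro add_left_mono mult_left_mono) auto
    finally show ?thesis by (simp add: C'_def algebra_simps add_divide_distrib)
  qed
  ultimately show ?case by blast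
qed

text \<open>The product of E with exp(-M t) is nonincreasing, starts at 0 and is
  nonnegative.\<close>

lemma gronwall_zero:
  fixes E :: "real \<Rightarrow> real"
  assumes deriv: "\<And>t. t \<in> {p..q} \<Longrightarrow> (E has_real_derivative E' t) (at t within {p..q})"
    and le: "\<And>t. t \<in> {p..q} \<Longrightarrow> E' t \<le> M * E t"
    and E0: "E p = 0" and nonneg: "\<And>t. 0 \<le> E t" and t: "t \<in> {p..q}"
  shows "E t = 0"
proof (cases "p < t")
  case True
  have "E t * exp (- M * t) \<le> E p * exp (- M * p)"
  proof (rule DERIV_nonpos_imp_decreasing_open[OF less_imp_le[OF True]])
    fix x assume x: "p < x" "x < t"
    then have "(E has_real_derivative E' x) (at x)"
      using deriv[of x] t by (auto simp: at_within_Icc_at)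
    then have "((\<lambda>t. E t * exp (- M * t)) has_real_derivative (E' x - M * E x) * exp (- M * x)) (at x)"
      by (auto intro!: derivative_eq_intros simp: algebra_simps)
    moreover have "(E' x - M * E x) * exp (- M * x) \<le> 0"
      using le[of x] x t by (intro mult_nonpos_nonneg) auto
    ultimately show "\<exists>y. ((\<lambda>t. E t * exp (- M * t)) has_real_derivative y) (at x) \<and> y \<le> 0" by blast
  next
    have "continuous_on {p..q} E" using deriv by (rule DERIV_continuous_on)
    then show "continuous_on {p..t} (\<lambda>t. E t * exp (- M * t))"
      using t by (intro continuous_intros) (auto elim: continuous_on_subset)
  qed
  then have "E t \<le> 0" using E0 by (simp add: mult_le_0_iff not_le[symmetric])
  then show ?thesis using nonneg[of t] by simp
qed (use t E0 in auto)

text \<open>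
  A vanishing Wronskian alone does not imply linear dependence (Peano, Bocher). On a subinterval
  where the number n of independent rows of the Wronskian matrix is constant, however, the
  functions solve a common linear differential equation of order n, and a combination whose
  initial values vanish is 0.
\<close>

lemma vanishing_wronskian_imp_dependent:
  fixes g :: "'s::finite \<Rightarrow> nat \<Rightarrow> real \<Rightarrow> real"
  assumes g: "\<And>j. jet (CARD('s)) {p..q} (g j)" and pq: "p < q"
    and degenerate: "\<And>t. t \<in> {p..q} \<Longrightarrow>
      \<exists>\<alpha> :: real ^ 's. \<alpha> \<noteq> 0 \<and> (\<forall>k<CARD('s). (\<Sum>j\<in>UNIV. \<alpha> $ j * g j k t) = 0)"
  obtains p' q' and \<alpha> :: "real ^ 's" where "p \<le> p'" "p' < q'" "q' \<le> q" "\<alpha> \<noteq> 0"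
    "\<And>t. t \<in> {p'..q'} \<Longrightarrow> (\<Sum>j\<in>UNIV. \<alpha> $ j * g j 0 t) = 0"
proof -
  define W where "W k t = (\<chi> j. g j k t)" for k t
  have inner_W: "\<alpha> \<bullet> W k t = (\<Sum>j\<in>UNIV. \<alpha> $ j * g j k t)" for \<alpha> k t
    by (simp add: W_def inner_vec_def)
  \<comment> \<open>\<open>W k t\<close> is the k-th row of the Wronskian matrix, and
    \<open>indep n t\<close> says that the first n rows are independent. \<open>P n\<close> says
    that this fails throughout some subinterval.\<close>
  define indep where "indep n t \<longleftrightarrow> (\<forall>a. (\<Sum>k<n. a k *\<^sub>R W k t) = 0 \<longrightarrow> (\<forall>k<n. a k = 0))" for n t
  define P where "P n \<longleftrightarrow> (\<exists>p' q'. p \<le> p' \<and> p' < q' \<and> q' \<le> q \<and> (\<forall>t\<in>{p'..q'}. \<not> indep n t))" for n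
  have "P CARD('s)"
    unfolding P_def
  proof (intro exI conjI ballI notI)
    fix t assume t: "t \<in> {p..q}" and ind: "indep CARD('s) t"
    obtain \<alpha> :: "real ^ 's" where \<alpha>: "\<alpha> \<noteq> 0" "\<And>k. k < CARD('s) \<Longrightarrow> \<alpha> \<bullet> W k t = 0"
      using degenerate[OF t] inner_W by auto
    obtain e :: "'s \<Rightarrow> nat" where e: "bij_betw e UNIV {..<CARD('s)}"
      using ex_bij_betw_finite_nat[of "UNIV :: 's set"] by (auto simp: lessThan_atLeast0)
    have e_less: "e i < CARD('s)" for i using e by (auto simp: bij_betw_def)
    \<comment> \<open>Column dependence is turned into row dependence: s independent rows would span
      the space, so \<open>\<alpha>\<close>, orthogonal to every row, would be orthogonal to
      itself.\<close>
    define L :: "real ^ 's \<Rightarrow> real ^ 's" where "L a = (\<Sum>i\<in>UNIV. a $ i *\<^sub>R W (e i) t)" for a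
    have lin: "linear L"
      by (auto intro!: linearI simp: L_def scaleR_left_distrib sum.distrib scaleR_sum_right)
    have "a = 0" if "L a = 0" for a
    proof -
      have "(\<Sum>k<CARD('s). a $ (inv_into UNIV e k) *\<^sub>R W k t) = L a"
        unfolding L_def sum.reindex_bij_betw[OF e, symmetric]
        using e by (intro sum.cong) (auto simp: bij_betw_def)
      with ind that have "\<forall>k<CARD('s). a $ (inv_into UNIV e k) = 0"
        unfolding indep_def by metis
      moreover have "inv_into UNIV e (e i) = i" for i
        using e by (auto simp: bij_betw_def)
      ultimately show "a = 0" using e_less by (metis vec_eq_iff zero_index)
    qed
    then have "surj L" using linear_injective_0[OF lin] linear_injective_imp_surjective[OF lin] by blast
    then obtain a where "L a = \<alpha>" by (metis surjD)
    then have "\<alpha> \<bullet> \<alpha> = (\<Sum>i\<in>UNIV. a $ i * (\<alpha> \<bullet> W (e i) t))"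
      unfolding L_def by (metis (no_types, lifting) inner_scaleR_right inner_sum_right sum.cong)
    also have "\<dots> = 0" by (intro sum.neutral) (simp add: e_less \<alpha>(2))
    finally show False using \<alpha>(1) by simp
  qed (use pq in auto)
  \<comment> \<open>By minimality the first m = n - 1 rows cannot be dependent throughout any
    subinterval, while the first m + 1 rows are dependent on all of [p1, q1].\<close>
  define n where "n = (LEAST n. P n)"
  have "P n" unfolding n_def using \<open>P CARD('s)\<close> by (rule LeastI)
  have "\<not> P 0" by (auto simp: P_def indep_def)
  then obtain m where m: "n = Suc m" using \<open>P n\<close> by (cases n) auto
  have "m < CARD('s)" using Least_le[of P, OF \<open>P CARD('s)\<close>] m by (simp add: n_def)
  have "\<not> P m" using not_less_Least[of m P] m by (simp add: n_def)
  obtain p1 q1 where 1: "p \<le> p1" "p1 < q1" "q1 \<le> q" "\<And>t. t \<in> {p1..q1} \<Longrightarrow> \<not> indep (Suc m) t"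
    using \<open>P n\<close> m by (auto simp: P_def)
  \<comment> \<open>Cutting off a third on each side places \<open>t1\<close> in the open interval,
    where the rows are continuous from both sides.\<close>
  define \<delta> where "\<delta> = (q1 - p1) / 3"
  have "\<exists>t\<in>{p1 + \<delta>..q1 - \<delta>}. indep m t"
  proof (rule ccontr)
    assume none: "\<not> (\<exists>t\<in>{p1 + \<delta>..q1 - \<delta>}. indep m t)"
    have "p \<le> p1 + \<delta>" "p1 + \<delta> < q1 - \<delta>" "q1 - \<delta> \<le> q"
      using 1(1-3) by (auto simp: \<delta>_def field_simps)
    then have "P m" unfolding P_def using none by blast
    with \<open>\<not> P m\<close> show False ..
  qed
  then obtain t1 where "t1 \<in> {p1 + \<delta>..q1 - \<delta>}" and "indep m t1" by blast
  then have t1: "p1 < t1" "t1 < q1" "indep m t1"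
    using 1(2) by (auto simp: \<delta>_def field_simps)
  obtain C where C: "C > 0" "\<And>a. (\<Sum>k<m. \<bar>a k\<bar>) \<le> C * norm (\<Sum>k<m. a k *\<^sub>R W k t1)"
    using independent_family_bounded_below[where n = m and v = "\<lambda>k. W k t1"] t1(3) by (auto simp: indep_def)
  have W_cont: "continuous_on {p..q} (W k)" if "k \<le> CARD('s)" for k
    unfolding W_def using that by (intro continuous_intros jet_continuous[OF g])
  have "((\<lambda>t. C * (\<Sum>k<m. norm (W k t - W k t1))) \<longlongrightarrow> C * (\<Sum>k<m. norm (W k t1 - W k t1))) (at t1)"
  proof (intro tendsto_intros)
    fix k assume "k \<in> {..<m}"
    then have "isCont (W k) t1"
      using W_cont[of k] \<open>m < CARD('s)\<close> t1 1 by (intro continuous_on_interior[of "{p..q}"]) auto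
    then show "(W k \<longlongrightarrow> W k t1) (at t1)" by (simp add: isCont_def)
  qed
  then have "\<forall>\<^sub>F t in at t1. C * (\<Sum>k<m. norm (W k t - W k t1)) < 1 / 2"
    by (rule order_tendstoD) simp
  then obtain r where r: "r > 0"
    and "\<And>t. t \<noteq> t1 \<Longrightarrow> dist t t1 < r \<Longrightarrow> C * (\<Sum>k<m. norm (W k t - W k t1)) < 1 / 2"
    unfolding eventually_at by blast
  then have r': "C * (\<Sum>k<m. norm (W k t - W k t1)) < 1 / 2" if "dist t t1 < r" for t
    using that by (cases "t = t1") auto
  \<comment> \<open>To the right of \<open>t1\<close>, within r/2, the first m rows stay independent
    with the constant doubled; starting exactly at \<open>t1\<close> provides the initial point of
    the differential equation.\<close>
  define p' q' where "p' = t1" and "q' = min q1 (t1 + r / 2)"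
  have 2: "p \<le> p'" "p1 \<le> p'" "p' < q'" "q' \<le> q1" "q' \<le> q"
    using 1 t1 r by (auto simp: p'_def q'_def)
  have bound: "(\<Sum>k<m. \<bar>a k\<bar>) \<le> 2 * C * norm (\<Sum>k<m. a k *\<^sub>R W k t)" if t: "t \<in> {p'..q'}" for a t
  proof -
    have "norm (\<Sum>k<m. a k *\<^sub>R (W k t - W k t1)) \<le> (\<Sum>k<m. (\<Sum>k<m. \<bar>a k\<bar>) * norm (W k t - W k t1))"
      by (intro sum_norm_le) (auto intro!: mult_right_mono member_le_sum)
    also have "\<dots> = (\<Sum>k<m. \<bar>a k\<bar>) * (\<Sum>k<m. norm (W k t - W k t1))"
      by (simp add: sum_distrib_left)
    finally have "C * norm (\<Sum>k<m. a k *\<^sub>R (W k t - W k t1))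
        \<le> (\<Sum>k<m. \<bar>a k\<bar>) * (C * (\<Sum>k<m. norm (W k t - W k t1)))"
      using C(1) by (simp add: mult.left_commute)
    also have "\<dots> \<le> (\<Sum>k<m. \<bar>a k\<bar>) * (1 / 2)"
    proof (intro mult_left_mono sum_nonneg)
      have "dist t t1 < r" using t r by (auto simp: p'_def q'_def dist_real_def)
      then show "C * (\<Sum>k<m. norm (W k t - W k t1)) \<le> 1 / 2" using r' less_imp_le by blast
    qed auto
    finally have *: "C * norm (\<Sum>k<m. a k *\<^sub>R (W k t - W k t1)) \<le> (\<Sum>k<m. \<bar>a k\<bar>) / 2" by simp
    have "(\<Sum>k<m. a k *\<^sub>R W k t1) = (\<Sum>k<m. a k *\<^sub>R W k t) - (\<Sum>k<m. a k *\<^sub>R (W k t - W k t1))"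
      by (simp add: scaleR_right_diff_distrib sum_subtractf)
    then have "norm (\<Sum>k<m. a k *\<^sub>R W k t1)
        \<le> norm (\<Sum>k<m. a k *\<^sub>R W k t) + norm (\<Sum>k<m. a k *\<^sub>R (W k t - W k t1))"
      by (simp add: norm_triangle_ineq4)
    then have "C * norm (\<Sum>k<m. a k *\<^sub>R W k t1)
        \<le> C * norm (\<Sum>k<m. a k *\<^sub>R W k t) + C * norm (\<Sum>k<m. a k *\<^sub>R (W k t - W k t1))"
      using C(1) by (simp add: distrib_left[symmetric])
    with * C(2)[of a] show ?thesis by linarith
  qed
  \<comment> \<open>This is the differential equation of order m. Its coefficients are chosen
    pointwise and need not be continuous; the bound above keeps them bounded, which suffices for the
    energy estimate.\<close>
  have ode: "\<exists>b. W m t = (\<Sum>k<m. b k *\<^sub>R W k t)" if t: "t \<in> {p'..q'}" for t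
  proof -
    from 1(4)[of t] t 2 obtain a where a: "(\<Sum>k<Suc m. a k *\<^sub>R W k t) = 0" "\<exists>k<Suc m. a k \<noteq> 0"
      by (auto simp: indep_def)
    have "a m \<noteq> 0"
    proof
      assume "a m = 0"
      then have "(\<Sum>k<m. \<bar>a k\<bar>) \<le> 0" using bound[OF t, of a] a(1) by simp
      then have "(\<Sum>k<m. \<bar>a k\<bar>) = 0" by (intro antisym sum_nonneg) auto
      then have "\<forall>k<m. a k = 0" by (subst (asm) sum_nonneg_eq_0_iff) auto
      then show False using a(2) \<open>a m = 0\<close> by (auto simp: less_Suc_eq)
    qed
    have "a m *\<^sub>R W m t = - (\<Sum>k<m. a k *\<^sub>R W k t)" using a(1) by (simp add: eq_neg_iff_add_eq_0 add.commute)
    then have "(1 / a m) *\<^sub>R a m *\<^sub>R W m t = (\<Sum>k<m. (- a k / a m) *\<^sub>R W k t)"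
      by (simp add: scaleR_sum_right sum_negf)
    then have "W m t = (\<Sum>k<m. (- a k / a m) *\<^sub>R W k t)" using \<open>a m \<noteq> 0\<close> by simp
    then show ?thesis by (rule exI[of _ "\<lambda>k. - a k / a m"])
  qed
  \<comment> \<open>Fewer than s initial conditions leave a nonzero solution.\<close>
  obtain \<alpha> :: "real ^ 's" where \<alpha>: "\<alpha> \<noteq> 0" "\<And>k. k < m \<Longrightarrow> \<alpha> \<bullet> W k p' = 0"
  proof -
    have "dim ((\<lambda>k. W k p') ` {..<m}) \<le> card ((\<lambda>k. W k p') ` {..<m})" by (intro dim_le_card') auto
    also have "\<dots> \<le> m" using card_image_le[of "{..<m}" "\<lambda>k. W k p'"] by simp
    finally have "dim ((\<lambda>k. W k p') ` {..<m}) < DIM(real ^ 's)" using \<open>m < CARD('s)\<close> by simp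
    from orthogonal_to_subspace_exists[OF this] obtain x where
      "x \<noteq> 0" "\<And>y. y \<in> span ((\<lambda>k. W k p') ` {..<m}) \<Longrightarrow> orthogonal x y" by blast
    then show ?thesis by (intro that[of x]) (auto simp: orthogonal_def intro: span_base)
  qed
  define \<phi> where "\<phi> k t = \<alpha> \<bullet> W k t" for k t
  have \<phi>_deriv: "(\<phi> k has_real_derivative \<phi> (Suc k) t) (at t within {p'..q'})"
    if "k < CARD('s)" "t \<in> {p'..q'}" for k t
    unfolding \<phi>_def inner_W
  proof (intro derivative_eq_intros DERIV_sum)
    fix j
    show "(g j k has_real_derivative g j (Suc k) t) (at t within {p'..q'})"
      using jet_subset[OF g[of j], of "{p'..q'}"] that 2 unfolding jet_def by auto
  qed auto
  obtain B where B: "\<And>t. t \<in> {p'..q'} \<Longrightarrow> norm (W m t) \<le> B"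
  proof -
    have "bounded (W m ` {p..q})"
      using \<open>m < CARD('s)\<close> by (intro compact_imp_bounded compact_continuous_image W_cont) auto
    then show ?thesis using 2 that by (fastforce simp: bounded_iff)
  qed
  define E where "E t = (\<Sum>k<m. (\<phi> k t)\<^sup>2)" for t
  \<comment> \<open>Each of the m summands of the derivative of E is at most \<phi>_k^2 +
    \<phi>_(k+1)^2. The first square contributes E, the second at most (1 + (2 C B)^2) E, where the
    part with C and B covers k + 1 = m.\<close>
  define M where "M = real m * (2 + (2 * C * B)\<^sup>2)"
  have \<phi>_le: "(\<phi> k t)\<^sup>2 \<le> E t" if "k < m" for k t
    unfolding E_def using that by (intro member_le_sum) auto
  have E_nonneg: "0 \<le> E t" for t by (auto simp: E_def intro: sum_nonneg)
  have \<phi>_m: "(\<phi> m t)\<^sup>2 \<le> (2 * C * B)\<^sup>2 * E t" if t: "t \<in> {p'..q'}" for t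
  proof -
    obtain b where b: "W m t = (\<Sum>k<m. b k *\<^sub>R W k t)" using ode[OF t] by blast
    have "(\<Sum>k<m. \<bar>b k\<bar>) \<le> 2 * C * norm (W m t)" using bound[OF t, of b] b by simp
    also have "\<dots> \<le> 2 * C * B" using B[OF t] C(1) by simp
    finally have b_le: "(\<Sum>k<m. \<bar>b k\<bar>) \<le> 2 * C * B" .
    have "\<phi> m t = (\<Sum>k<m. b k * \<phi> k t)" by (simp add: \<phi>_def b inner_sum_right)
    then have "\<bar>\<phi> m t\<bar> \<le> (\<Sum>k<m. \<bar>b k\<bar> * sqrt (E t))"
      using \<phi>_le by (auto intro!: order_trans[OF sum_abs] sum_mono mult_left_mono
        simp: abs_mult real_le_rsqrt)
    also have "\<dots> \<le> (2 * C * B) * sqrt (E t)"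
      unfolding sum_distrib_right[symmetric] using b_le E_nonneg by (intro mult_right_mono) auto
    finally have "\<bar>\<phi> m t\<bar>\<^sup>2 \<le> ((2 * C * B) * sqrt (E t))\<^sup>2" by (intro power_mono) auto
    then show ?thesis using E_nonneg[of t] by (simp add: power_mult_distrib)
  qed
  have E_zero: "E t = 0" if t: "t \<in> {p'..q'}" for t
  proof (rule gronwall_zero[of p' q' E "\<lambda>t. \<Sum>k<m. 2 * \<phi> k t * \<phi> (Suc k) t" M])
    fix t assume t: "t \<in> {p'..q'}"
    show "(E has_real_derivative (\<Sum>k<m. 2 * \<phi> k t * \<phi> (Suc k) t)) (at t within {p'..q'})"
      unfolding E_def using \<open>m < CARD('s)\<close> t
      by (auto intro!: derivative_eq_intros \<phi>_deriv sum.cong)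
    have "(\<Sum>k<m. 2 * \<phi> k t * \<phi> (Suc k) t) \<le> (\<Sum>k<m. (2 + (2 * C * B)\<^sup>2) * E t)"
    proof (intro sum_mono)
      fix k assume "k \<in> {..<m}"
      then have k: "k < m" by simp
      have "(\<phi> (Suc k) t)\<^sup>2 \<le> (1 + (2 * C * B)\<^sup>2) * E t"
      proof (cases "Suc k = m")
        case True
        then show ?thesis using \<phi>_m[OF t] E_nonneg[of t] by (simp add: distrib_right)
      next
        case False
        then have "(\<phi> (Suc k) t)\<^sup>2 \<le> 1 * E t" using \<phi>_le[of "Suc k" t] k by simp
        also have "\<dots> \<le> (1 + (2 * C * B)\<^sup>2) * E t" using E_nonneg[of t] by (intro mult_right_mono) auto
        finally show ?thesis .
      qed
      moreover have "2 * \<phi> k t * \<phi> (Suc k) t \<le> (\<phi> k t)\<^sup>2 + (\<phi> (Suc k) t)\<^sup>2" by (rule sum_squares_bound)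
      ultimately show "2 * \<phi> k t * \<phi> (Suc k) t \<le> (2 + (2 * C * B)\<^sup>2) * E t"
        using \<phi>_le[OF k, of t] by (simp add: distrib_right)
    qed
    then show "(\<Sum>k<m. 2 * \<phi> k t * \<phi> (Suc k) t) \<le> M * E t" by (simp add: M_def mult.assoc)
  qed (use \<alpha>(2) E_nonneg t in \<open>auto simp: E_def \<phi>_def\<close>)
  show ?thesis
  proof (rule that[OF 2(1,3,5) \<alpha>(1)])
    fix t assume t: "t \<in> {p'..q'}"
    have "\<phi> 0 t = 0"
    \<comment> \<open>For m = 0 the energy is an empty sum; there the equation itself says that row
      0 vanishes.\<close>
    proof (cases "m = 0")
      case True
      then show ?thesis using ode[OF t] by (simp add: \<phi>_def)
    next
      case False
      then show ?thesis using \<phi>_le[of 0 t] E_zero[OF t] by simp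
    qed
    then show "(\<Sum>j\<in>UNIV. \<alpha> $ j * g j 0 t) = 0" by (simp add: \<phi>_def inner_W)
  qed
qed

lemma jet_d2:
  assumes "jet N UNIV G" "2 \<le> N" "\<And>t. G 0 t = v t"
  shows "deriv v = G 1" "d2 v = G 2"
proof -
  have "G 0 = v" using assms(3) by (intro ext)
  then show "deriv v = G 1" "d2 v = G 2"
    using jet_deriv[OF assms(1), of 0] jet_deriv[OF assms(1), of 1] assms(2)
    by (auto simp: d2_def numeral_2_eq_2)
qed

section \<open>Regular times are relatively open and dense\<close>

lemma regular_times_jet:
  fixes u :: "'s::finite \<Rightarrow> real \<Rightarrow> real"
  assumes G: "\<And>j. jet (CARD('s) + 5) UNIV (G j)" "\<And>j t. G j 0 t = u j t"
  shows "regular_times t0 T u = {t \<in> {t0..t0+T}. \<forall>\<alpha> :: real ^ 's.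
    (\<forall>k<CARD('s). (\<Sum>j\<in>UNIV. \<alpha> $ j * G j (k + 2) t) = 0) \<longrightarrow> \<alpha> = 0}"
proof -
  have "(deriv ^^ k) (d2 (u j)) t = G j (k + 2) t" if "k < CARD('s)" for k j t
    using jet_deriv_funpow[OF G(1), of k 2] jet_d2(2)[OF G(1) _ G(2)] that by simp
  then show ?thesis unfolding regular_times_def by simp
qed

text \<open>The lower bound of the Wronskian system at t persists, with doubled constant, at all
  nearby times by continuity of the jets.\<close>

lemma openin_regular_times:
  fixes u :: "'s::finite \<Rightarrow> real \<Rightarrow> real"
  assumes G: "\<And>j. jet (CARD('s) + 5) UNIV (G j)" "\<And>j t. G j 0 t = u j t"
  shows "openin (top_of_set {t0..t0+T}) (regular_times t0 T u)"
  unfolding openin_euclidean_subtopology_iff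
proof (intro conjI ballI)
  fix t assume "t \<in> regular_times t0 T u"
  then have inj: "\<alpha> = 0" if "\<And>k. k < CARD('s) \<Longrightarrow> (\<Sum>j\<in>UNIV. \<alpha> $ j * G j (k + 2) t) = 0"
    for \<alpha> :: "real ^ 's"
    using that by (auto simp: regular_times_jet[OF G])
  have "\<exists>C>0. \<forall>t'\<in>{t}.
      (\<forall>\<alpha> :: real ^ 's. norm \<alpha> \<le> C * (\<Sum>k<CARD('s). \<bar>\<Sum>j\<in>UNIV. \<alpha> $ j * G j (k + 2) t'\<bar>)) \<and>
      (\<forall>v. \<exists>\<alpha> :: real ^ 's. \<forall>k<CARD('s). (\<Sum>j\<in>UNIV. \<alpha> $ j * G j (k + 2) t') = v k)"
    using inj by (intro square_system) auto
  then obtain C where C: "C > 0" "\<And>\<alpha> :: real ^ 's.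
      norm \<alpha> \<le> C * (\<Sum>k<CARD('s). \<bar>\<Sum>j\<in>UNIV. \<alpha> $ j * G j (k + 2) t\<bar>)"
    by blast
  have "(G j (k + 2) \<longlongrightarrow> G j (k + 2) t) (nhds t)" if "k < CARD('s)" for j k
    using jet_continuous[OF G(1), of "k + 2" j] that
    by (simp add: continuous_on_eq_continuous_at tendsto_at_iff_tendsto_nhds[symmetric] isCont_def)
  then have "\<forall>\<^sub>F t' in nhds t. \<forall>\<alpha> :: real ^ 's.
      norm \<alpha> \<le> 2 * C * (\<Sum>k<CARD('s). \<bar>\<Sum>j\<in>UNIV. \<alpha> $ j * G j (k + 2) t'\<bar>)"
    by (rule square_system_perturbed[OF C])
  then obtain r where r: "r > 0" "\<And>t' (\<alpha> :: real ^ 's). dist t' t < r \<Longrightarrow>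
      norm \<alpha> \<le> 2 * C * (\<Sum>k<CARD('s). \<bar>\<Sum>j\<in>UNIV. \<alpha> $ j * G j (k + 2) t'\<bar>)"
    unfolding eventually_nhds_metric by blast
  have "t' \<in> regular_times t0 T u" if t': "t' \<in> {t0..t0+T}" "dist t' t < r" for t'
    unfolding regular_times_jet[OF G]
  proof (intro CollectI conjI allI impI t'(1))
    fix \<alpha> :: "real ^ 's"
    assume "\<forall>k<CARD('s). (\<Sum>j\<in>UNIV. \<alpha> $ j * G j (k + 2) t') = 0"
    then show "\<alpha> = 0" using r(2)[OF t'(2), of \<alpha>] by simp
  qed
  with r(1) show "\<exists>e>0. \<forall>t'\<in>{t0..t0+T}. dist t' t < e \<longrightarrow> t' \<in> regular_times t0 T u" by blast
qed (auto simp: regular_times_def)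

text \<open>From the midpoint of [p, q], all nodes t + c_i h stay inside for every small h, whatever
  the signs of the c_i. A linear relation on [p, q] thus makes the collocation matrix singular on a
  whole interval of h, which is not a null set.\<close>

lemma collocation_condition_imp_independent:
  fixes c :: "real ^ 's::finite" and \<alpha> :: "real ^ 's"
  assumes colloc: "collocation_condition t0 T hmax c u"
    and pq: "t0 \<le> p" "p < q" "q \<le> t0 + T" and \<alpha>: "\<alpha> \<noteq> 0"
  shows "\<exists>t\<in>{p..q}. (\<Sum>j\<in>UNIV. \<alpha> $ j * d2 (u j) t) \<noteq> 0"
proof (rule ccontr)
  assume "\<not> (\<exists>t\<in>{p..q}. (\<Sum>j\<in>UNIV. \<alpha> $ j * d2 (u j) t) \<noteq> 0)"
  then have zero: "(\<Sum>j\<in>UNIV. \<alpha> $ j * d2 (u j) t) = 0" if "t \<in> {p..q}" for t using that by blast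
  define t where "t = (p + q) / 2"
  define B where "B = 1 + (\<Sum>i\<in>UNIV. \<bar>c $ i\<bar>)"
  have B: "0 < B" "\<bar>c $ i\<bar> \<le> B" for i
    by (auto simp: B_def intro!: add_pos_nonneg sum_nonneg order_trans[OF member_le_sum[of i UNIV "\<lambda>i. \<bar>c $ i\<bar>"]])
  define m where "m = min hmax ((q - p) / 2 / B)"
  have "0 < m" using colloc pq B by (auto simp: m_def collocation_condition_def)
  have singular: "\<not> invertible (collocation_matrix c u t h)" if h: "h \<in> {0<..<m}" for h
  proof
    assume "invertible (collocation_matrix c u t h)"
    moreover have "collocation_matrix c u t h *v \<alpha> = 0"
    proof -
      have "t + c $ i * h \<in> {p..q}" for i
      proof -
        have "\<bar>c $ i * h\<bar> \<le> B * h" using B(2)[of i] h by (simp add: abs_mult mult_right_mono)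
        also have "\<dots> \<le> (q - p) / 2" using h B(1) by (auto simp: m_def field_simps)
        finally show ?thesis by (auto simp: t_def abs_le_iff field_simps)
      qed
      then show ?thesis
        using zero by (simp add: vec_eq_iff matrix_vector_mult_def collocation_matrix_def at_stages_def mult.commute)
    qed
    ultimately show False
      using \<alpha> by (metis invertible_def matrix_left_invertible_ker)
  qed
  have "t \<in> {t0..<t0+T}" using pq by (auto simp: t_def)
  then have "AE h in lborel. h \<in> {0..hmax} \<longrightarrow> invertible (collocation_matrix c u t h)"
    using colloc by (auto simp: collocation_condition_def)
  then have "AE h in lborel. h \<notin> {0<..<m}"
    by eventually_elim (use singular in \<open>auto simp: m_def\<close>)
  then have "{0<..<m} \<in> null_sets lborel" by (subst AE_iff_null_sets) auto
  then show False using \<open>0 < m\<close> by (simp add: null_sets_def)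
qed

lemma dense_regular_times:
  fixes u :: "'s::finite \<Rightarrow> real \<Rightarrow> real"
  assumes T: "0 < T"
    and G: "\<And>j. jet (CARD('s) + 5) UNIV (G j)" "\<And>j t. G j 0 t = u j t"
    and colloc: "collocation_condition t0 T hmax c u"
  shows "{t0..t0+T} \<subseteq> closure (regular_times t0 T u)"
proof
  fix t assume t: "t \<in> {t0..t0+T}"
  show "t \<in> closure (regular_times t0 T u)"
  proof (rule ccontr)
    assume "t \<notin> closure (regular_times t0 T u)"
    then obtain r where r: "r > 0" "\<And>t'. t' \<in> regular_times t0 T u \<Longrightarrow> \<not> dist t' t < r"
      unfolding closure_approachable by blast
    define p q where "p = max t0 (t - r / 2)" and "q = min (t0 + T) (t + r / 2)"
    have pq: "t0 \<le> p" "p < q" "q \<le> t0 + T" using T t r(1) by (auto simp: p_def q_def)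
    have degenerate: "\<exists>\<alpha> :: real ^ 's. \<alpha> \<noteq> 0 \<and> (\<forall>k<CARD('s). (\<Sum>j\<in>UNIV. \<alpha> $ j * G j (k + 2) t') = 0)"
      if t': "t' \<in> {p..q}" for t'
    proof -
      have "dist t' t < r" using t' r(1) by (auto simp: p_def q_def dist_real_def)
      then have "t' \<notin> regular_times t0 T u" using r(2) by blast
      then show ?thesis using t' pq by (auto simp: regular_times_jet[OF G])
    qed
    have "jet (CARD('s)) {p..q} (\<lambda>k. G j (k + 2))" for j
      by (rule jet_shift, rule jet_subset, rule jet_mono, rule G(1)) auto
    from vanishing_wronskian_imp_dependent[OF this pq(2) degenerate]
    obtain p' q' and \<alpha> :: "real ^ 's" where "p \<le> p'" "p' < q'" "q' \<le> q" "\<alpha> \<noteq> 0"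
      "\<And>t. t \<in> {p'..q'} \<Longrightarrow> (\<Sum>j\<in>UNIV. \<alpha> $ j * G j (0 + 2) t) = 0" by blast
    then show False
      using collocation_condition_imp_independent[OF colloc, of p' q' \<alpha>] pq jet_d2(2)[OF G(1) _ G(2)] by (simp add: numeral_2_eq_2)
  qed
qed

section \<open>Quadrature weights and collocation nodes\<close>

lemma moment_pCons_0: "moment I (pCons 0 p) = moment (\<lambda>k. I (Suc k)) p"
proof -
  have "moment I (pCons 0 p) = (\<Sum>k\<le>Suc (degree p). coeff (pCons 0 p) k * I k)"
    by (intro moment_superset degree_pCons_le)
  then show ?thesis by (simp add: moment_def sum.atMost_Suc_shift del: sum.atMost_Suc)
qed

text \<open>The primitive that vanishes at 0. Keeping it a polynomial lets iterated integrals be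
  handled through coefficients and degrees.\<close>

definition antideriv :: "real poly \<Rightarrow> real poly" where
  "antideriv p = (\<Sum>k\<le>degree p. monom (coeff p k / real (Suc k)) (Suc k))"

lemma coeff_antideriv: "coeff (antideriv p) k = (case k of 0 \<Rightarrow> 0 | Suc n \<Rightarrow> coeff p n / real (Suc n))"
  unfolding antideriv_def coeff_sum
  by (cases k) (auto simp: if_distrib[of "\<lambda>x. x / _"] coeff_eq_0 not_le cong: if_cong)

lemma degree_antideriv: "degree (antideriv p) \<le> Suc (degree p)"
  by (rule degree_le) (auto simp: coeff_antideriv coeff_eq_0 split: nat.split)

lemma pderiv_antideriv: "pderiv (antideriv p) = p"
  by (rule poly_eqI) (simp add: coeff_pderiv coeff_antideriv del: of_nat_Suc)

lemma moment_antideriv: "moment I (antideriv p) = moment (\<lambda>k. I (Suc k) / real (Suc k)) p"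
proof -
  have "moment I (antideriv p) = (\<Sum>k\<le>Suc (degree p). coeff (antideriv p) k * I k)"
    by (intro moment_superset degree_antideriv)
  also have "\<dots> = (\<Sum>k\<le>degree p. coeff p k / real (Suc k) * I (Suc k))"
    by (simp only: sum.atMost_Suc_shift coeff_antideriv) simp
  finally show ?thesis by (simp add: moment_def)
qed

lemma poly_eq_moment: "poly p x = moment (\<lambda>k. x ^ k) p"
  by (simp add: moment_def poly_altdef)

lemma has_integral_poly:
  assumes "a \<le> b"
  shows "(poly p has_integral poly (antideriv p) b - poly (antideriv p) a) {a..b}"
proof (rule fundamental_theorem_of_calculus[OF assms])
  fix x
  show "(poly (antideriv p) has_vector_derivative poly p x) (at x within {a..b})"
    unfolding has_real_derivative_iff_has_vector_derivative[symmetric]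
    by (metis poly_DERIV pderiv_antideriv DERIV_subset subset_UNIV)
qed

lemma poly_antideriv_0 [simp]: "poly (antideriv p) 0 = 0"
  by (simp add: poly_0_coeff_0 coeff_antideriv)

lemma integral_poly_from_0: "0 \<le> x \<Longrightarrow> integral {0..x} (poly p) = poly (antideriv p) x"
  using has_integral_poly[of 0 x p] by (simp add: integral_unique)

lemma moment_unit_interval: "moment (\<lambda>k. 1 / (real k + 1)) p = integral {0..1} (poly p)"
  using integral_poly_from_0[of 1 p] by (simp add: poly_eq_moment moment_antideriv add.commute)

section \<open>Interpolatory quadrature at the nodes\<close>

definition node_poly :: "real ^ 's::finite \<Rightarrow> real poly" where
  "node_poly c = (\<Prod>i\<in>UNIV. [:- c $ i, 1:])"

lemma poly_node_poly: "poly (node_poly c) x = (\<Prod>i\<in>UNIV. (x - c $ i))"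
  by (simp add: node_poly_def poly_prod)

lemma poly_node_poly_node [simp]: "poly (node_poly c) (c $ i) = 0"
  by (auto simp: poly_node_poly intro: exI[of _ i])

lemma degree_node_poly: "degree (node_poly (c :: real ^ 's::finite)) = CARD('s)"
  unfolding node_poly_def by (subst degree_prod_eq_sum_degree) auto

lemma lead_coeff_node_poly: "lead_coeff (node_poly c) = 1"
  by (simp add: node_poly_def lead_coeff_prod)

lemma ex_quadrature_weights:
  fixes c :: "real ^ 's::finite"
  assumes "inj (\<lambda>i. c $ i)"
  shows "\<exists>w :: real ^ 's. \<forall>k<CARD('s). (\<Sum>i\<in>UNIV. w $ i * (c $ i) ^ k) = I k"
proof -
  have "\<exists>C>0. \<forall>t\<in>{0::real}.
      (\<forall>w :: real ^ 's. norm w \<le> C * (\<Sum>k<CARD('s). \<bar>\<Sum>i\<in>UNIV. w $ i * (c $ i) ^ k\<bar>)) \<and>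
      (\<forall>v. \<exists>w :: real ^ 's. \<forall>k<CARD('s). (\<Sum>i\<in>UNIV. w $ i * (c $ i) ^ k) = v k)"
    using vandermonde_injective[OF assms] by (intro square_system) auto
  then show ?thesis by auto
qed

text \<open>On multiples of the node polynomial the quadrature sum is 0, so orthogonality of
  \<open>I\<close> is orthogonality of the error functional, to which \<open>moments_vanish\<close>
  applies.\<close>

lemma quadrature_exact:
  fixes c w :: "real ^ 's::finite"
  assumes w: "\<And>k. k < CARD('s) \<Longrightarrow> (\<Sum>i\<in>UNIV. w $ i * (c $ i) ^ k) = I k"
    and orth: "\<And>j. j < r \<Longrightarrow> moment I (monom 1 j * node_poly c) = 0"
    and m: "m < CARD('s) + r"
  shows "(\<Sum>i\<in>UNIV. w $ i * (c $ i) ^ m) = I m"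
proof -
  have "coeff (node_poly c) CARD('s) = 1"
    using lead_coeff_node_poly[of c] by (simp add: degree_node_poly)
  then have "I m - (\<Sum>i\<in>UNIV. w $ i * (c $ i) ^ m) = 0"
    using w orth m
    by - (rule moments_vanish[of "node_poly c" "\<lambda>k. I k - (\<Sum>i\<in>UNIV. w $ i * (c $ i) ^ k)" r],
          auto simp: moment_quadrature degree_node_poly)
  then show ?thesis by simp
qed

text \<open>The error functional kills degrees below s, so its value at x^s equals its value on the
  monic node polynomial, where the quadrature sum vanishes.\<close>

lemma quadrature_defect:
  fixes c w :: "real ^ 's::finite"
  assumes w: "\<And>k. k < CARD('s) \<Longrightarrow> (\<Sum>i\<in>UNIV. w $ i * (c $ i) ^ k) = I k"
  shows "I CARD('s) - (\<Sum>i\<in>UNIV. w $ i * (c $ i) ^ CARD('s)) = moment I (node_poly c)"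
proof -
  let ?\<epsilon> = "\<lambda>k. I k - (\<Sum>i\<in>UNIV. w $ i * (c $ i) ^ k)"
  have "moment ?\<epsilon> (node_poly c) = coeff (node_poly c) CARD('s) * ?\<epsilon> CARD('s)
      + (\<Sum>k<CARD('s). coeff (node_poly c) k * ?\<epsilon> k)"
    by (simp add: moment_def degree_node_poly lessThan_Suc_atMost[symmetric])
  also have "(\<Sum>k<CARD('s). coeff (node_poly c) k * ?\<epsilon> k) = 0"
    using w by (intro sum.neutral) auto
  also have "coeff (node_poly c) CARD('s) = 1"
    using lead_coeff_node_poly[of c] by (simp add: degree_node_poly)
  finally show ?thesis by (simp add: moment_quadrature)
qed

lemma quadrature_poly:
  fixes c w :: "real ^ 's::finite"
  assumes "\<And>m. m \<le> degree p \<Longrightarrow> (\<Sum>i\<in>UNIV. w $ i * (c $ i) ^ m) = I m"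
  shows "(\<Sum>i\<in>UNIV. w $ i * poly p (c $ i)) = moment I p"
proof -
  have "moment (\<lambda>k. I k - (\<Sum>i\<in>UNIV. w $ i * (c $ i) ^ k)) p = 0"
    unfolding moment_def using assms by (intro sum.neutral) auto
  then show ?thesis by (simp add: moment_quadrature)
qed

text \<open>The integral of x^k over 1 < x < t, integrated in turn over 1 < t < 1 + \<open>\<xi>\<close>.\<close>

abbreviation stage_moment :: "real \<Rightarrow> nat \<Rightarrow> real" where
  "stage_moment \<xi> \<equiv> \<lambda>k. ((1 + \<xi>) ^ (k + 2) - 1 - \<xi> * (real k + 2)) / ((real k + 1) * (real k + 2))"

locale superconvergent_nodes =
  fixes c :: "real ^ 's::finite"
  assumes c_inj: "inj (\<lambda>i. c $ i)"
    and triple: "integral {0..1} (\<lambda>x. integral {0..1+x} (\<lambda>t. integral {0..t} (\<lambda>\<xi>. \<Prod>i\<in>UNIV. (\<xi> - c $ i)))) = 0"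
    and orth: "\<And>k :: nat. k \<in> {0, 1, 2} \<Longrightarrow> integral {0..1} (\<lambda>\<xi>. \<xi> ^ k * (\<Prod>i\<in>UNIV. (\<xi> - c $ i))) = 0"
begin

lemma moment_d_orth:
  assumes "j < 3"
  shows "moment (\<lambda>k. 1 / (real k + 1)) (monom 1 j * node_poly c) = 0"
proof -
  have "j \<in> {0, 1, 2}" using assms by auto
  moreover have "poly (monom 1 j * node_poly c) = (\<lambda>\<xi>. \<xi> ^ j * (\<Prod>i\<in>UNIV. (\<xi> - c $ i)))"
    by (simp add: fun_eq_iff poly_monom poly_node_poly)
  ultimately show ?thesis using orth[of j] by (simp only: moment_unit_interval)
qed

text \<open>The value functional has kernel 1 - x, which uses up one degree: three orthogonality
  conditions for the kernel 1 become two for this one.\<close>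

lemma moment_b_orth:
  assumes "j < 2"
  shows "moment (\<lambda>k. 1 / ((real k + 1) * (real k + 2))) (monom 1 j * node_poly c) = 0"
proof -
  let ?p = "monom 1 j * node_poly c"
  have "1 / ((real k + 1) * (real k + 2)) = 1 / (real k + 1) - 1 / (real (Suc k) + 1)" for k
  proof -
    have "real k + 1 \<noteq> 0" "real k + 2 \<noteq> 0" by linarith+
    then show ?thesis by (simp add: field_simps)
  qed
  then have "moment (\<lambda>k. 1 / ((real k + 1) * (real k + 2))) ?p
      = moment (\<lambda>k. 1 / (real k + 1)) ?p - moment (\<lambda>k. 1 / (real (Suc k) + 1)) ?p"
    by (simp add: moment_def right_diff_distrib sum_subtractf del: of_nat_Suc)
  also have "moment (\<lambda>k. 1 / (real (Suc k) + 1)) ?p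
      = moment (\<lambda>k. 1 / (real k + 1)) (monom 1 (Suc j) * node_poly c)"
    by (simp add: moment_pCons_0 monom_Suc)
  finally show ?thesis using assms moment_d_orth[of j] moment_d_orth[of "Suc j"] by simp
qed

text \<open>With P the double primitive of the node polynomial, the stage functional takes the value
  P(1 + \<xi>) - P(1) - \<xi> P'(1) on it. The orthogonality conditions give P(1) = P'(1) = 0, so
  only the first term is left.\<close>

lemma stage_defect:
  assumes w: "\<And>k. k < CARD('s) \<Longrightarrow> (\<Sum>i\<in>UNIV. w $ i * (c $ i) ^ k) = stage_moment \<xi> k"
  shows "stage_moment \<xi> CARD('s) - (\<Sum>i\<in>UNIV. w $ i * (c $ i) ^ CARD('s))
    = poly (antideriv (antideriv (node_poly c))) (1 + \<xi>)"
proof -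
  let ?p = "node_poly c"
  have P2: "poly (antideriv (antideriv ?p)) x = moment (\<lambda>k. x ^ (k + 2) / ((real k + 1) * (real k + 2))) ?p" for x
    by (simp add: poly_eq_moment moment_antideriv mult.commute add.commute)
  have split: "stage_moment \<xi> k = (1 + \<xi>) ^ (k + 2) / ((real k + 1) * (real k + 2))
      - 1 / ((real k + 1) * (real k + 2)) - \<xi> * (1 / (real k + 1))" for k
  proof -
    have "real k + 1 \<noteq> 0" "real k + 2 \<noteq> 0" by linarith+
    then show ?thesis by (simp add: diff_divide_distrib)
  qed
  have "moment (stage_moment \<xi>) ?p = poly (antideriv (antideriv ?p)) (1 + \<xi>)
      - moment (\<lambda>k. 1 / ((real k + 1) * (real k + 2))) ?p - \<xi> * moment (\<lambda>k. 1 / (real k + 1)) ?p"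
    unfolding P2 split
    by (simp add: moment_def right_diff_distrib sum_subtractf sum_distrib_left mult_ac)
  also have "\<dots> = poly (antideriv (antideriv ?p)) (1 + \<xi>)"
    using moment_b_orth[of 0] moment_d_orth[of 0] by (simp add: monom_0)
  finally show ?thesis using quadrature_defect[of w c "stage_moment \<xi>"] w by simp
qed

lemma weighted_stage_defects:
  assumes d: "\<And>m. m < CARD('s) + 3 \<Longrightarrow> (\<Sum>i\<in>UNIV. d $ i * (c $ i) ^ m) = 1 / (real m + 1)"
    and a: "\<And>i k. k < CARD('s) \<Longrightarrow> (\<Sum>j\<in>UNIV. a i $ j * (c $ j) ^ k) = stage_moment (c $ i) k"
  shows "(\<Sum>i\<in>UNIV. d $ i * (stage_moment (c $ i) CARD('s) - (\<Sum>j\<in>UNIV. a i $ j * (c $ j) ^ CARD('s)))) = 0"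
proof -
  let ?P2 = "antideriv (antideriv (node_poly c))"
  define q where "q = pcompose ?P2 [:1, 1:]"
  have q: "poly q x = poly ?P2 (1 + x)" for x by (simp add: q_def poly_pcompose)
  have "degree q \<le> degree ?P2 * 1" unfolding q_def by (rule order_trans[OF degree_pcompose_le]) simp
  also have "\<dots> \<le> CARD('s) + 2"
    using degree_antideriv[of "antideriv (node_poly c)"] degree_antideriv[of "node_poly c"]
    by (simp add: degree_node_poly)
  finally have deg: "degree q < CARD('s) + 3" by simp
  have "(\<Sum>i\<in>UNIV. d $ i * (stage_moment (c $ i) CARD('s) - (\<Sum>j\<in>UNIV. a i $ j * (c $ j) ^ CARD('s))))
      = (\<Sum>i\<in>UNIV. d $ i * poly q (c $ i))"
    by (intro sum.cong refl) (simp only: stage_defect[OF a] q)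
  also have "\<dots> = moment (\<lambda>k. 1 / (real k + 1)) q"
    by (rule quadrature_poly) (use d deg in auto)
  also have "\<dots> = integral {0..1} (poly q)" by (rule moment_unit_interval)
  also have "\<dots> = integral {0..1} (\<lambda>x. integral {0..1+x} (\<lambda>t. integral {0..t} (\<lambda>\<xi>. \<Prod>i\<in>UNIV. (\<xi> - c $ i))))"
  proof (rule integral_cong)
    fix x :: real assume x: "x \<in> {0..1}"
    have "integral {0..1+x} (\<lambda>t. integral {0..t} (\<lambda>\<xi>. \<Prod>i\<in>UNIV. (\<xi> - c $ i)))
        = integral {0..1+x} (poly (antideriv (node_poly c)))"
      by (rule integral_cong) (simp add: integral_poly_from_0[symmetric] poly_node_poly[abs_def])
    also have "\<dots> = poly q x" using x by (simp add: integral_poly_from_0 q)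
    finally show "poly q x = integral {0..1+x} (\<lambda>t. integral {0..t} (\<lambda>\<xi>. \<Prod>i\<in>UNIV. (\<xi> - c $ i)))" ..
  qed
  finally show ?thesis using triple by simp
qed

end

section \<open>Consistency of one step\<close>

text \<open>The jets of the basis are required on the whole line as well, so that they agree with
  the two-sided \<open>deriv\<close> in the method's equations, also at the end points of the
  interval.\<close>

locale feptrkn_step = fitted_step F h t0 "t0 + len" K \<tau> c G + superconvergent_nodes c
  for F :: "'x filter" and h and t0 len K \<tau> and c :: "real ^ 's::finite" and G +
  fixes hmax u A b d
  assumes hmax: "0 < hmax"
    and fitted: "feptrkn_method t0 len hmax c u A b d"
    and G_UNIV: "\<And>j. jet (CARD('s) + 5) UNIV (G j)"
    and G_0: "\<And>j t. G j 0 t = u j t"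
    and \<tau>h: "\<forall>\<^sub>F x in F. \<tau> x + h x \<in> {t0..t0 + len}"
begin

definition value_increment :: "(nat \<Rightarrow> real \<Rightarrow> real) \<Rightarrow> 'x \<Rightarrow> real" where
  "value_increment Y x = (Y 0 (\<tau> x + h x) - Y 0 (\<tau> x) - h x * Y 1 (\<tau> x)) / (h x)\<^sup>2"

definition derivative_increment :: "(nat \<Rightarrow> real \<Rightarrow> real) \<Rightarrow> 'x \<Rightarrow> real" where
  "derivative_increment Y x = (Y 1 (\<tau> x + h x) - Y 1 (\<tau> x)) / h x"

definition stage_increment :: "(nat \<Rightarrow> real \<Rightarrow> real) \<Rightarrow> 's \<Rightarrow> 'x \<Rightarrow> real" where
  "stage_increment Y i x = (Y 0 (\<tau> x + h x + c $ i * h x) - Y 0 (\<tau> x + h x)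
     - h x * c $ i * Y 1 (\<tau> x + h x)) / (h x)\<^sup>2"

definition stage_constant :: "'s \<Rightarrow> real" where
  "stage_constant i = poly (antideriv (antideriv (node_poly c))) (1 + c $ i)"

text \<open>Upgrades invertibility from almost every h to every small h, uniformly for base times in
  K; without it the coefficients along the filter could be arbitrary.\<close>

lemma eventually_invertible:
  "\<forall>\<^sub>F x in F. invertible (collocation_matrix c u (\<tau> x) (h x))"
  using fitted_matrix_injective
proof eventually_elim
  case (elim x)
  let ?M = "collocation_matrix c u (\<tau> x) (h x)"
  have M: "?M $ i $ j = V (G j) i x" for i j
    by (simp add: collocation_matrix_def at_stages_def jet_d2(2)[OF G_UNIV _ G_0])
  have "w = 0" if "transpose ?M *v w = 0" for w
  proof -
    have "(\<Sum>i\<in>UNIV. w $ i * V (G j) i x) = 0" for j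
      using that by (simp add: vec_eq_iff matrix_vector_mult_def transpose_def M mult.commute)
    with elim show "w = 0" by blast
  qed
  then have "invertible (transpose ?M)"
    unfolding invertible_left_inverse matrix_left_invertible_ker by blast
  then show ?case using transpose_invertible[of "transpose ?M"] by simp
qed

lemma eventually_exact:
  "\<forall>\<^sub>F x in F. \<forall>j. value_increment (G j) x = (\<Sum>i\<in>UNIV. b (\<tau> x) (h x) $ i * V (G j) i x)"
  "\<forall>\<^sub>F x in F. \<forall>j. derivative_increment (G j) x = (\<Sum>i\<in>UNIV. d (\<tau> x) (h x) $ i * V (G j) i x)"
  "\<forall>\<^sub>F x in F. \<forall>j. stage_increment (G j) k x = (\<Sum>i\<in>UNIV. A (\<tau> x) (h x) $ k $ i * V (G j) i x)"
proof -
  have "\<forall>\<^sub>F x in F. h x < hmax" using h_lim hmax by (rule order_tendstoD)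
  with eventually_invertible h_pos \<tau>h \<tau>_in have "\<forall>\<^sub>F x in F.
     (\<forall>j. value_increment (G j) x = (\<Sum>i\<in>UNIV. b (\<tau> x) (h x) $ i * V (G j) i x)) \<and>
     (\<forall>j. derivative_increment (G j) x = (\<Sum>i\<in>UNIV. d (\<tau> x) (h x) $ i * V (G j) i x)) \<and>
     (\<forall>j. stage_increment (G j) k x = (\<Sum>i\<in>UNIV. A (\<tau> x) (h x) $ k $ i * V (G j) i x))"
  proof eventually_elim
    case (elim x)
    let ?t = "\<tau> x" and ?h = "h x"
    \<comment> \<open>The base time is strictly below the right end point because \<tau> + h is
      still in the interval and h > 0.\<close>
    have "?t \<in> {t0..<t0 + len}" "?h \<in> {0<..hmax}" using elim by auto
    with fitted elim(1) have eqs: "u j (?t + ?h) = u j ?t + ?h * deriv (u j) ?t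
                 + ?h\<^sup>2 * (b ?t ?h \<bullet> at_stages c (d2 (u j)) ?t ?h)"
      "deriv (u j) (?t + ?h) = deriv (u j) ?t + ?h * (d ?t ?h \<bullet> at_stages c (d2 (u j)) ?t ?h)"
      "at_stages c (u j) (?t + ?h) ?h
               = vec (u j (?t + ?h)) + (?h * deriv (u j) (?t + ?h)) *\<^sub>R c
                 + ?h\<^sup>2 *\<^sub>R (A ?t ?h *v at_stages c (d2 (u j)) ?t ?h)" for j
      unfolding feptrkn_method_def by blast+
    have der: "deriv (u j) = G j 1" "d2 (u j) = G j 2" for j
      using jet_d2[OF G_UNIV _ G_0] by simp_all
    have stages: "at_stages c (G j 2) ?t ?h = (\<chi> i. V (G j) i x)" for j
      by (simp add: at_stages_def)
    have "value_increment (G j) x = (\<Sum>i\<in>UNIV. b ?t ?h $ i * V (G j) i x)" for j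
      using eqs(1)[of j] elim(2) by (simp add: value_increment_def G_0 der stages inner_vec_def)
    moreover have "derivative_increment (G j) x = (\<Sum>i\<in>UNIV. d ?t ?h $ i * V (G j) i x)" for j
      using eqs(2)[of j] elim(2) by (simp add: derivative_increment_def der stages inner_vec_def)
    moreover have "stage_increment (G j) k x = (\<Sum>i\<in>UNIV. A ?t ?h $ k $ i * V (G j) i x)" for j
    proof -
      have "at_stages c (u j) (?t + ?h) ?h $ k
               = (vec (u j (?t + ?h)) + (?h * deriv (u j) (?t + ?h)) *\<^sub>R c
                 + ?h\<^sup>2 *\<^sub>R (A ?t ?h *v at_stages c (d2 (u j)) ?t ?h)) $ k"
        by (simp only: eqs(3))
      then show ?thesis
        using elim(2) by (simp add: stage_increment_def G_0 der stages matrix_vector_mult_def at_stages_def)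
    qed
    ultimately show ?case by blast
  qed
  then show "\<forall>\<^sub>F x in F. \<forall>j. value_increment (G j) x = (\<Sum>i\<in>UNIV. b (\<tau> x) (h x) $ i * V (G j) i x)"
    "\<forall>\<^sub>F x in F. \<forall>j. derivative_increment (G j) x = (\<Sum>i\<in>UNIV. d (\<tau> x) (h x) $ i * V (G j) i x)"
    "\<forall>\<^sub>F x in F. \<forall>j. stage_increment (G j) k x = (\<Sum>i\<in>UNIV. A (\<tau> x) (h x) $ k $ i * V (G j) i x)"
    by (auto elim: eventually_mono)
qed

lemma value_increment_expansion:
  assumes "jet (CARD('s) + 5) {t0..t0 + len} Y"
  shows "(\<lambda>x. value_increment Y x - (\<Sum>k<CARD('s) + 3. T Y k x * h x ^ k * (1 / ((real k + 1) * (real k + 2)))))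
    \<in> Oh (CARD('s) + 3)"
  unfolding value_increment_def
  by (rule expand_value_increment[OF _ \<tau>_in \<tau>h]) (use assms in \<open>simp add: add.commute\<close>)

lemma derivative_increment_expansion:
  assumes "jet (CARD('s) + 5) {t0..t0 + len} Y"
  shows "(\<lambda>x. derivative_increment Y x - (\<Sum>k<CARD('s) + 3. T Y k x * h x ^ k * (1 / (real k + 1))))
    \<in> Oh (CARD('s) + 3)"
  unfolding derivative_increment_def
  by (rule expand_derivative_increment[OF _ \<tau>_in \<tau>h]) (use assms in \<open>simp add: add.commute\<close>)

lemma stage_increment_expansion:
  assumes "jet (CARD('s) + 5) {t0..t0 + len} Y" "\<forall>\<^sub>F x in F. \<tau> x + h x + c $ i * h x \<in> {t0..t0 + len}"
  shows "(\<lambda>x. stage_increment Y i x - (\<Sum>k<CARD('s) + 3. T Y k x * h x ^ k * stage_moment (c $ i) k))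
    \<in> Oh (CARD('s) + 3)"
  unfolding stage_increment_def
  by (rule expand_stage_increment[OF _ \<tau>_in \<tau>h assms(2)]) (use assms(1) in \<open>simp add: add.commute\<close>)

lemma Oh_weights_bounded:
  assumes "(\<lambda>x. norm (w x - w0)) \<in> Oh (r + 1)"
  shows "(\<lambda>x. w x $ i - w0 $ i) \<in> Oh 1" "(\<lambda>x. w x $ i) \<in> O[F](\<lambda>_. 1)"
proof -
  have "(\<lambda>x. (w x - w0) $ i) \<in> Oh 1"
    by (rule Oh_le[OF Oh_mono[OF assms]], simp, intro always_eventually allI,
        simp only: abs_norm_cancel component_le_norm_cart)
  then show 1: "(\<lambda>x. w x $ i - w0 $ i) \<in> Oh 1" by simp
  have "(\<lambda>x. (w x $ i - w0 $ i) + w0 $ i) \<in> Oh 0"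
    by (intro sum_in_bigo Oh_mono[OF 1]) auto
  then show "(\<lambda>x. w x $ i) \<in> O[F](\<lambda>_. 1)" by simp
qed

lemma d_exact_weights:
  obtains d0 :: "real ^ 's" where
    "\<And>m. m < CARD('s) + 3 \<Longrightarrow> (\<Sum>i\<in>UNIV. d0 $ i * (c $ i) ^ m) = 1 / (real m + 1)"
    "(\<lambda>x. norm (d (\<tau> x) (h x) - d0)) \<in> Oh (3 + 1)"
proof -
  obtain d0 :: "real ^ 's" where d0: "\<And>k. k < CARD('s) \<Longrightarrow> (\<Sum>i\<in>UNIV. d0 $ i * (c $ i) ^ k) = 1 / (real k + 1)"
    using ex_quadrature_weights[OF c_inj, of "\<lambda>k. 1 / (real k + 1)"] by blast
  have exact: "(\<Sum>i\<in>UNIV. d0 $ i * (c $ i) ^ m) = 1 / (real m + 1)" if "m < CARD('s) + 3" for m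
    by (rule quadrature_exact[OF d0 moment_d_orth that])
  show ?thesis
    by (rule that[OF exact fitted_weights[OF derivative_increment_expansion[OF G] exact order_refl eventually_exact(2)]])
qed

lemma b_exact_weights:
  obtains b0 :: "real ^ 's" where
    "\<And>m. m < CARD('s) + 2 \<Longrightarrow> (\<Sum>i\<in>UNIV. b0 $ i * (c $ i) ^ m) = 1 / ((real m + 1) * (real m + 2))"
    "(\<lambda>x. norm (b (\<tau> x) (h x) - b0)) \<in> Oh (2 + 1)"
proof -
  obtain b0 :: "real ^ 's" where b0: "\<And>k. k < CARD('s) \<Longrightarrow>
      (\<Sum>i\<in>UNIV. b0 $ i * (c $ i) ^ k) = 1 / ((real k + 1) * (real k + 2))"
    using ex_quadrature_weights[OF c_inj, of "\<lambda>k. 1 / ((real k + 1) * (real k + 2))"] by blast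
  have exact: "(\<Sum>i\<in>UNIV. b0 $ i * (c $ i) ^ m) = 1 / ((real m + 1) * (real m + 2))" if "m < CARD('s) + 2" for m
    by (rule quadrature_exact[OF b0 moment_b_orth that])
  show ?thesis
    by (rule that[OF exact fitted_weights[OF value_increment_expansion[OF G] exact _ eventually_exact(1)]]) auto
qed

lemma A_exact_weights:
  assumes "\<forall>\<^sub>F x in F. \<tau> x + h x + c $ k * h x \<in> {t0..t0 + len}"
  obtains a0 :: "real ^ 's" where
    "\<And>m. m < CARD('s) \<Longrightarrow> (\<Sum>i\<in>UNIV. a0 $ i * (c $ i) ^ m) = stage_moment (c $ k) m"
    "(\<lambda>x. norm (A (\<tau> x) (h x) $ k - a0)) \<in> Oh (0 + 1)"
proof -
  obtain a0 :: "real ^ 's" where a0: "\<And>m. m < CARD('s) \<Longrightarrow>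
      (\<Sum>i\<in>UNIV. a0 $ i * (c $ i) ^ m) = stage_moment (c $ k) m"
    using ex_quadrature_weights[OF c_inj, of "stage_moment (c $ k)"] by blast
  have exact: "(\<Sum>i\<in>UNIV. a0 $ i * (c $ i) ^ m) = stage_moment (c $ k) m" if "m < CARD('s) + 0" for m
    using a0 that by simp
  show ?thesis
    by (rule that[OF a0 fitted_weights[OF stage_increment_expansion[OF G assms] exact _ eventually_exact(3)]]) auto
qed

text \<open>The stage constants are recognized as quadrature defects of auxiliary weights, so that
  the triple integral condition applies to the limit \<open>d0\<close>. Keeping only a deviation
  O(h) of the weights from \<open>d0\<close> is enough for the product with the leading stage
  error.\<close>

lemma d_defect_weighted:
  obtains d0 :: "real ^ 's" where "(\<Sum>i\<in>UNIV. d0 $ i * stage_constant i) = 0"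
    "\<And>i. (\<lambda>x. d (\<tau> x) (h x) $ i - d0 $ i) \<in> Oh 1" "\<And>i. (\<lambda>x. d (\<tau> x) (h x) $ i) \<in> O[F](\<lambda>_. 1)"
proof -
  obtain d0 :: "real ^ 's" where
    d0: "\<And>m. m < CARD('s) + 3 \<Longrightarrow> (\<Sum>i\<in>UNIV. d0 $ i * (c $ i) ^ m) = 1 / (real m + 1)"
    "(\<lambda>x. norm (d (\<tau> x) (h x) - d0)) \<in> Oh (3 + 1)"
    by (rule d_exact_weights) blast
  have "\<exists>a :: real ^ 's. \<forall>k<CARD('s). (\<Sum>j\<in>UNIV. a $ j * (c $ j) ^ k) = stage_moment (c $ i) k" for i
    by (rule ex_quadrature_weights[OF c_inj])
  then have "\<exists>a :: 's \<Rightarrow> real ^ 's. \<forall>i. \<forall>k<CARD('s). (\<Sum>j\<in>UNIV. a i $ j * (c $ j) ^ k) = stage_moment (c $ i) k"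
    by (intro choice allI)
  then obtain a :: "'s \<Rightarrow> real ^ 's" where
    a: "\<And>i k. k < CARD('s) \<Longrightarrow> (\<Sum>j\<in>UNIV. a i $ j * (c $ j) ^ k) = stage_moment (c $ i) k"
    by blast
  have "(\<Sum>i\<in>UNIV. d0 $ i * stage_constant i) = 0"
    using weighted_stage_defects[OF d0(1) a] by (simp only: stage_defect[OF a] stage_constant_def)
  then show ?thesis using Oh_weights_bounded[OF d0(2)] by (rule that)
qed

lemma b_bounded: "(\<lambda>x. b (\<tau> x) (h x) $ i) \<in> O[F](\<lambda>_. 1)"
  by (rule b_exact_weights) (rule Oh_weights_bounded)

lemma A_bounded:
  assumes "\<forall>\<^sub>F x in F. \<tau> x + h x + c $ k * h x \<in> {t0..t0 + len}"
  shows "(\<lambda>x. A (\<tau> x) (h x) $ k $ i) \<in> O[F](\<lambda>_. 1)"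
  by (rule A_exact_weights[OF assms]) (rule Oh_weights_bounded)

text \<open>Local residuals for exact stage values, at the scale of the second derivative: the
  increments are already divided by h^2, and for the derivative by h. For b the exponent s + 2 comes
  from exactness below degree s + 2, for d exactness allows s + 3, and for A the term of order s is
  kept, with one factor \<open>D\<close> for all stages.\<close>

lemma consistency:
  assumes Y: "jet (CARD('s) + 5) {t0..t0 + len} Y"
  shows "(\<lambda>x. value_increment Y x - (\<Sum>i\<in>UNIV. b (\<tau> x) (h x) $ i * V Y i x)) \<in> Oh (CARD('s) + 2)" (is ?b)
    "(\<lambda>x. derivative_increment Y x - (\<Sum>i\<in>UNIV. d (\<tau> x) (h x) $ i * V Y i x)) \<in> Oh (CARD('s) + 3)" (is ?d)
    "\<exists>D. D \<in> O[F](\<lambda>_. 1) \<and> (\<forall>k. (\<forall>\<^sub>F x in F. \<tau> x + h x + c $ k * h x \<in> {t0..t0 + len}) \<longrightarrow>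
       (\<lambda>x. stage_increment Y k x - (\<Sum>i\<in>UNIV. A (\<tau> x) (h x) $ k $ i * V Y i x)
          - D x * h x ^ CARD('s) * stage_constant k) \<in> Oh (CARD('s) + 1))" (is ?A)
proof -
  obtain D where D: "\<And>m. m < CARD('s) + 3 \<Longrightarrow> D m \<in> O[F](\<lambda>_. 1)"
    and res: "\<And>I J JY w0 w r n.
       (\<And>j. (\<lambda>x. J j x - (\<Sum>m<CARD('s) + 3. T (G j) m x * h x ^ m * I m)) \<in> Oh (CARD('s) + 3)) \<Longrightarrow>
       (\<lambda>x. JY x - (\<Sum>m<CARD('s) + 3. T Y m x * h x ^ m * I m)) \<in> Oh (CARD('s) + 3) \<Longrightarrow>
       (\<And>m. m < CARD('s) + r \<Longrightarrow> (\<Sum>i\<in>UNIV. w0 $ i * (c $ i) ^ m) = I m) \<Longrightarrow> r \<le> 3 \<Longrightarrow>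
       \<forall>\<^sub>F x in F. \<forall>j. J j x = (\<Sum>i\<in>UNIV. w x $ i * V (G j) i x) \<Longrightarrow>
       n \<le> CARD('s) + 3 \<Longrightarrow> n \<le> CARD('s) + r + 1 \<Longrightarrow>
       (\<lambda>x. (JY x - (\<Sum>i\<in>UNIV. w x $ i * V Y i x))
          - (\<Sum>m<CARD('s) + 3. D m x * h x ^ m * (I m - (\<Sum>i\<in>UNIV. w0 $ i * (c $ i) ^ m)))) \<in> Oh n"
    using fitted_residual[OF Y] by blast
  have tail: "(\<lambda>x. \<Sum>m<CARD('s) + 3. D m x * h x ^ m * \<epsilon> m) \<in> Oh q"
    if "\<And>m. m < q \<Longrightarrow> \<epsilon> m = 0" "q \<le> CARD('s) + 3" for \<epsilon> q
    by (rule expansion_order[where g = D and m = \<epsilon> and n = "CARD('s) + 3"]) (use D that in auto)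
  have drop_tail: "B \<in> Oh q"
    if "(\<lambda>x. B x - (\<Sum>m<CARD('s) + 3. D m x * h x ^ m * \<epsilon> m)) \<in> Oh q"
      "\<And>m. m < q \<Longrightarrow> \<epsilon> m = 0" "q \<le> CARD('s) + 3" for B \<epsilon> q
  proof -
    have "(\<lambda>x. \<Sum>m<CARD('s) + 3. D m x * h x ^ m * \<epsilon> m) \<in> Oh q"
      by (rule tail) (use that in auto)
    from sum_in_bigo(1)[OF that(1) this] show ?thesis by simp
  qed
  obtain b0 :: "real ^ 's" where
    b0: "\<And>m. m < CARD('s) + 2 \<Longrightarrow> (\<Sum>i\<in>UNIV. b0 $ i * (c $ i) ^ m) = 1 / ((real m + 1) * (real m + 2))"
    by (rule b_exact_weights) blast
  have "(\<lambda>x. (value_increment Y x - (\<Sum>i\<in>UNIV. b (\<tau> x) (h x) $ i * V Y i x))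
          - (\<Sum>m<CARD('s) + 3. D m x * h x ^ m * (1 / ((real m + 1) * (real m + 2)) - (\<Sum>i\<in>UNIV. b0 $ i * (c $ i) ^ m))))
     \<in> Oh (CARD('s) + 2)"
    by (rule res[where r = 2, OF value_increment_expansion[OF G] value_increment_expansion[OF Y] b0 _ eventually_exact(1)]) auto
  then show ?b by (rule drop_tail) (use b0 in simp_all)
  obtain d0 :: "real ^ 's" where
    d0: "\<And>m. m < CARD('s) + 3 \<Longrightarrow> (\<Sum>i\<in>UNIV. d0 $ i * (c $ i) ^ m) = 1 / (real m + 1)"
    by (rule d_exact_weights) blast
  have "(\<lambda>x. (derivative_increment Y x - (\<Sum>i\<in>UNIV. d (\<tau> x) (h x) $ i * V Y i x))
          - (\<Sum>m<CARD('s) + 3. D m x * h x ^ m * (1 / (real m + 1) - (\<Sum>i\<in>UNIV. d0 $ i * (c $ i) ^ m))))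
     \<in> Oh (CARD('s) + 3)"
    by (rule res[where r = 3, OF derivative_increment_expansion[OF G] derivative_increment_expansion[OF Y] d0 _ eventually_exact(2)]) auto
  then show ?d by (rule drop_tail) (use d0 in simp_all)
  show ?A
  proof (intro exI conjI allI impI)
    show "D CARD('s) \<in> O[F](\<lambda>_. 1)" using D by simp
    fix k assume inside: "\<forall>\<^sub>F x in F. \<tau> x + h x + c $ k * h x \<in> {t0..t0 + len}"
    obtain a0 :: "real ^ 's" where
      a0: "\<And>m. m < CARD('s) \<Longrightarrow> (\<Sum>i\<in>UNIV. a0 $ i * (c $ i) ^ m) = stage_moment (c $ k) m"
      by (rule A_exact_weights[OF inside]) blast
    then have a0': "\<And>m. m < CARD('s) + 0 \<Longrightarrow> (\<Sum>i\<in>UNIV. a0 $ i * (c $ i) ^ m) = stage_moment (c $ k) m"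
      by simp
    define \<epsilon> where "\<epsilon> m = stage_moment (c $ k) m - (\<Sum>i\<in>UNIV. a0 $ i * (c $ i) ^ m)" for m
    have "(\<lambda>x. (stage_increment Y k x - (\<Sum>i\<in>UNIV. A (\<tau> x) (h x) $ k $ i * V Y i x))
          - (\<Sum>m<CARD('s) + 3. D m x * h x ^ m * \<epsilon> m)) \<in> Oh (CARD('s) + 1)"
      unfolding \<epsilon>_def
      by (rule res[where r = 0, OF stage_increment_expansion[OF G inside] stage_increment_expansion[OF Y inside] a0' _ eventually_exact(3)]) auto
    \<comment> \<open>Moments below s are exact, so removing the index s from the defect leaves only
      terms of order s + 1 and higher; the removed term is the one with the stage constant.\<close>
    moreover have "(\<lambda>x. \<Sum>m<CARD('s) + 3. D m x * h x ^ m * (if m \<le> CARD('s) then 0 else \<epsilon> m)) \<in> Oh (CARD('s) + 1)"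
      by (rule tail) auto
    ultimately have "(\<lambda>x. (stage_increment Y k x - (\<Sum>i\<in>UNIV. A (\<tau> x) (h x) $ k $ i * V Y i x))
          - (\<Sum>m<CARD('s) + 3. D m x * h x ^ m * \<epsilon> m)
          + (\<Sum>m<CARD('s) + 3. D m x * h x ^ m * (if m \<le> CARD('s) then 0 else \<epsilon> m))) \<in> Oh (CARD('s) + 1)"
      by (rule sum_in_bigo)
    moreover have "(\<Sum>m<CARD('s) + 3. D m x * h x ^ m * \<epsilon> m)
        = (\<Sum>m<CARD('s) + 3. D m x * h x ^ m * (if m \<le> CARD('s) then 0 else \<epsilon> m))
          + D CARD('s) x * h x ^ CARD('s) * stage_constant k" for x
    proof -
      have "stage_constant k = \<epsilon> CARD('s)"
        using stage_defect[OF a0] by (simp add: \<epsilon>_def stage_constant_def)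
      moreover have "(\<Sum>m<CARD('s) + 3. D m x * h x ^ m * \<epsilon> m)
        = (\<Sum>m<CARD('s) + 3. D m x * h x ^ m * (if m \<le> CARD('s) then 0 else \<epsilon> m)
          + (if m = CARD('s) then D m x * h x ^ m * \<epsilon> m else 0))"
        using a0 by (intro sum.cong) (auto simp: \<epsilon>_def)
      ultimately show ?thesis by (simp add: sum.distrib)
    qed
    ultimately show "(\<lambda>x. stage_increment Y k x - (\<Sum>i\<in>UNIV. A (\<tau> x) (h x) $ k $ i * V Y i x)
          - D CARD('s) x * h x ^ CARD('s) * stage_constant k) \<in> Oh (CARD('s) + 1)"
      by (simp add: algebra_simps)
  qed
qed

end

section \<open>Dependence on the stage values\<close>

text \<open>Provides one compact set of regular times that contains both t and t - h for t in K and
  all small h, so that the estimates of the preceding step are uniform too.\<close>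

lemma compact_subset_openin_enlarge:
  fixes S :: "'a::heine_borel set"
  assumes R: "openin (top_of_set S) R" and S: "compact S" and K: "compact K" "K \<subseteq> R"
  obtains K' e where "compact K'" "K' \<subseteq> R" "e > 0"
    "\<And>t t'. t \<in> K \<Longrightarrow> t' \<in> S \<Longrightarrow> dist t' t \<le> e \<Longrightarrow> t' \<in> K'"
proof (cases "K = {}")
  case True
  then show ?thesis by (intro that[of "{}" 1]) auto
next
  case False
  obtain U where U: "open U" "R = S \<inter> U" using R by (auto simp: openin_open)
  obtain e where e: "e > 0" "{x. infdist x K \<le> e} \<subseteq> U"
    using compact_in_open_separated[OF False K(1) U(1)] K(2) U(2) by blast
  show ?thesis
  proof (rule that[of "S \<inter> {x. infdist x K \<le> e}" e])
    show "compact (S \<inter> {x. infdist x K \<le> e})"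
      by (intro compact_Int S compact_infdist_le False K(1) e(1))
    show "t' \<in> S \<inter> {x. infdist x K \<le> e}" if "t \<in> K" "t' \<in> S" "dist t' t \<le> e" for t t'
      using that infdist_le2[OF that(1,3)] by auto
  qed (use e U in auto)
qed

text \<open>\<open>D t\<close> is the partial derivative of f in its second argument along the
  solution. It is Lipschitz in t because the derivative is jointly Lipschitz and the solution is
  Lipschitz.\<close>

lemma rhs_linearization:
  assumes f: "smooth_rhs t0 T f" and H: "jet N {t0..t0 + T} H" and N: "1 \<le> N"
  obtains D C where "C \<ge> 0"
    "\<And>t v. t \<in> {t0..t0+T} \<Longrightarrow> \<bar>v - H 0 t\<bar> \<le> 1 \<Longrightarrow>
       \<bar>f t v - f t (H 0 t) - D t * (v - H 0 t)\<bar> \<le> C * (v - H 0 t)\<^sup>2"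
    "\<And>t t'. t \<in> {t0..t0+T} \<Longrightarrow> t' \<in> {t0..t0+T} \<Longrightarrow> \<bar>D t' - D t\<bar> \<le> C * \<bar>t' - t\<bar>"
proof -
  let ?S = "{t0..t0+T}"
  obtain fy where fy: "\<And>t v. t \<in> ?S \<Longrightarrow> (f t has_real_derivative fy t v) (at v)"
    and lip: "\<And>R. \<exists>L. L-lipschitz_on (?S \<times> {-R..R}) (\<lambda>(t, v). fy t v)"
    using f unfolding smooth_rhs_def by blast
  obtain B0 where B0: "\<And>t. t \<in> ?S \<Longrightarrow> \<bar>H 0 t\<bar> \<le> B0" using jet_bounded[OF H, of 0] by blast
  obtain B1 where B1: "\<And>t. t \<in> ?S \<Longrightarrow> \<bar>H 1 t\<bar> \<le> B1" using jet_bounded[OF H N] by blast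
  \<comment> \<open>The radius B0 + 1 covers the tube of width 1 around the solution, in which the
    linearization is claimed.\<close>
  obtain L where L: "L-lipschitz_on (?S \<times> {-(B0 + 1)..B0 + 1}) (\<lambda>(t, v). fy t v)" using lip by blast
  have L_nonneg: "0 \<le> L" by (rule lipschitz_on_nonneg[OF L])
  have fy_lip: "\<bar>fy t v - fy t' v'\<bar> \<le> L * (\<bar>t - t'\<bar> + \<bar>v - v'\<bar>)"
    if "t \<in> ?S" "t' \<in> ?S" "\<bar>v\<bar> \<le> B0 + 1" "\<bar>v'\<bar> \<le> B0 + 1" for t t' v v'
  proof -
    have "dist (fy t v) (fy t' v') \<le> L * dist (t, v) (t', v')"
      using lipschitz_onD[OF L, of "(t, v)" "(t', v')"] that by (auto simp: abs_le_iff)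
    also have "\<dots> \<le> L * (\<bar>t - t'\<bar> + \<bar>v - v'\<bar>)"
      using norm_Pair_le[of "t - t'" "v - v'"] L_nonneg by (intro mult_left_mono) (auto simp: dist_norm)
    finally show ?thesis by (simp add: dist_real_def)
  qed
  have y_lip: "\<bar>H 0 t' - H 0 t\<bar> \<le> B1 * \<bar>t' - t\<bar>" if "t \<in> ?S" "t' \<in> ?S" for t t'
  proof -
    have "norm (H 0 t' - H 0 t) \<le> B1 * norm (t' - t)"
    proof (rule field_differentiable_bound[of ?S])
      show "(H 0 has_real_derivative H 1 z) (at z within ?S)" if "z \<in> ?S" for z
        using H N that unfolding jet_def by auto
    qed (use that B1 in auto)
    then show ?thesis by simp
  qed
  define C where "C = L * (1 + \<bar>B1\<bar>)"
  have "C \<ge> 0" "L \<le> C" using L_nonneg by (auto simp: C_def algebra_simps)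
  show ?thesis
  proof (rule that[of C "\<lambda>t. fy t (H 0 t)"])
    fix t v assume t: "t \<in> ?S" and v: "\<bar>v - H 0 t\<bar> \<le> 1"
    define w where "w = H 0 t"
    let ?I = "cball w \<bar>v - w\<bar>"
    \<comment> \<open>Subtracting the linear part leaves a derivative bounded by L |v - w| between w
      and v; the mean value inequality then gives the quadratic remainder.\<close>
    let ?g = "\<lambda>z. f t z - fy t w * z"
    have "norm (?g v - ?g w) \<le> (L * \<bar>v - w\<bar>) * norm (v - w)"
    proof (rule field_differentiable_bound[of ?I ?g "\<lambda>z. fy t z - fy t w"])
      fix z assume z: "z \<in> ?I"
      show "(?g has_real_derivative fy t z - fy t w) (at z within ?I)"
        by (rule has_field_derivative_at_within) (auto intro!: derivative_eq_intros fy[OF t])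
      have "\<bar>z - w\<bar> \<le> \<bar>v - w\<bar>" using z by (simp add: dist_real_def abs_minus_commute)
      moreover have "\<bar>w\<bar> \<le> B0 + 1" "\<bar>z\<bar> \<le> B0 + 1"
        using calculation v B0[OF t] by (auto simp: w_def)
      ultimately show "norm (fy t z - fy t w) \<le> L * \<bar>v - w\<bar>"
        using fy_lip[OF t t, of z w] L_nonneg mult_left_mono[of "\<bar>z - w\<bar>" "\<bar>v - w\<bar>" L] by simp
    qed (auto simp: dist_real_def)
    then have "\<bar>f t v - f t w - fy t w * (v - w)\<bar> \<le> L * (v - w)\<^sup>2"
      by (simp add: algebra_simps power2_eq_square abs_mult_self_eq flip: abs_mult)
    also have "\<dots> \<le> C * (v - w)\<^sup>2" using \<open>L \<le> C\<close> by (intro mult_right_mono) auto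
    finally show "\<bar>f t v - f t (H 0 t) - fy t (H 0 t) * (v - H 0 t)\<bar> \<le> C * (v - H 0 t)\<^sup>2"
      by (simp add: w_def)
  next
    fix t t' assume t: "t \<in> ?S" "t' \<in> ?S"
    have "\<bar>fy t' (H 0 t') - fy t (H 0 t)\<bar> \<le> L * (\<bar>t' - t\<bar> + \<bar>H 0 t' - H 0 t\<bar>)"
      using fy_lip[OF t(2,1)] B0[OF t(1)] B0[OF t(2)] by simp
    also have "\<dots> \<le> L * (\<bar>t' - t\<bar> + \<bar>B1\<bar> * \<bar>t' - t\<bar>)"
      using y_lip[OF t] L_nonneg
      by (intro mult_left_mono add_left_mono) (auto intro: order_trans[OF _ mult_right_mono[of B1]])
    finally show "\<bar>fy t' (H 0 t') - fy t (H 0 t)\<bar> \<le> C * \<bar>t' - t\<bar>"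
      by (simp add: C_def algebra_simps)
  qed (rule \<open>C \<ge> 0\<close>)
qed

section \<open>Propagation of stage errors through the right-hand side\<close>

context small_step
begin

lemma Oh_norm:
  fixes v :: "'x \<Rightarrow> real ^ 's::finite"
  assumes "\<And>i. (\<lambda>x. v x $ i) \<in> Oh n"
  shows "(\<lambda>x. norm (v x)) \<in> Oh n"
proof (rule Oh_le)
  show "(\<lambda>x. \<Sum>i\<in>UNIV. \<bar>v x $ i\<bar>) \<in> Oh n" using assms by (intro big_sum_in_bigo) simp
  have "norm (v x) \<le> (\<Sum>i\<in>UNIV. \<bar>v x $ i\<bar>)" for x by (rule norm_le_l1_cart)
  then show "\<forall>\<^sub>F x in F. \<bar>norm (v x)\<bar> \<le> \<bar>\<Sum>i\<in>UNIV. \<bar>v x $ i\<bar>\<bar>"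
    by (intro always_eventually allI) (simp add: order_trans[OF _ abs_ge_self])
qed

text \<open>Freezing the derivative at the base time gives all stages the same factor
  \<open>D (\<tau> x)\<close>. The price is the square of the error and h times the error, each at
  least one power of h smaller than the error itself.\<close>

lemma rhs_error:
  assumes C: "C \<ge> 0"
    and lin: "\<And>t v. t \<in> {a..b} \<Longrightarrow> \<bar>v - Y t\<bar> \<le> 1 \<Longrightarrow>
       \<bar>f t v - f t (Y t) - D t * (v - Y t)\<bar> \<le> C * (v - Y t)\<^sup>2"
    and D: "\<And>t t'. t \<in> {a..b} \<Longrightarrow> t' \<in> {a..b} \<Longrightarrow> \<bar>D t' - D t\<bar> \<le> C * \<bar>t' - t\<bar>"
    and \<tau>: "\<forall>\<^sub>F x in F. \<tau> x \<in> {a..b}" and \<xi>: "\<forall>\<^sub>F x in F. \<tau> x + \<xi> * h x \<in> {a..b}"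
    and e: "(\<lambda>x. Y (\<tau> x + \<xi> * h x) - W x) \<in> Oh (Suc n)"
  shows "(\<lambda>x. f (\<tau> x + \<xi> * h x) (Y (\<tau> x + \<xi> * h x)) - f (\<tau> x + \<xi> * h x) (W x)
     - D (\<tau> x) * (Y (\<tau> x + \<xi> * h x) - W x)) \<in> Oh (Suc (Suc n))"
proof -
  define e where "e x = Y (\<tau> x + \<xi> * h x) - W x" for x
  have e': "e \<in> Oh (Suc n)" using e by (simp add: e_def[abs_def])
  have "(\<lambda>x. e x * e x) \<in> Oh (Suc (Suc n))" by (rule Oh_mono[OF Oh_mult[OF e' e']]) simp
  then have sq: "(\<lambda>x. C * \<bar>e x * e x\<bar>) \<in> Oh (Suc (Suc n))" by simp
  have "(\<lambda>x. h x ^ 1 * e x) \<in> Oh (Suc (Suc n))" using Oh_mult[OF Oh_power[of 1] e'] by simp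
  then have lip: "(\<lambda>x. (C * \<bar>\<xi>\<bar>) * \<bar>h x ^ 1 * e x\<bar>) \<in> Oh (Suc (Suc n))"
    by (intro Oh_cmult) simp
  have "\<forall>\<^sub>F x in F. \<bar>e x\<bar> < 1"
    using tendsto_rabs[OF Oh_tendsto_0[OF e']] by (rule order_tendstoD) simp
  with \<tau> \<xi> have "\<forall>\<^sub>F x in F. \<bar>f (\<tau> x + \<xi> * h x) (Y (\<tau> x + \<xi> * h x)) - f (\<tau> x + \<xi> * h x) (W x) - D (\<tau> x) * e x\<bar>
      \<le> \<bar>C * \<bar>e x * e x\<bar> + (C * \<bar>\<xi>\<bar>) * \<bar>h x ^ 1 * e x\<bar>\<bar>"
  proof eventually_elim
    case (elim x)
    let ?t = "\<tau> x + \<xi> * h x"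
    have W: "W x = Y ?t - e x" by (simp add: e_def)
    have "\<bar>f ?t (W x) - f ?t (Y ?t) - D ?t * (W x - Y ?t)\<bar> \<le> C * (W x - Y ?t)\<^sup>2"
      using elim by (intro lin) (auto simp: W)
    then have 1: "\<bar>f ?t (W x) - f ?t (Y ?t) + D ?t * e x\<bar> \<le> C * \<bar>e x * e x\<bar>"
      by (simp add: W power2_eq_square)
    have "\<bar>D ?t - D (\<tau> x)\<bar> \<le> C * \<bar>\<xi> * h x\<bar>" using D[OF elim(1,2)] by simp
    then have "\<bar>D ?t - D (\<tau> x)\<bar> * \<bar>e x\<bar> \<le> C * \<bar>\<xi> * h x\<bar> * \<bar>e x\<bar>" by (rule mult_right_mono) simp
    then have 2: "\<bar>(D ?t - D (\<tau> x)) * e x\<bar> \<le> (C * \<bar>\<xi>\<bar>) * \<bar>h x ^ 1 * e x\<bar>"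
      by (simp add: abs_mult mult_ac)
    have "f ?t (Y ?t) - f ?t (W x) - D (\<tau> x) * e x
        = - (f ?t (W x) - f ?t (Y ?t) + D ?t * e x) + (D ?t - D (\<tau> x)) * e x"
      by (simp add: algebra_simps)
    with 1 2 show ?case by linarith
  qed
  from Oh_le[OF sum_in_bigo(1)[OF sq lip] this] show ?thesis by (simp add: e_def)
qed

end

section \<open>The filter of small steps\<close>

lemma small_steps_snd: "filterlim snd (at_right 0) (small_steps S)"
  unfolding small_steps_def by (rule filterlim_mono[OF filterlim_filtercomap order_refl inf_le1])

lemma eventually_small_steps_mem: "\<forall>\<^sub>F x in small_steps S. x \<in> S"
  unfolding small_steps_def by (simp add: eventually_inf_principal)

lemma small_steps_mono: "S \<subseteq> S' \<Longrightarrow> small_steps S \<le> small_steps S'"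
  unfolding small_steps_def by (intro inf_mono) auto

lemma small_step_small_steps: "small_step (small_steps S) snd"
proof
  show "\<forall>\<^sub>F x in small_steps S. 0 < snd x"
    using small_steps_snd[of S] unfolding filterlim_at_right_to_0
    by (auto simp: filterlim_at elim: eventually_mono)
  show "(snd \<longlongrightarrow> 0) (small_steps S)"
    using small_steps_snd[of S] by (simp add: filterlim_at)
qed

text \<open>Derivatives within a nondegenerate interval are unique even at its end points, so the
  jet of y must agree with the derivatives supplied by the differential equation.\<close>

lemma solves_ivp_jet:
  assumes T: "0 < T" and sol: "solves_ivp t0 T f y0 dy0 y dy"
    and H: "jet N {t0..t0+T} H" "2 \<le> N" "\<And>t. t \<in> {t0..t0+T} \<Longrightarrow> H 0 t = y t"
    and t: "t \<in> {t0..t0+T}"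
  shows "H 1 t = dy t" "H 2 t = f t (y t)"
proof -
  let ?S = "{t0..t0+T}"
  have unique: "E = E'"
    if "t \<in> ?S" "\<And>t. t \<in> ?S \<Longrightarrow> v t = w t" "(v has_real_derivative E) (at t within ?S)"
      "(w has_real_derivative E') (at t within ?S)" for v w :: "real \<Rightarrow> real" and E E' t
  proof (rule vector_derivative_unique_within_closed_interval[of t0 "t0 + T" t v])
    show "(v has_vector_derivative E') (at t within cbox t0 (t0 + T))"
      using has_vector_derivative_transform[of t ?S v w E'] that
      by (simp add: has_real_derivative_iff_has_vector_derivative)
  qed (use T that in \<open>auto simp: has_real_derivative_iff_has_vector_derivative\<close>)
  have dH: "(H j has_real_derivative H (Suc j) t) (at t within ?S)" if "j < 2" "t \<in> ?S" for j t
    using H(1,2) that unfolding jet_def by auto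
  have dy: "(y has_real_derivative dy t) (at t within ?S)" "(dy has_real_derivative f t (y t)) (at t within ?S)"
    if "t \<in> ?S" for t
    using sol that unfolding solves_ivp_def by auto
  have 1: "H 1 t = dy t" if "t \<in> ?S" for t
    using unique[OF that H(3) dH[of 0] dy(1)] that by simp
  show "H 1 t = dy t" by (rule 1[OF t])
  show "H 2 t = f t (y t)"
    using unique[OF t 1 dH[of 1] dy(2)] t by (simp add: numeral_2_eq_2)
qed

section \<open>Order of the method\<close>

text \<open>The third order s + 1 allows stage errors O(h^(s+2)), the size that one step produces
  from exact data; the first two are s + 3 because the leading part of that error cancels or meets a
  factor h^2.\<close>

lemma has_orders_feptrkn:
  fixes c :: "real ^ 's::finite" and u :: "'s \<Rightarrow> real \<Rightarrow> real"
  assumes T: "0 < T"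
    and adm: "admissible_rhs t0 T f" and smooth: "smooth_rhs t0 T f"
    and sol: "solves_ivp t0 T f y0 dy0 y dy"
    and H: "jet (CARD('s) + 5) {t0..t0+T} H" "\<And>t. t \<in> {t0..t0+T} \<Longrightarrow> H 0 t = y t"
    and G: "\<And>j. jet (CARD('s) + 5) UNIV (G j)" "\<And>j t. G j 0 t = u j t"
    and nodes: "superconvergent_nodes c"
    and hmax: "0 < hmax" and fitted: "feptrkn_method t0 T hmax c u A b d"
    and K: "compact K" "K \<subseteq> regular_times t0 T u"
  shows "has_orders t0 T f y dy c A b d K (CARD('s) + 3) (CARD('s) + 3) (CARD('s) + 1)"
proof -
  let ?S = "{t0..t0+T}" and ?n = "CARD('s)"
  define F where "F = small_steps (step_pairs t0 T c K)"
  define F' where "F' = small_steps (stage_pairs t0 T c K)"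
  have F'_le: "F' \<le> F"
    unfolding F_def F'_def by (rule small_steps_mono) (auto simp: stage_pairs_def)
  interpret small_step F snd unfolding F_def by (rule small_step_small_steps)
  interpret F': small_step F' snd unfolding F'_def by (rule small_step_small_steps)
  obtain K' e where K': "compact K'" "K' \<subseteq> regular_times t0 T u" and e: "e > 0"
    and near: "\<And>t t'. t \<in> K \<Longrightarrow> t' \<in> ?S \<Longrightarrow> dist t' t \<le> e \<Longrightarrow> t' \<in> K'"
    using compact_subset_openin_enlarge[OF openin_regular_times[where G = G and u = u, OF G] compact_Icc K] by blast
  have K'_sub: "K' \<subseteq> ?S" using K'(2) by (auto simp: regular_times_def)
  have regular: "\<alpha> = 0" if "t \<in> K'" "\<And>k. k < ?n \<Longrightarrow> (\<Sum>j\<in>UNIV. \<alpha> $ j * G j (k + 2) t) = 0"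
    for t and \<alpha> :: "real ^ 's"
    using that K'(2) by (auto simp: regular_times_jet[where G = G and u = u, OF G])
  have G': "jet (?n + 5) ?S (G j)" for j by (rule jet_subset[OF G(1)]) simp
  have F_mem: "\<forall>\<^sub>F x in F. x \<in> step_pairs t0 T c K" unfolding F_def by (rule eventually_small_steps_mem)
  have F'_mem: "\<forall>\<^sub>F x in F'. x \<in> stage_pairs t0 T c K" unfolding F'_def by (rule eventually_small_steps_mem)
  have h_e: "\<forall>\<^sub>F x in F. snd x < e" using h_lim e by (rule order_tendstoD)
  have in_K': "\<forall>\<^sub>F x in F. fst x - snd x \<in> K'" "\<forall>\<^sub>F x in F. fst x \<in> K'"
  proof -
    have "\<forall>\<^sub>F x in F. fst x - snd x \<in> K' \<and> fst x \<in> K'"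
      using F_mem h_e h_pos
    proof eventually_elim
      case (elim x)
      then have "fst x \<in> K" "fst x - snd x \<in> ?S" "fst x \<in> ?S"
        by (auto simp: step_pairs_def)
      then show ?case using near[of "fst x" "fst x - snd x"] near[of "fst x" "fst x"] elim e
        by (auto simp: dist_real_def)
    qed
    then show "\<forall>\<^sub>F x in F. fst x - snd x \<in> K'" "\<forall>\<^sub>F x in F. fst x \<in> K'" by (auto elim: eventually_mono)
  qed
  have F_in: "\<forall>\<^sub>F x in F. \<forall>i. fst x - snd x + c $ i * snd x \<in> ?S" "\<forall>\<^sub>F x in F. \<forall>i. fst x + c $ i * snd x \<in> ?S"
    "\<forall>\<^sub>F x in F. fst x + snd x \<in> ?S" "\<forall>\<^sub>F x in F. fst x \<in> ?S" "\<forall>\<^sub>F x in F. fst x - snd x \<in> ?S"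
  proof -
    have "\<forall>\<^sub>F x in F. (\<forall>i. fst x - snd x + c $ i * snd x \<in> ?S) \<and> (\<forall>i. fst x + c $ i * snd x \<in> ?S) \<and>
        fst x + snd x \<in> ?S \<and> fst x \<in> ?S \<and> fst x - snd x \<in> ?S"
      using F_mem h_pos by eventually_elim (auto simp: step_pairs_def)
    then show "\<forall>\<^sub>F x in F. \<forall>i. fst x - snd x + c $ i * snd x \<in> ?S" "\<forall>\<^sub>F x in F. \<forall>i. fst x + c $ i * snd x \<in> ?S"
      "\<forall>\<^sub>F x in F. fst x + snd x \<in> ?S" "\<forall>\<^sub>F x in F. fst x \<in> ?S" "\<forall>\<^sub>F x in F. fst x - snd x \<in> ?S"
      by (auto elim: eventually_mono)
  qed
  have F_in_i: "\<forall>\<^sub>F x in F. fst x + c $ i * snd x \<in> ?S" for i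
    using F_in(2) by eventually_elim blast
  have F'_in: "\<forall>\<^sub>F x in F'. \<forall>i. fst x + snd x + c $ i * snd x \<in> ?S"
    using F'_mem by eventually_elim (auto simp: stage_pairs_def)
  have F'_in_i: "\<forall>\<^sub>F x in F'. fst x + snd x + c $ i * snd x \<in> ?S" for i
    using F'_in by eventually_elim blast
  have to_F': "\<forall>\<^sub>F x in F'. P x" if "\<forall>\<^sub>F x in F. P x" for P
    using F'_le that by (rule filter_leD)
  have step: "feptrkn_step FF snd t0 T K' \<tau> c G hmax u A b d"
    if "small_step FF snd" "\<forall>\<^sub>F x in FF. \<tau> x \<in> K'" "\<forall>\<^sub>F x in FF. \<forall>i. \<tau> x + c $ i * snd x \<in> ?S"
      "\<forall>\<^sub>F x in FF. \<tau> x + snd x \<in> ?S" for FF :: "(real \<times> real) filter" and \<tau>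
    by (intro feptrkn_step.intro fitted_step.intro fitted_step_axioms.intro feptrkn_step_axioms.intro that
        superconvergent_nodes.c_inj[OF nodes] nodes G' G K'(1) K'_sub hmax fitted) (rule regular)
  \<comment> \<open>\<open>s1\<close> is the preceding step, based at t - h; \<open>s2\<close> is
    the current step; \<open>s3\<close> is the current step along the finer filter, where its new
    stages may be compared with the solution.\<close>
  interpret s1: feptrkn_step F snd t0 T K' "\<lambda>x. fst x - snd x" c G hmax u A b d
    by (rule step[OF small_step_axioms in_K'(1) F_in(1)]) (use F_in(4) in simp)
  interpret s2: feptrkn_step F snd t0 T K' fst c G hmax u A b d
    by (rule step[OF small_step_axioms in_K'(2) F_in(2,3)])
  interpret s3: feptrkn_step F' snd t0 T K' fst c G hmax u A b d
    by (rule step[OF F'.small_step_axioms to_F'[OF in_K'(2)] to_F'[OF F_in(2)] to_F'[OF F_in(3)]])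
  have H12: "H 1 t = dy t" "H 2 t = f t (y t)" if "t \<in> ?S" for t
    using solves_ivp_jet[OF T sol H(1) _ H(2) that] by simp_all
  obtain Df C where C: "C \<ge> 0"
    and lin: "\<And>t v. t \<in> ?S \<Longrightarrow> \<bar>v - H 0 t\<bar> \<le> 1 \<Longrightarrow>
       \<bar>f t v - f t (H 0 t) - Df t * (v - H 0 t)\<bar> \<le> C * (v - H 0 t)\<^sup>2"
    and Df: "\<And>t t'. t \<in> ?S \<Longrightarrow> t' \<in> ?S \<Longrightarrow> \<bar>Df t' - Df t\<bar> \<le> C * \<bar>t' - t\<bar>"
    by (rule rhs_linearization[OF smooth H(1)]) (simp, blast)
  have Df_bounded: "(\<lambda>x. Df (fst x)) \<in> O[F](\<lambda>_. 1)"
  proof (rule bigoI)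
    show "\<forall>\<^sub>F x in F. norm (Df (fst x)) \<le> (\<bar>Df t0\<bar> + C * T) * norm (1::real)"
      using F_in(4)
    proof eventually_elim
      case (elim x)
      have "\<bar>Df (fst x) - Df t0\<bar> \<le> C * \<bar>fst x - t0\<bar>" using Df[of t0 "fst x"] elim T by simp
      also have "\<dots> \<le> C * T" using elim C by (intro mult_left_mono) auto
      finally show ?case by simp
    qed
  qed
  obtain L where L: "\<And>t. t \<in> ?S \<Longrightarrow> L-lipschitz_on UNIV (f t)"
    using adm unfolding admissible_rhs_def by blast
  show ?thesis
    unfolding has_orders_def Let_def case_prod_unfold F_def[symmetric] F'_def[symmetric]
  proof (intro allI impI)
    fix Z :: "real \<Rightarrow> real \<Rightarrow> real ^ 's"
    assume Z: "(\<lambda>x. norm (at_stages c y (fst x - snd x) (snd x) - Z (fst x) (snd x))) \<in> Oh (?n + 1 + 1)"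
    define Yn where "Yn x = next_stages c A f (fst x - snd x) (snd x) (y (fst x)) (dy (fst x)) (Z (fst x) (snd x))" for x
    \<comment> \<open>\<open>q\<close> are the errors of f at the stages entering the preceding
      step, \<open>\<delta>\<close> the errors of the stages it hands over, and \<open>g\<close> the
      errors of f that these cause in the current step.\<close>
    define q where "q k x = s1.V H k x - f (fst x - snd x + c $ k * snd x) (Z (fst x) (snd x) $ k)" for k x
    define \<delta> where "\<delta> i x = H 0 (fst x + c $ i * snd x) - Yn x $ i" for i x
    define g where "g i x = f (fst x + c $ i * snd x) (H 0 (fst x + c $ i * snd x)) - f (fst x + c $ i * snd x) (Yn x $ i)" for i x
    have q: "q k \<in> Oh (?n + 2)" for k
    proof (rule Oh_le)
      show "(\<lambda>x. L * norm (at_stages c y (fst x - snd x) (snd x) - Z (fst x) (snd x))) \<in> Oh (?n + 2)"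
        using Z by (intro Oh_cmult) simp
      show "\<forall>\<^sub>F x in F. \<bar>q k x\<bar> \<le> \<bar>L * norm (at_stages c y (fst x - snd x) (snd x) - Z (fst x) (snd x))\<bar>"
        using F_in(1)
      proof eventually_elim
        case (elim x)
        let ?t = "fst x - snd x + c $ k * snd x"
        have t: "?t \<in> ?S" using elim by blast
        have "\<bar>q k x\<bar> = dist (f ?t (y ?t)) (f ?t (Z (fst x) (snd x) $ k))"
          using H12(2)[OF t] by (simp add: q_def dist_real_def)
        also have "\<dots> \<le> L * dist (y ?t) (Z (fst x) (snd x) $ k)"
          by (rule lipschitz_onD[OF L[OF t]]) auto
        also have "dist (y ?t) (Z (fst x) (snd x) $ k)
            = \<bar>(at_stages c y (fst x - snd x) (snd x) - Z (fst x) (snd x)) $ k\<bar>"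
          by (simp add: at_stages_def dist_real_def)
        also have "L * \<dots> \<le> L * norm (at_stages c y (fst x - snd x) (snd x) - Z (fst x) (snd x))"
          by (intro mult_left_mono component_le_norm_cart lipschitz_on_nonneg[OF L[OF t]])
        finally show ?case by linarith
      qed
    qed
    have A1: "(\<lambda>x. A (fst x - snd x) (snd x) $ i $ k) \<in> O[F](\<lambda>_. 1)" for i k
      by (rule s1.A_bounded) (use F_in_i[of i] in simp)
    \<comment> \<open>Since the values at t are exact, the new stage error consists of the residual
      of the stage formula for exact stages and of the propagated error \<open>q\<close>; with its
      factor h^2 the latter is O(h^(s+4)).\<close>
    have \<delta>_eq: "\<forall>\<^sub>F x in F. \<delta> i x = (snd x)\<^sup>2 * (s1.stage_increment H i x - (\<Sum>k\<in>UNIV. A (fst x - snd x) (snd x) $ i $ k * s1.V H k x))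
        + (snd x)\<^sup>2 * (\<Sum>k\<in>UNIV. A (fst x - snd x) (snd x) $ i $ k * q k x)" for i
      using F_in(4) h_pos
    proof eventually_elim
      case (elim x)
      have "Yn x $ i = H 0 (fst x) + snd x * c $ i * H 1 (fst x) + (snd x)\<^sup>2 *
          (\<Sum>k\<in>UNIV. A (fst x - snd x) (snd x) $ i $ k * (s1.V H k x - q k x))"
        using H(2)[OF elim(1)] H12(1)[OF elim(1)]
        by (simp add: Yn_def next_stages_def q_def matrix_vector_mult_def rhs_at_stages_def mult_ac)
      then have "\<delta> i x = (snd x)\<^sup>2 * s1.stage_increment H i x - (snd x)\<^sup>2 *
          (\<Sum>k\<in>UNIV. A (fst x - snd x) (snd x) $ i $ k * (s1.V H k x - q k x))"
        using elim(2) by (simp add: \<delta>_def s1.stage_increment_def)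
      then show ?case by (simp add: right_diff_distrib sum_subtractf)
    qed
    obtain D where D: "D \<in> O[F](\<lambda>_. 1)" and inc: "\<And>i. (\<forall>\<^sub>F x in F. fst x - snd x + snd x + c $ i * snd x \<in> ?S) \<Longrightarrow>
        (\<lambda>x. s1.stage_increment H i x - (\<Sum>k\<in>UNIV. A (fst x - snd x) (snd x) $ i $ k * s1.V H k x)
          - D x * snd x ^ ?n * s1.stage_constant i) \<in> Oh (?n + 1)"
      using s1.consistency(3)[OF H(1)] by blast
    have \<delta>_exp: "(\<lambda>x. \<delta> i x - D x * snd x ^ (?n + 2) * s1.stage_constant i) \<in> Oh (?n + 3)" for i
    proof -
      have "(\<lambda>x. s1.stage_increment H i x - (\<Sum>k\<in>UNIV. A (fst x - snd x) (snd x) $ i $ k * s1.V H k x)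
          - D x * snd x ^ ?n * s1.stage_constant i) \<in> Oh (?n + 1)"
        by (rule inc) (use F_in_i[of i] in simp)
      from Oh_mult[OF Oh_power[of 2] this]
      have 1: "(\<lambda>x. snd x ^ 2 * (s1.stage_increment H i x - (\<Sum>k\<in>UNIV. A (fst x - snd x) (snd x) $ i $ k * s1.V H k x)
          - D x * snd x ^ ?n * s1.stage_constant i)) \<in> Oh (?n + 3)" by (rule Oh_mono) simp
      have "(\<lambda>x. \<Sum>k\<in>UNIV. A (fst x - snd x) (snd x) $ i $ k * q k x) \<in> Oh (?n + 2)"
        by (intro big_sum_in_bigo Oh_bounded_mult A1 q)
      from Oh_mult[OF Oh_power[of 2] this]
      have 2: "(\<lambda>x. snd x ^ 2 * (\<Sum>k\<in>UNIV. A (fst x - snd x) (snd x) $ i $ k * q k x)) \<in> Oh (?n + 3)"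
        by (rule Oh_mono) simp
      show ?thesis
        by (rule Oh_eq[OF sum_in_bigo(1)[OF 1 2]], use \<delta>_eq[of i] in eventually_elim)
           (simp add: power_add algebra_simps power2_eq_square)
    qed
    have D_pow: "(\<lambda>x. D x * snd x ^ (?n + 2) * C) \<in> Oh (?n + 2)" for C
      using Oh_cmult[OF Oh_bounded_mult[OF D Oh_power[of "?n + 2"]], of C] by (simp only: mult_ac)
    have \<delta>_order: "\<delta> i \<in> Oh (Suc (?n + 1))" for i
      using sum_in_bigo(1)[OF Oh_mono[OF \<delta>_exp, of "?n + 2" i] D_pow[of "s1.stage_constant i"]] by simp
    have g_lin: "(\<lambda>x. g i x - Df (fst x) * \<delta> i x) \<in> Oh (?n + 3)" for i
      using rhs_error[OF C lin Df F_in(4) F_in_i \<delta>_order[unfolded \<delta>_def]]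
      by (simp add: g_def \<delta>_def numeral_3_eq_3)
    have g_order: "g i \<in> Oh (?n + 2)" for i
    proof -
      have "(\<lambda>x. Df (fst x) * \<delta> i x) \<in> Oh (?n + 2)"
        by (rule Oh_bounded_mult[OF Df_bounded]) (use \<delta>_order[of i] in simp)
      from sum_in_bigo(1)[OF Oh_mono[OF g_lin, of "?n + 2" i] this] show ?thesis by simp
    qed
    obtain d0 :: "real ^ 's" where d0: "(\<Sum>i\<in>UNIV. d0 $ i * s2.stage_constant i) = 0"
      and d_lim: "\<And>i. (\<lambda>x. d (fst x) (snd x) $ i - d0 $ i) \<in> Oh 1"
      and d_bounded: "\<And>i. (\<lambda>x. d (fst x) (snd x) $ i) \<in> O[F](\<lambda>_. 1)"
      by (rule s2.d_defect_weighted) blast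
    \<comment> \<open>The sum is split in four: linearization error, remainder of the stage error,
      deviation of the weights from \<open>d0\<close>, and the leading stage error weighted by
      \<open>d0\<close>. The first three are O(h^(s+3)); the last one vanishes identically.\<close>
    have dg: "(\<lambda>x. \<Sum>i\<in>UNIV. d (fst x) (snd x) $ i * g i x) \<in> Oh (?n + 3)"
    proof -
      have 1: "(\<lambda>x. \<Sum>i\<in>UNIV. d (fst x) (snd x) $ i * (g i x - Df (fst x) * \<delta> i x)) \<in> Oh (?n + 3)"
        by (intro big_sum_in_bigo Oh_bounded_mult d_bounded g_lin)
      have 2: "(\<lambda>x. Df (fst x) * (\<Sum>i\<in>UNIV. d (fst x) (snd x) $ i *
          (\<delta> i x - D x * snd x ^ (?n + 2) * s1.stage_constant i))) \<in> Oh (?n + 3)"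
        by (intro Oh_bounded_mult[OF Df_bounded] big_sum_in_bigo Oh_bounded_mult d_bounded \<delta>_exp)
      have "(\<lambda>x. (d (fst x) (snd x) $ i - d0 $ i) * (D x * snd x ^ (?n + 2) * s1.stage_constant i)) \<in> Oh (?n + 3)" for i
        by (rule Oh_mono[OF Oh_mult[OF d_lim D_pow]]) simp
      then have 3: "(\<lambda>x. Df (fst x) * (\<Sum>i\<in>UNIV. (d (fst x) (snd x) $ i - d0 $ i) *
          (D x * snd x ^ (?n + 2) * s1.stage_constant i))) \<in> Oh (?n + 3)"
        by (intro Oh_bounded_mult[OF Df_bounded] big_sum_in_bigo)
      have "(\<Sum>i\<in>UNIV. d0 $ i * (D x * snd x ^ (?n + 2) * s1.stage_constant i))
          = D x * snd x ^ (?n + 2) * (\<Sum>i\<in>UNIV. d0 $ i * s2.stage_constant i)" for x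
        by (simp add: s1.stage_constant_def s2.stage_constant_def sum_distrib_left mult_ac)
      then have zero: "(\<Sum>i\<in>UNIV. d0 $ i * (D x * snd x ^ (?n + 2) * s1.stage_constant i)) = 0" for x
        by (simp add: d0)
      have "(\<Sum>i\<in>UNIV. d (fst x) (snd x) $ i * g i x)
          = (\<Sum>i\<in>UNIV. d (fst x) (snd x) $ i * (g i x - Df (fst x) * \<delta> i x))
          + Df (fst x) * (\<Sum>i\<in>UNIV. d (fst x) (snd x) $ i * (\<delta> i x - D x * snd x ^ (?n + 2) * s1.stage_constant i))
          + Df (fst x) * (\<Sum>i\<in>UNIV. (d (fst x) (snd x) $ i - d0 $ i) * (D x * snd x ^ (?n + 2) * s1.stage_constant i))
          + Df (fst x) * (\<Sum>i\<in>UNIV. d0 $ i * (D x * snd x ^ (?n + 2) * s1.stage_constant i))" for x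
        unfolding sum_distrib_left sum.distrib[symmetric] by (intro sum.cong refl) (simp add: algebra_simps)
      then show ?thesis using sum_in_bigo(1)[OF sum_in_bigo(1)[OF 1 2] 3] by (simp only: zero mult_zero_right add_0_right)
    qed
    have rhs: "\<forall>\<^sub>F x in F. \<forall>i. f (fst x + c $ i * snd x) (Yn x $ i) = s2.V H i x - g i x"
      using F_in(2) by eventually_elim (simp add: g_def H12(2) H(2))
    define ey where "ey x = y (fst x + snd x) - next_y c b f (fst x) (snd x) (y (fst x)) (dy (fst x)) (Yn x)" for x
    define edy where "edy x = dy (fst x + snd x) - next_dy c d f (fst x) (snd x) (dy (fst x)) (Yn x)" for x
    \<comment> \<open>Here the factor h^2 in front of the weights lifts O(h^(s+2)) to the required
      order without cancellation. The derivative has only one factor h and relies on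
      \<open>dg\<close>.\<close>
    have ey: "ey \<in> Oh (?n + 3 + 1)"
    proof -
      have "(\<lambda>x. \<Sum>i\<in>UNIV. b (fst x) (snd x) $ i * g i x) \<in> Oh (?n + 2)"
        by (intro big_sum_in_bigo Oh_bounded_mult s2.b_bounded g_order)
      from Oh_mult[OF Oh_power[of 2] sum_in_bigo(1)[OF s2.consistency(1)[OF H(1)] this]]
      have "(\<lambda>x. snd x ^ 2 * (s2.value_increment H x - (\<Sum>i\<in>UNIV. b (fst x) (snd x) $ i * s2.V H i x)
          + (\<Sum>i\<in>UNIV. b (fst x) (snd x) $ i * g i x))) \<in> Oh (?n + 3 + 1)" by (rule Oh_mono) simp
      then show ?thesis
      proof (rule Oh_eq)
        show "\<forall>\<^sub>F x in F. ey x = snd x ^ 2 * (s2.value_increment H x - (\<Sum>i\<in>UNIV. b (fst x) (snd x) $ i * s2.V H i x)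
          + (\<Sum>i\<in>UNIV. b (fst x) (snd x) $ i * g i x))"
          using rhs F_in(3,4) h_pos
        proof eventually_elim
          case (elim x)
          have "next_y c b f (fst x) (snd x) (y (fst x)) (dy (fst x)) (Yn x) = H 0 (fst x) + snd x * H 1 (fst x)
              + (snd x)\<^sup>2 * (\<Sum>i\<in>UNIV. b (fst x) (snd x) $ i * (s2.V H i x - g i x))"
            using elim(1) H(2)[OF elim(3)] H12(1)[OF elim(3)]
            by (simp add: next_y_def inner_vec_def rhs_at_stages_def)
          moreover have "(snd x)\<^sup>2 * s2.value_increment H x = y (fst x + snd x) - H 0 (fst x) - snd x * H 1 (fst x)"
            using H(2)[OF elim(2)] elim(4) by (simp add: s2.value_increment_def)
          ultimately show ?case
            by (simp add: ey_def right_diff_distrib sum_subtractf distrib_left)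
        qed
      qed
    qed
    have edy: "edy \<in> Oh (?n + 3 + 1)"
    proof -
      from Oh_mult[OF Oh_power[of 1] sum_in_bigo(1)[OF s2.consistency(2)[OF H(1)] dg]]
      have "(\<lambda>x. snd x ^ 1 * (s2.derivative_increment H x - (\<Sum>i\<in>UNIV. d (fst x) (snd x) $ i * s2.V H i x)
          + (\<Sum>i\<in>UNIV. d (fst x) (snd x) $ i * g i x))) \<in> Oh (?n + 3 + 1)" by (rule Oh_mono) simp
      then show ?thesis
      proof (rule Oh_eq)
        show "\<forall>\<^sub>F x in F. edy x = snd x ^ 1 * (s2.derivative_increment H x - (\<Sum>i\<in>UNIV. d (fst x) (snd x) $ i * s2.V H i x)
          + (\<Sum>i\<in>UNIV. d (fst x) (snd x) $ i * g i x))"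
          using rhs F_in(3,4) h_pos
        proof eventually_elim
          case (elim x)
          have "next_dy c d f (fst x) (snd x) (dy (fst x)) (Yn x) = H 1 (fst x)
              + snd x * (\<Sum>i\<in>UNIV. d (fst x) (snd x) $ i * (s2.V H i x - g i x))"
            using elim(1) H12(1)[OF elim(3)]
            by (simp add: next_dy_def inner_vec_def rhs_at_stages_def)
          moreover have "snd x * s2.derivative_increment H x = dy (fst x + snd x) - H 1 (fst x)"
            using H12(1)[OF elim(2)] elim(4) by (simp add: s2.derivative_increment_def)
          ultimately show ?case
            by (simp add: edy_def right_diff_distrib sum_subtractf distrib_left)
        qed
      qed
    qed
    define Yn1 where "Yn1 x = next_stages c A f (fst x) (snd x)
      (next_y c b f (fst x) (snd x) (y (fst x)) (dy (fst x)) (Yn x))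
      (next_dy c d f (fst x) (snd x) (dy (fst x)) (Yn x)) (Yn x)" for x
    \<comment> \<open>The bottleneck is the stage residual, O(h^s) before the factor h^2; the errors
      inherited from the new value and the new derivative are of higher order.\<close>
    have stages: "(\<lambda>x. (at_stages c y (fst x + snd x) (snd x) - Yn1 x) $ i) \<in> F'.Oh (?n + 1 + 1)" for i
    proof -
      obtain D' where D': "D' \<in> O[F'](\<lambda>_. 1)" and inc': "\<And>i. (\<forall>\<^sub>F x in F'. fst x + snd x + c $ i * snd x \<in> ?S) \<Longrightarrow>
        (\<lambda>x. s3.stage_increment H i x - (\<Sum>k\<in>UNIV. A (fst x) (snd x) $ i $ k * s3.V H k x)
          - D' x * snd x ^ ?n * s3.stage_constant i) \<in> F'.Oh (?n + 1)"
        using s3.consistency(3)[OF H(1)] by blast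
      have "(\<lambda>x. D' x * snd x ^ ?n * s3.stage_constant i) \<in> F'.Oh ?n"
        using F'.Oh_cmult[OF F'.Oh_bounded_mult[OF D' F'.Oh_power[of ?n]], of "s3.stage_constant i"]
        by (simp only: mult_ac)
      from sum_in_bigo(1)[OF F'.Oh_mono[OF inc'[OF F'_in_i], of ?n i] this]
      have 1: "(\<lambda>x. s3.stage_increment H i x - (\<Sum>k\<in>UNIV. A (fst x) (snd x) $ i $ k * s3.V H k x)) \<in> F'.Oh ?n"
        by simp
      have "g k \<in> F'.Oh ?n" for k
        using F'.Oh_mono[OF landau_o.big.filter_mono[OF F'_le g_order[of k]], of ?n] by simp
      then have 2: "(\<lambda>x. \<Sum>k\<in>UNIV. A (fst x) (snd x) $ i $ k * g k x) \<in> F'.Oh ?n"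
        by (intro big_sum_in_bigo F'.Oh_bounded_mult s3.A_bounded F'_in_i)
      have 3: "(\<lambda>x. snd x ^ 2 * (s3.stage_increment H i x - (\<Sum>k\<in>UNIV. A (fst x) (snd x) $ i $ k * s3.V H k x)
          + (\<Sum>k\<in>UNIV. A (fst x) (snd x) $ i $ k * g k x))) \<in> F'.Oh (?n + 1 + 1)"
        by (rule F'.Oh_mono[OF F'.Oh_mult[OF F'.Oh_power[of 2] sum_in_bigo(1)[OF 1 2]]]) simp
      have ey': "ey \<in> F'.Oh (?n + 1 + 1)"
        by (rule F'.Oh_mono[OF landau_o.big.filter_mono[OF F'_le ey]]) simp
      have edy': "edy \<in> F'.Oh (?n + 3 + 1)"
        by (rule landau_o.big.filter_mono[OF F'_le edy])
      have "(\<lambda>x. c $ i * (snd x ^ 1 * edy x)) \<in> F'.Oh (?n + 1 + 1)"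
        by (rule F'.Oh_cmult[OF F'.Oh_mono[OF F'.Oh_mult[OF F'.Oh_power[of 1] edy']]]) simp
      from sum_in_bigo(1)[OF sum_in_bigo(1)[OF ey' this] 3] show ?thesis
      proof (rule F'.Oh_eq)
        show "\<forall>\<^sub>F x in F'. (at_stages c y (fst x + snd x) (snd x) - Yn1 x) $ i
          = ey x + c $ i * (snd x ^ 1 * edy x)
            + snd x ^ 2 * (s3.stage_increment H i x - (\<Sum>k\<in>UNIV. A (fst x) (snd x) $ i $ k * s3.V H k x)
              + (\<Sum>k\<in>UNIV. A (fst x) (snd x) $ i $ k * g k x))"
          using to_F'[OF rhs] to_F'[OF F_in(3)] to_F'[OF h_pos] F'_in
        proof eventually_elim
          case (elim x)
          have "Yn1 x $ i = (y (fst x + snd x) - ey x) + snd x * c $ i * (dy (fst x + snd x) - edy x)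
              + (snd x)\<^sup>2 * (\<Sum>k\<in>UNIV. A (fst x) (snd x) $ i $ k * (s3.V H k x - g k x))"
            using elim(1)
            by (simp add: Yn1_def next_stages_def ey_def edy_def matrix_vector_mult_def rhs_at_stages_def mult_ac)
          moreover have "at_stages c y (fst x + snd x) (snd x) $ i = H 0 (fst x + snd x + c $ i * snd x)"
            using elim(4) H(2) by (simp add: at_stages_def)
          moreover have "(snd x)\<^sup>2 * s3.stage_increment H i x = H 0 (fst x + snd x + c $ i * snd x)
              - y (fst x + snd x) - snd x * c $ i * dy (fst x + snd x)"
            using elim(3) H(2)[OF elim(2)] H12(1)[OF elim(2)] by (simp add: s3.stage_increment_def)
          ultimately show ?case
            by (simp add: right_diff_distrib sum_subtractf distrib_left algebra_simps)
        qed
      qed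
    qed
    show "(\<lambda>x. y (fst x + snd x) - next_y c b f (fst x) (snd x) (y (fst x)) (dy (fst x))
          (next_stages c A f (fst x - snd x) (snd x) (y (fst x)) (dy (fst x)) (Z (fst x) (snd x)))) \<in> Oh (?n + 3 + 1) \<and>
      (\<lambda>x. dy (fst x + snd x) - next_dy c d f (fst x) (snd x) (dy (fst x))
          (next_stages c A f (fst x - snd x) (snd x) (y (fst x)) (dy (fst x)) (Z (fst x) (snd x)))) \<in> Oh (?n + 3 + 1) \<and>
      (\<lambda>x. norm (at_stages c y (fst x + snd x) (snd x) - next_stages c A f (fst x) (snd x)
          (next_y c b f (fst x) (snd x) (y (fst x)) (dy (fst x))
            (next_stages c A f (fst x - snd x) (snd x) (y (fst x)) (dy (fst x)) (Z (fst x) (snd x))))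
          (next_dy c d f (fst x) (snd x) (dy (fst x))
            (next_stages c A f (fst x - snd x) (snd x) (y (fst x)) (dy (fst x)) (Z (fst x) (snd x))))
          (next_stages c A f (fst x - snd x) (snd x) (y (fst x)) (dy (fst x)) (Z (fst x) (snd x))))) \<in> F'.Oh (?n + 1 + 1)"
      using ey edy F'.Oh_norm[OF stages]
      unfolding ey_def[abs_def] edy_def[abs_def] Yn1_def Yn_def by blast
  qed
qed

theorem theorem4p4:
  fixes t0 T hmax y0 dy0 :: real
    and f :: "real \<Rightarrow> real \<Rightarrow> real"
    and y dy :: "real \<Rightarrow> real"
    and c :: "real ^ 's::finite"
    and u :: "'s \<Rightarrow> real \<Rightarrow> real"
    and A :: "real \<Rightarrow> real \<Rightarrow> real ^ 's ^ 's"
    and b d :: "real \<Rightarrow> real \<Rightarrow> real ^ 's"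
  assumes "0 < T"
    and "admissible_rhs t0 T f"
    and "smooth_rhs t0 T f"
    and "solves_ivp t0 T f y0 dy0 y dy"
    and "Ck_on (CARD('s) + 5) {t0..t0+T} y"
    and "\<And>i. Ck_on (CARD('s) + 5) UNIV (u i)"
    and "inj (\<lambda>i. c $ i)"
    and "collocation_condition t0 T hmax c u"
    and "feptrkn_method t0 T hmax c u A b d"
    and "integral {0..1} (\<lambda>x. integral {0..1+x} (\<lambda>t. integral {0..t} (\<lambda>\<xi>. \<Prod>i\<in>UNIV. (\<xi> - c $ i)))) = 0"
    and "\<And>k :: nat. k \<in> {0, 1, 2} \<Longrightarrow> integral {0..1} (\<lambda>\<xi>. \<xi> ^ k * (\<Prod>i\<in>UNIV. (\<xi> - c $ i))) = 0"
  shows "has_step_order t0 T f y dy c A b d (regular_times t0 T u) (CARD('s) + 3)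
       \<and> openin (top_of_set {t0..t0+T}) (regular_times t0 T u)
       \<and> {t0..t0+T} \<subseteq> closure (regular_times t0 T u)"
proof -
  have nodes: "superconvergent_nodes c"
    using assms(7,10,11) by (rule superconvergent_nodes.intro)
  have hmax: "0 < hmax" using assms(8) by (simp add: collocation_condition_def)
  obtain H where H: "jet (CARD('s) + 5) {t0..t0+T} H" "\<And>t. t \<in> {t0..t0+T} \<Longrightarrow> H 0 t = y t"
    by (rule Ck_on_jet[OF assms(5)]) blast
  have "\<exists>G. jet (CARD('s) + 5) UNIV G \<and> (\<forall>t. G 0 t = u j t)" for j
    by (rule Ck_on_jet[OF assms(6)[of j]]) blast
  then obtain G where G: "\<And>j. jet (CARD('s) + 5) UNIV (G j)" "\<And>j t. G j 0 t = u j t"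
    by metis
  have "has_step_order t0 T f y dy c A b d (regular_times t0 T u) (CARD('s) + 3)"
    unfolding has_step_order_def
  proof (intro exI conjI allI impI)
    show "CARD('s) + 3 = min (CARD('s) + 3) (CARD('s) + 3)" by simp
    fix K assume "compact K \<and> K \<subseteq> regular_times t0 T u"
    then show "has_orders t0 T f y dy c A b d K (CARD('s) + 3) (CARD('s) + 3) (CARD('s) + 1)"
      by (intro has_orders_feptrkn[OF assms(1-4) H G nodes hmax assms(9)]) auto
  qed
  then show ?thesis
    using openin_regular_times[where G = G and u = u, OF G] dense_regular_times[where G = G, OF assms(1) G assms(8)] by blast
qed

end
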